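(* Let $N>1$, $p\ge 2$, $s\in(0,1)$, $N>ps$, and let $\Omega\subset\mathbb{R}^N$ be a bounded domain with $C^{1,1}$ boundary. Let $f:\Omega\times\mathbb{R}\to\mathbb{R}$ be a Carathéodory function such that, for some $c_0>0$ and $q\in(p,p_s^* )$, $|f(x,t)|\le c_0(1+|t|^{q-1})$ for a.e. $x\in\Omega$ and all $t\in\mathbb{R}$. Let $(\underline{u},\overline{u})\in\widetilde{W}^{s,p}(\Omega)\times\widetilde{W}^{s,p}(\Omega)$ be a sub-supersolution pair of the problem $$(-\Delta)_p^s u=f(x,u)\ \text{ in }\Omega,\qquad u=0\ \text{ in }\Omega^c.$$ Then $\mathcal{S}(\underline{u},\overline{u})$, with the pointwise a.e. order, is directed: for all $u_1,u_2\in\mathcal{S}(\underline{u},\overline{u})$ there exist $u_3,u_4\in\mathcal{S}(\underline{u},\overline{u})$ such that $u_3\le u_1$, $u_3\le u_2$ and $u_4\ge u_1$, $u_4\ge u_2$.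
   Context: Notation: $\Omega^c=\mathbb{R}^N\setminus\Omega$, $p_s^*=Np/(N-ps)$, $d\mu=|x-y|^{-N-ps}\,dx\,dy$. Inequalities between measurable functions hold almost everywhere. Functions on $\Omega$ are identified with their $0$-extension to $\mathbb{R}^N$. Spaces: $[u]_{s,p}^p=\iint_{\mathbb{R}^N\times\mathbb{R}^N}|u(x)-u(y)|^p\,d\mu$; $W^{s,p}(\mathbb{R}^N)=\{u\in L^p(\mathbb{R}^N):[u]_{s,p}<\infty\}$; $W^{s,p}_0(\Omega)=\{u\in W^{s,p}(\mathbb{R}^N):u=0\text{ in }\Omega^c\}$, normed by $\|u\|_{s,p}=[u]_{s,p}$, with dual $W^{-s,p'}(\Omega)$; $W^{s,p}_0(\Omega)_+$ is the set of its a.e. non-negative elements. For $U\subseteq\mathbb{R}^N$ open, $W^{s,p}(U)$ is the usual fractional Sobolev space ($u\in L^p(U)$ with $\iint_{U\times U}|u(x)-u(y)|^p\,d\mu<\infty$). $\widetilde{W}^{s,p}(\Omega)$ is the space of all $u\in L^p_{\rm loc}(\mathbb{R}^N)$ such that $u\in W^{s,p}(U)$ for some open $U\subseteq\mathbb{R}^N$ with $\overline\Omega\subset U$, and $\int_{\mathbb{R}^N}\frac{|u(x)|^{p-1}}{(1+|x|)^{N+ps}}\,dx<\infty$. Operator: for $u\in\widetilde{W}^{s,p}(\Omega)$, $(-\Delta)_p^su\in W^{-s,p'}(\Omega)$ is defined by $$\langle(-\Delta)_p^su,v\rangle=\iint_{\mathbb{R}^N\times\mathbb{R}^N}|u(x)-u(y)|^{p-2}(u(x)-u(y))(v(x)-v(y))\,d\mu,\quad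 v\in W^{s,p}_0(\Omega).$$ Definitions: $u\in\widetilde{W}^{s,p}(\Omega)$ is a supersolution if $u\ge0$ in $\Omega^c$ and $\langle(-\Delta)_p^su,v\rangle\ge\int_\Omega f(x,u)v\,dx$ for all $v\in W^{s,p}_0(\Omega)_+$; it is a subsolution if $u\le0$ in $\Omega^c$ and $\langle(-\Delta)_p^su,v\rangle\le\int_\Omega f(x,u)v\,dx$ for all $v\in W^{s,p}_0(\Omega)_+$. $u\in W^{s,p}_0(\Omega)$ is a solution if $\langle(-\Delta)_p^su,v\rangle=\int_\Omega f(x,u)v\,dx$ for all $v\in W^{s,p}_0(\Omega)$. $(\underline{u},\overline{u})$ is a sub-supersolution pair if $\underline{u}$ is a subsolution, $\overline{u}$ is a supersolution, and $\underline{u}\le\overline{u}$ in $\Omega$. For such a pair, $\mathcal{S}(\underline{u},\overline{u})=\{u\in W^{s,p}_0(\Omega):u\text{ is a solution},\ \underline{u}\le u\le\overline{u}\}$. *)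

theory Defs
  imports "HOL-Analysis.Analysis"
begin

text \<open>The space \<open>\<real>\<^sup>N\<close> is an arbitrary Euclidean space \<open>'a\<close> with \<open>N = DIM('a)\<close>. Functions on
  \<open>\<Omega>\<close> are represented by functions on the whole space; they are not quotiented modulo null sets,
  so all identities and inequalities between them are stated almost everywhere.\<close>

text \<open>Since \<open>0 powr r = 0\<close>, the density vanishes instead of being infinite on the diagonal, which
  is a null set of \<open>\<real>\<^sup>N \<times> \<real>\<^sup>N\<close>.\<close>

definition frac_measure :: "real \<Rightarrow> real \<Rightarrow> ('a::euclidean_space \<times> 'a) measure" where
  "frac_measure s p =
     density (lebesgue \<Otimes>\<^sub>M lebesgue)
       (\<lambda>(x, y). ennreal (norm (x - y) powr (- (real DIM('a) + p * s))))"

definition Lp_space :: "real \<Rightarrow> 'a::euclidean_space set \<Rightarrow> ('a \<Rightarrow> real) set" where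
  "Lp_space p U =
     {u. u \<in> borel_measurable (lebesgue_on U) \<and> integrable (lebesgue_on U) (\<lambda>x. \<bar>u x\<bar> powr p)}"

definition Lp_loc_space :: "real \<Rightarrow> ('a::euclidean_space \<Rightarrow> real) set" where
  "Lp_loc_space p = {u. u \<in> borel_measurable lebesgue \<and> (\<forall>K. compact K \<longrightarrow> u \<in> Lp_space p K)}"

text \<open>The \<open>p\<close>-th power of the Gagliardo seminorm over \<open>U \<times> U\<close>.\<close>

definition gagliardo :: "real \<Rightarrow> real \<Rightarrow> 'a::euclidean_space set \<Rightarrow> ('a \<Rightarrow> real) \<Rightarrow> ennreal" where
  "gagliardo s p U u =
     (\<integral>\<^sup>+z \<in> U \<times> U. ennreal (\<bar>u (fst z) - u (snd z)\<bar> powr p) \<partial>frac_measure s p)"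

definition frac_sobolev :: "real \<Rightarrow> real \<Rightarrow> 'a::euclidean_space set \<Rightarrow> ('a \<Rightarrow> real) set" where
  "frac_sobolev s p U = {u \<in> Lp_space p U. gagliardo s p U u < \<infinity>}"

definition frac_sobolev0 :: "real \<Rightarrow> real \<Rightarrow> 'a::euclidean_space set \<Rightarrow> ('a \<Rightarrow> real) set" where
  "frac_sobolev0 s p \<Omega> = {u \<in> frac_sobolev s p UNIV. AE x in lebesgue. x \<notin> \<Omega> \<longrightarrow> u x = 0}"

definition frac_sobolev0_nonneg :: "real \<Rightarrow> real \<Rightarrow> 'a::euclidean_space set \<Rightarrow> ('a \<Rightarrow> real) set" where
  "frac_sobolev0_nonneg s p \<Omega> = {v \<in> frac_sobolev0 s p \<Omega>. AE x in lebesgue. 0 \<le> v x}"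

definition frac_sobolev_tilde :: "real \<Rightarrow> real \<Rightarrow> 'a::euclidean_space set \<Rightarrow> ('a \<Rightarrow> real) set" where
  "frac_sobolev_tilde s p \<Omega> =
     {u \<in> Lp_loc_space p.
        (\<exists>U. open U \<and> closure \<Omega> \<subseteq> U \<and> u \<in> frac_sobolev s p U) \<and>
        integrable lebesgue
          (\<lambda>x. \<bar>u x\<bar> powr (p - 1) / (1 + norm x) powr (real DIM('a) + p * s))}"

text \<open>The duality pairing of the fractional \<open>p\<close>-Laplacian of \<open>u\<close> with \<open>v\<close>. For \<open>p = 2\<close> the
  convention \<open>0 powr 0 = 0\<close> is harmless, because the next factor vanishes as well.\<close>

definition frac_plaplacian ::
  "real \<Rightarrow> real \<Rightarrow> ('a::euclidean_space \<Rightarrow> real) \<Rightarrow> ('a \<Rightarrow> real) \<Rightarrow> real" where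
  "frac_plaplacian s p u v =
     (\<integral>(x, y). \<bar>u x - u y\<bar> powr (p - 2) * (u x - u y) * (v x - v y) \<partial>frac_measure s p)"

definition supersolution ::
  "real \<Rightarrow> real \<Rightarrow> 'a::euclidean_space set \<Rightarrow> ('a \<Rightarrow> real \<Rightarrow> real) \<Rightarrow> ('a \<Rightarrow> real) \<Rightarrow> bool" where
  "supersolution s p \<Omega> f u \<longleftrightarrow>
     u \<in> frac_sobolev_tilde s p \<Omega> \<and>
     (AE x in lebesgue. x \<notin> \<Omega> \<longrightarrow> 0 \<le> u x) \<and>
     (\<forall>v \<in> frac_sobolev0_nonneg s p \<Omega>.
        frac_plaplacian s p u v \<ge> (\<integral>x. f x (u x) * v x \<partial>lebesgue_on \<Omega>))"

definition subsolution ::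
  "real \<Rightarrow> real \<Rightarrow> 'a::euclidean_space set \<Rightarrow> ('a \<Rightarrow> real \<Rightarrow> real) \<Rightarrow> ('a \<Rightarrow> real) \<Rightarrow> bool" where
  "subsolution s p \<Omega> f u \<longleftrightarrow>
     u \<in> frac_sobolev_tilde s p \<Omega> \<and>
     (AE x in lebesgue. x \<notin> \<Omega> \<longrightarrow> u x \<le> 0) \<and>
     (\<forall>v \<in> frac_sobolev0_nonneg s p \<Omega>.
        frac_plaplacian s p u v \<le> (\<integral>x. f x (u x) * v x \<partial>lebesgue_on \<Omega>))"

definition solution ::
  "real \<Rightarrow> real \<Rightarrow> 'a::euclidean_space set \<Rightarrow> ('a \<Rightarrow> real \<Rightarrow> real) \<Rightarrow> ('a \<Rightarrow> real) \<Rightarrow> bool" where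
  "solution s p \<Omega> f u \<longleftrightarrow>
     u \<in> frac_sobolev0 s p \<Omega> \<and>
     (\<forall>v \<in> frac_sobolev0 s p \<Omega>.
        frac_plaplacian s p u v = (\<integral>x. f x (u x) * v x \<partial>lebesgue_on \<Omega>))"

definition sub_supersolution_pair ::
  "real \<Rightarrow> real \<Rightarrow> 'a::euclidean_space set \<Rightarrow> ('a \<Rightarrow> real \<Rightarrow> real) \<Rightarrow>
     ('a \<Rightarrow> real) \<Rightarrow> ('a \<Rightarrow> real) \<Rightarrow> bool" where
  "sub_supersolution_pair s p \<Omega> f u_low u_up \<longleftrightarrow>
     subsolution s p \<Omega> f u_low \<and> supersolution s p \<Omega> f u_up \<and>
     (AE x in lebesgue_on \<Omega>. u_low x \<le> u_up x)"

definition solution_set ::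
  "real \<Rightarrow> real \<Rightarrow> 'a::euclidean_space set \<Rightarrow> ('a \<Rightarrow> real \<Rightarrow> real) \<Rightarrow>
     ('a \<Rightarrow> real) \<Rightarrow> ('a \<Rightarrow> real) \<Rightarrow> ('a \<Rightarrow> real) set" where
  "solution_set s p \<Omega> f u_low u_up =
     {u \<in> frac_sobolev0 s p \<Omega>. solution s p \<Omega> f u \<and>
        (AE x in lebesgue. u_low x \<le> u x \<and> u x \<le> u_up x)}"

definition caratheodory :: "'a::euclidean_space set \<Rightarrow> ('a \<Rightarrow> real \<Rightarrow> real) \<Rightarrow> bool" where
  "caratheodory \<Omega> f \<longleftrightarrow>
     (\<forall>t. (\<lambda>x. f x t) \<in> borel_measurable (lebesgue_on \<Omega>)) \<and>
     (AE x in lebesgue_on \<Omega>. continuous_on UNIV (f x))"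

text \<open>Near each boundary point, \<open>\<Omega>\<close> is the strict supergraph of a \<open>C\<^sup>1\<^sup>,\<^sup>1\<close> function over the
  hyperplane orthogonal to some unit vector \<open>e\<close>. The graph function is extended to the whole space;
  only its values on this hyperplane, at the projections \<open>x - (x \<bullet> e) *\<^sub>R e\<close>, are used.\<close>

definition C11_boundary :: "'a::euclidean_space set \<Rightarrow> bool" where
  "C11_boundary \<Omega> \<longleftrightarrow>
     (\<forall>x\<^sub>0 \<in> frontier \<Omega>. \<exists>r > 0. \<exists>e \<phi> g L.
        norm e = 1 \<and> (\<forall>x. GDERIV \<phi> x :> g x) \<and> L-lipschitz_on UNIV g \<and>
        \<Omega> \<inter> ball x\<^sub>0 r = {x \<in> ball x\<^sub>0 r. \<phi> (x - (x \<bullet> e) *\<^sub>R e) < x \<bullet> e})"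

end

theory Submission
  imports Defs "HOL-Complex_Analysis.Great_Picard"
begin

text \<open>Let \<open>u\<^sub>1\<close> and \<open>u\<^sub>2\<close> be solutions above the subsolution \<open>l\<close>. A solution below both of them is
obtained from a truncated problem. Let \<open>T\<^sub>i\<close> truncate a value \<open>t\<close> to the interval between \<open>l(x)\<close> and
\<open>u\<^sub>i(x)\<close>, and replace the right-hand side \<open>f(x, t)\<close> by
\<open>g(x, t) = min (f(x, T\<^sub>1 t)) (f(x, T\<^sub>2 t))\<close>. Three properties of \<open>g\<close> matter. It is bounded,
uniformly in \<open>t\<close>, by a function of \<open>x\<close> that pairs with the whole energy space, so that the truncated
problem has a solution \<open>u\<close>. Where \<open>t\<close> exceeds \<open>u\<^sub>i(x)\<close> it is at most \<open>f(x, u\<^sub>i)\<close>, and where \<open>t\<close> is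
below \<open>l(x)\<close> it equals \<open>f(x, l)\<close>; testing with \<open>(u - u\<^sub>i)\<^sup>+\<close> and with \<open>(l - u)\<^sup>+\<close>, the strict
monotonicity of the operator then yields \<open>l \<le> u \<le> u\<^sub>i\<close> for both \<open>i\<close>. Between these barriers
\<open>g(x, t) = f(x, t)\<close>, so \<open>u\<close> solves the original problem. Because \<open>g\<close> is a minimum of two
truncations, each \<open>u\<^sub>i\<close> can be used as a barrier separately. The solution above \<open>u\<^sub>1\<close> and \<open>u\<^sub>2\<close>
follows from the reflection \<open>f(x, t) \<mapsto> - f(x, - t)\<close>, \<open>u \<mapsto> - u\<close>, which exchanges subsolutions and
supersolutions.

The truncated problem is solved by minimising \<open>energy u / p - \<integral> G(x, u)\<close>, where \<open>G\<close> is the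
antiderivative of \<open>g\<close> in \<open>t\<close>. Two facts about the energy space carry this. The fractional Sobolev
inequality (\<open>sobolev_inequality\<close>) makes the functional coercive and the pairing with \<open>g\<close>
finite, and a bound on the energy gives a subsequence converging almost everywhere
(\<open>compactness\<close>). Both rest on one estimate (\<open>deviation_from_average\<close>): the distance of \<open>u(x)\<close> from
the mean of \<open>u\<close> over a ball of radius \<open>r\<close> near \<open>x\<close> is at most a multiple of \<open>r\<^sup>s\<close> times the
\<open>p\<close>-th root of the energy density of \<open>u\<close> at \<open>x\<close>. Lower semicontinuity of the energy is Fatou's lemma.

The subsolution \<open>l\<close> lies only in the larger space, whose elements have finite energy only near the closure of
\<open>\<Omega>\<close>. A Lipschitz cutoff
puts it into the energy space without changing it on \<open>\<Omega>\<close> (\<open>tilde_cutoff\<close>), which gives the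
integrability of \<open>l\<close> on \<open>\<Omega>\<close> and the admissibility of \<open>(l - u)\<^sup>+\<close>. That the operator applied to \<open>l\<close>
is an absolutely convergent integral, not a default value of the Bochner integral, is
\<open>tilde_pairing_integrable\<close>.\<close>

section \<open>Measures, means and Young's inequality\<close>

lemma sigma_finite_lebesgue: "sigma_finite_measure (lebesgue :: 'a::euclidean_space measure)"
proof
  obtain A :: "'a set set" where A: "countable A" "A \<subseteq> sets lborel" "\<Union>A = space lborel"
     "\<forall>a\<in>A. emeasure lborel a \<noteq> \<infinity>"
    using lborel.sigma_finite_countable by blast
  show "\<exists>A :: 'a set set. countable A \<and> A \<subseteq> sets lebesgue \<and> \<Union>A = space lebesgue
      \<and> (\<forall>a\<in>A. emeasure lebesgue a \<noteq> \<infinity>)"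
    using A by (intro exI[of _ A]) (auto simp: subset_iff)
qed

interpretation lebesgue: sigma_finite_measure lebesgue
  by (rule sigma_finite_lebesgue)

interpretation lebesgue_pair: pair_sigma_finite lebesgue lebesgue
  by unfold_locales

text \<open>Jensen's inequality for the power \<open>p\<close>, here in the form that also yields integrability. Integrating
Young's inequality with a weight \<open>l\<close> equal to the mean of \<open>\<bar>w\<bar>\<close> gives it directly.\<close>

lemma powr_mean_le_mean_powr:
  fixes w :: "'b \<Rightarrow> real"
  assumes fin: "finite_measure M" and w [measurable]: "w \<in> borel_measurable M" and p: "1 \<le> p"
    and int: "integrable M (\<lambda>x. \<bar>w x\<bar> powr p)"
  shows "integrable M w"
    and "(\<integral>x. \<bar>w x\<bar> \<partial>M) powr p \<le> measure M (space M) powr (p - 1) * (\<integral>x. \<bar>w x\<bar> powr p \<partial>M)"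
proof -
  interpret finite_measure M by fact
  have le: "\<bar>a\<bar> \<le> 1 + \<bar>a\<bar> powr p" for a :: real
  proof (cases "\<bar>a\<bar> \<le> 1")
    case False
    then have "\<bar>a\<bar> powr 1 \<le> \<bar>a\<bar> powr p" using p by (intro powr_mono) auto
    then show ?thesis using False by simp
  qed (use powr_ge_zero[of "\<bar>a\<bar>" p] in linarith)
  show iw: "integrable M w"
  proof (rule Bochner_Integration.integrable_bound)
    show "integrable M (\<lambda>x. 1 + \<bar>w x\<bar> powr p)" using int by simp
    show "AE x in M. norm (w x) \<le> norm (1 + \<bar>w x\<bar> powr p)"
      using le by (auto simp: abs_of_nonneg add_nonneg_nonneg)
  qed simp
  define I where "I = (\<integral>x. \<bar>w x\<bar> \<partial>M)"
  define D where "D = (\<integral>x. \<bar>w x\<bar> powr p \<partial>M)"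
  define m where "m = measure M (space M)"
  have I0: "0 \<le> I" and D0: "0 \<le> D" unfolding I_def D_def by simp_all
  have "I powr p \<le> m powr (p - 1) * D"
  proof (cases "I = 0 \<or> p = 1 \<or> m = 0")
    case True
    moreover have "I = 0" if "m = 0"
    proof -
      have "AE x in M. False" using that unfolding m_def
        by (simp add: AE_iff_null null_setsI emeasure_eq_measure)
      then have "I = integral\<^sup>L M (\<lambda>x. 0)" unfolding I_def by (intro integral_cong_AE) auto
      then show ?thesis by simp
    qed
    moreover have "I = D \<or> m = 0" if "p = 1" using that unfolding I_def D_def by simp
    moreover have "I \<le> m powr 0 * D" if "p = 1" "m \<noteq> 0" using that unfolding I_def D_def by simp
    ultimately show ?thesis using D0 I0 by (cases "m = 0"; cases "I = 0") auto
  next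
    case False
    then have Ip: "I > 0" and p1: "p > 1" and mp: "m > 0" using I0 p by (auto simp: m_def less_le)
    define l where "l = I / m"
    have l: "l > 0" using Ip mp by (simp add: l_def)
    have young: "\<bar>a\<bar> \<le> \<bar>a\<bar> powr p / (p * l powr (p - 1)) + (1 - 1/p) * l" for a :: real
    proof -
      have "(\<bar>a\<bar> / l) * 1 \<le> (\<bar>a\<bar> / l) powr p / p + 1 powr (p / (p - 1)) / (p / (p - 1))"
        using p1 l by (intro Youngs_inequality) (auto simp: field_simps)
      then have "l * (\<bar>a\<bar> / l) \<le> l * ((\<bar>a\<bar> / l) powr p / p + (p - 1) / p)"
        using l by (intro mult_left_mono) auto
      also have "\<dots> = \<bar>a\<bar> powr p / (p * l powr (p - 1)) + (1 - 1/p) * l"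
        using l p1 by (simp add: powr_divide powr_diff field_simps)
      finally show ?thesis using l by simp
    qed
    have "I \<le> (\<integral>x. \<bar>w x\<bar> powr p / (p * l powr (p - 1)) + (1 - 1/p) * l \<partial>M)"
      unfolding I_def using int iw by (intro integral_mono young) auto
    also have "\<dots> = D / (p * l powr (p - 1)) + (1 - 1/p) * l * m"
      using int by (simp add: D_def m_def)
    also have "\<dots> = D / (p * l powr (p - 1)) + I - I / p"
      using mp by (simp add: l_def algebra_simps)
    finally have "I / p \<le> D / (p * l powr (p - 1))" by simp
    then have "I * l powr (p - 1) \<le> D" using l p1 by (simp add: field_simps)
    moreover have "I * l powr (p - 1) = I powr p / m powr (p - 1)"
      using Ip mp unfolding l_def by (simp add: powr_divide powr_diff)
    ultimately show ?thesis using mp by (simp add: field_simps)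
  qed
  then show "(\<integral>x. \<bar>w x\<bar> \<partial>M) powr p \<le> measure M (space M) powr (p - 1) * (\<integral>x. \<bar>w x\<bar> powr p \<partial>M)"
    unfolding I_def D_def m_def .
qed

section \<open>The singular kernel near and far from the diagonal\<close>

text \<open>Negative powers of the distance are integrated by comparison with a series over concentric
balls. The balls overlap, which is harmless for an upper bound.\<close>

lemma nn_integral_le_dyadic_balls:
  fixes F :: "'a::euclidean_space \<Rightarrow> ennreal" and b \<rho> :: "nat \<Rightarrow> real"
  assumes "\<And>y. F y \<noteq> 0 \<Longrightarrow> \<exists>k. y \<in> ball x (\<rho> k) \<and> F y \<le> ennreal (b k)"
    and b: "\<And>k. 0 \<le> b k" and \<rho>: "\<And>k. 0 \<le> \<rho> k"
    and sm: "summable (\<lambda>k. b k * \<rho> k ^ DIM('a))"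
  shows "(\<integral>\<^sup>+y. F y \<partial>lebesgue) \<le> ennreal (unit_ball_vol (real DIM('a)) * (\<Sum>k. b k * \<rho> k ^ DIM('a)))"
proof -
  have "(\<integral>\<^sup>+y. F y \<partial>lebesgue) \<le> (\<integral>\<^sup>+y. (\<Sum>k. ennreal (b k) * indicator (ball x (\<rho> k)) y) \<partial>lebesgue)"
  proof (rule nn_integral_mono)
    fix y :: 'a
    show "F y \<le> (\<Sum>k. ennreal (b k) * indicator (ball x (\<rho> k)) y)"
    proof (cases "F y = 0")
      case False
      then obtain k where k: "y \<in> ball x (\<rho> k)" "F y \<le> ennreal (b k)" using assms(1) by blast
      have "ennreal (b k) * indicator (ball x (\<rho> k)) y
          = (\<Sum>j\<in>{k}. ennreal (b j) * indicator (ball x (\<rho> j)) y)"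
        by (simp del: mem_ball sum_mult_indicator)
      also have "\<dots> \<le> (\<Sum>k. ennreal (b k) * indicator (ball x (\<rho> k)) y)"
        by (intro sum_le_suminf) auto
      finally show ?thesis using k by (simp del: mem_ball)
    qed simp
  qed
  also have "\<dots> = (\<Sum>k. \<integral>\<^sup>+y. ennreal (b k) * indicator (ball x (\<rho> k)) y \<partial>lebesgue)"
    by (rule nn_integral_suminf) (intro borel_measurable_times_ennreal borel_measurable_indicator; simp)
  also have "\<dots> = (\<Sum>k. ennreal (unit_ball_vol (real DIM('a)) * (b k * \<rho> k ^ DIM('a))))"
    using b \<rho> by (intro suminf_cong)
      (simp add: nn_integral_cmult_indicator emeasure_ball ennreal_mult' algebra_simps)
  also have "\<dots> = ennreal (\<Sum>k. unit_ball_vol (real DIM('a)) * (b k * \<rho> k ^ DIM('a)))"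
    using b \<rho> sm by (intro suminf_ennreal2) (auto intro!: summable_mult)
  also have "(\<Sum>k. unit_ball_vol (real DIM('a)) * (b k * \<rho> k ^ DIM('a)))
     = unit_ball_vol (real DIM('a)) * (\<Sum>k. b k * \<rho> k ^ DIM('a))"
    using sm by (rule suminf_mult)
  finally show ?thesis .
qed

lemma nn_integral_kernel_near:
  fixes a :: real
  assumes "a < real DIM('a)"
  obtains C where "0 \<le> C" "\<And>x::'a::euclidean_space.
    (\<integral>\<^sup>+y. ennreal (norm (x - y) powr (- a)) * indicator (ball x 1) y \<partial>lebesgue) \<le> ennreal C"
proof -
  \<comment> \<open>For negative \<open>a\<close> the kernel is at most \<open>1\<close> on the unit ball, as for \<open>a = 0\<close>.\<close>
  define a' where "a' = max a 0"
  have a': "0 \<le> a'" "a \<le> a'" "a' < real DIM('a)" using assms by (auto simp: a'_def)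
  define b where "b k = 2 powr (real (Suc k) * a')" for k
  define \<rho> where "\<rho> k = (2::real) powr (- real k)" for k
  have eq: "b k * \<rho> k ^ DIM('a) = 2 powr a' * (2 powr (a' - real DIM('a))) ^ k" for k
    by (simp add: b_def \<rho>_def powr_power powr_add[symmetric] algebra_simps)
  have sm: "summable (\<lambda>k. b k * \<rho> k ^ DIM('a))"
    unfolding eq using a' by (intro summable_mult summable_geometric) (auto simp: powr_less_one)
  show ?thesis
  proof (rule that)
    show "0 \<le> unit_ball_vol (real DIM('a)) * (\<Sum>k. b k * \<rho> k ^ DIM('a))"
      using sm by (intro mult_nonneg_nonneg suminf_nonneg) (auto simp: b_def \<rho>_def)
    fix x :: 'a
    show "(\<integral>\<^sup>+y. ennreal (norm (x - y) powr (- a)) * indicator (ball x 1) y \<partial>lebesgue)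
        \<le> ennreal (unit_ball_vol (real DIM('a)) * (\<Sum>k. b k * \<rho> k ^ DIM('a)))"
    proof (rule nn_integral_le_dyadic_balls[where x = x, OF _ _ _ sm])
      fix y assume "ennreal (norm (x - y) powr (- a)) * indicator (ball x 1) y \<noteq> 0"
      then have y: "y \<in> ball x 1" "x \<noteq> y" by (auto split: split_indicator_asm)
      define t where "t = norm (x - y)"
      have t: "0 < t" "t < 1" using y by (auto simp: t_def dist_norm)
      define k where "k = nat \<lfloor>- log 2 t\<rfloor>"
      have lg: "- log 2 t > 0" using t by simp
      have k: "real k \<le> - log 2 t" "- log 2 t < real (Suc k)"
        using lg unfolding k_def by linarith+
      show "\<exists>k. y \<in> ball x (\<rho> k) \<and>
          ennreal (norm (x - y) powr (- a)) * indicator (ball x 1) y \<le> ennreal (b k)"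
      proof (cases "t < \<rho> k")
        case True
        have "t powr (- a) \<le> t powr (- a')" using t a' by (simp add: powr_mono')
        also have "\<dots> = 2 powr (- log 2 t * a')"
          using t by (simp add: powr_def log_def)
        also have "\<dots> \<le> b k" unfolding b_def using k a' by (intro powr_mono mult_right_mono) auto
        finally show ?thesis using True y by (intro exI[of _ k]) (auto simp: t_def dist_norm intro!: ennreal_leI)
      next
        case False
        \<comment> \<open>At distance exactly \<open>2 powr (- k)\<close> the open ball \<open>k\<close> misses \<open>y\<close>, and the next larger one is used.\<close>
        then have k0: "k \<noteq> 0" using t(2) by (cases k) (simp_all add: \<rho>_def)
        have tl: "t = 2 powr (log 2 t)" using t by simp
        have "log 2 t = - real k"
          using False k(1) t le_log_iff[of 2 t "- real k"] unfolding \<rho>_def by simp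
        then have "t = 2 powr (- real k)" using tl by simp
        moreover have "t < 2 powr (- real (k - 1))"
          unfolding calculation using k0 by (intro powr_less_mono) auto
        ultimately have "t < \<rho> (k - 1)" by (simp add: \<rho>_def)
        moreover have "t powr (- a) \<le> b (k - 1)"
        proof -
          have "t powr (- a) \<le> t powr (- a')" using t a' by (simp add: powr_mono')
          also have "\<dots> = 2 powr (real k * a')"
            using \<open>t = 2 powr (- real k)\<close> by (simp add: powr_powr)
          finally show ?thesis using k0 by (simp add: b_def)
        qed
        ultimately show ?thesis using y by (intro exI[of _ "k - 1"]) (auto simp: t_def dist_norm intro!: ennreal_leI)
      qed
    qed (auto simp: b_def \<rho>_def)
  qed
qed

lemma nn_integral_kernel_far:
  fixes b d :: real
  assumes "b > real DIM('a)" "d > 0"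
  obtains C where "0 \<le> C" "\<And>x::'a::euclidean_space.
    (\<integral>\<^sup>+y. ennreal (norm (x - y) powr (- b)) * indicator (- ball x d) y \<partial>lebesgue) \<le> ennreal C"
proof -
  have b0: "b > 0" using assms by (smt (verit) of_nat_0_le_iff)
  define B where "B k = (2 powr real k * d) powr (- b)" for k
  define \<rho> where "\<rho> k = (2::real) powr (real (Suc k)) * d" for k
  have eq: "B k * \<rho> k ^ DIM('a) = d powr (- b) * (2 * d) ^ DIM('a) * (2 powr (real DIM('a) - b)) ^ k" for k
  proof -
    have "B k = d powr (-b) * 2 powr (- (b * real k))" using assms
      by (simp add: B_def powr_mult powr_powr algebra_simps)
    moreover have "\<rho> k ^ DIM('a) = (2 * d) ^ DIM('a) * 2 powr (real k * real DIM('a))"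
      by (simp add: \<rho>_def powr_add power_mult_distrib powr_powr[symmetric] powr_realpow algebra_simps)
    moreover have "(2 powr (real DIM('a) - b)) ^ k = 2 powr (- (b * real k)) * 2 powr (real k * real DIM('a))"
      by (simp add: powr_power powr_add[symmetric] algebra_simps)
    ultimately show ?thesis by simp
  qed
  have sm: "summable (\<lambda>k. B k * \<rho> k ^ DIM('a))"
    unfolding eq using assms by (intro summable_mult summable_geometric) (auto simp: powr_less_one)
  show ?thesis
  proof (rule that)
    show "0 \<le> unit_ball_vol (real DIM('a)) * (\<Sum>k. B k * \<rho> k ^ DIM('a))"
      using sm assms by (intro mult_nonneg_nonneg suminf_nonneg) (auto simp: B_def \<rho>_def)
    fix x :: 'a
    show "(\<integral>\<^sup>+y. ennreal (norm (x - y) powr (- b)) * indicator (- ball x d) y \<partial>lebesgue)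
        \<le> ennreal (unit_ball_vol (real DIM('a)) * (\<Sum>k. B k * \<rho> k ^ DIM('a)))"
    proof (rule nn_integral_le_dyadic_balls[where x = x, OF _ _ _ sm])
      fix y assume "ennreal (norm (x - y) powr (- b)) * indicator (- ball x d) y \<noteq> 0"
      then have y: "y \<notin> ball x d" by (auto split: split_indicator_asm)
      define t where "t = norm (x - y)"
      have t: "d \<le> t" using y by (auto simp: t_def dist_norm)
      define k where "k = nat \<lfloor>log 2 (t / d)\<rfloor>"
      have lg: "log 2 (t / d) \<ge> 0" using t assms by simp
      have k: "real k \<le> log 2 (t / d)" "log 2 (t / d) < real (Suc k)"
        using lg unfolding k_def by linarith+
      have tl: "t = 2 powr (log 2 (t / d)) * d" using t assms by simp
      have "2 powr real k \<le> 2 powr (log 2 (t / d))" using k by (intro powr_mono) auto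
      then have 1: "2 powr real k * d \<le> t" using assms t by (simp add: field_simps)
      have "2 powr (log 2 (t / d)) < 2 powr (real (Suc k))" using k by (intro powr_less_mono) auto
      then have 2: "t < \<rho> k" using assms t unfolding \<rho>_def by (simp add: field_simps)
      have "t powr (- b) \<le> B k" unfolding B_def using 1 assms b0 t by (intro powr_mono2') auto
      then show "\<exists>k. y \<in> ball x (\<rho> k) \<and>
          ennreal (norm (x - y) powr (- b)) * indicator (- ball x d) y \<le> ennreal (B k)"
        using 2 by (intro exI[of _ k]) (auto simp: t_def dist_norm intro!: ennreal_leI split: split_indicator)
    qed (use assms in \<open>auto simp: B_def \<rho>_def\<close>)
  qed
qed

section \<open>The weighted product measure and the Gagliardo energy\<close>

text \<open>Fatou's lemma in the shape in which it gives lower semicontinuity of the energy.\<close>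

lemma nn_integral_le_of_AE_tendsto:
  fixes f :: "nat \<Rightarrow> 'b \<Rightarrow> ennreal"
  assumes "\<And>n. f n \<in> borel_measurable M" and "AE x in M. (\<lambda>n. f n x) \<longlonglongrightarrow> g x"
    and "\<And>n. (\<integral>\<^sup>+x. f n x \<partial>M) \<le> c n" and "c \<longlonglongrightarrow> C"
  shows "(\<integral>\<^sup>+x. g x \<partial>M) \<le> C"
proof -
  have "(\<integral>\<^sup>+x. g x \<partial>M) = (\<integral>\<^sup>+x. liminf (\<lambda>n. f n x) \<partial>M)"
    using assms(2) by (intro nn_integral_cong_AE) (auto elim!: eventually_mono simp: lim_imp_Liminf)
  also have "\<dots> \<le> liminf (\<lambda>n. \<integral>\<^sup>+x. f n x \<partial>M)" using assms(1) by (intro nn_integral_liminf)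
  also have "\<dots> \<le> liminf c" using assms(3) by (intro Liminf_mono always_eventually) auto
  also have "\<dots> = C" using assms(4) by (simp add: lim_imp_Liminf)
  finally show ?thesis .
qed

lemma measurable_fst_lebesgue [measurable]:
  "u \<in> borel_measurable lebesgue \<Longrightarrow> (\<lambda>z. u (fst z)) \<in> borel_measurable (lebesgue \<Otimes>\<^sub>M lebesgue)"
  by (rule measurable_compose[OF measurable_fst])

lemma measurable_snd_lebesgue [measurable]:
  "u \<in> borel_measurable lebesgue \<Longrightarrow> (\<lambda>z. u (snd z)) \<in> borel_measurable (lebesgue \<Otimes>\<^sub>M lebesgue)"
  by (rule measurable_compose[OF measurable_snd])

lemma measurable_id_lebesgue [measurable]: "(\<lambda>x. x) \<in> borel_measurable lebesgue"
  by (simp add: borel_measurable_continuous_onI measurable_completion)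

lemma measurable_kernel [measurable]:
  "(\<lambda>z. norm (fst z - snd z :: 'a::euclidean_space) powr c) \<in> borel_measurable (lebesgue \<Otimes>\<^sub>M lebesgue)"
  by measurable

lemma frac_measure_eq:
  "frac_measure s p = density (lebesgue \<Otimes>\<^sub>M lebesgue)
     (\<lambda>z. ennreal (norm (fst z - snd z :: 'a::euclidean_space) powr (- (real DIM('a) + p * s))))"
  by (simp add: frac_measure_def case_prod_beta')

lemma sets_frac_measure [simp, measurable_cong]:
  "sets (frac_measure s p) = sets (lebesgue \<Otimes>\<^sub>M lebesgue)"
  by (simp add: frac_measure_def)

lemma space_frac_measure [simp]: "space (frac_measure s p) = UNIV"
  by (simp add: frac_measure_def space_pair_measure)

lemma nn_integral_frac_measure:
  fixes F :: "'a::euclidean_space \<times> 'a \<Rightarrow> ennreal"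
  assumes [measurable]: "F \<in> borel_measurable (lebesgue \<Otimes>\<^sub>M lebesgue)"
  shows "(\<integral>\<^sup>+z. F z \<partial>frac_measure s p) =
    (\<integral>\<^sup>+x. (\<integral>\<^sup>+y. ennreal (norm (x - y) powr (- (real DIM('a) + p * s))) * F (x, y) \<partial>lebesgue) \<partial>lebesgue)"
proof -
  have "(\<integral>\<^sup>+z. F z \<partial>frac_measure s p) = (\<integral>\<^sup>+z. ennreal (norm (fst z - snd z) powr (- (real DIM('a) + p * s))) * F z
      \<partial>(lebesgue \<Otimes>\<^sub>M lebesgue))"
    unfolding frac_measure_eq by (rule nn_integral_density) measurable
  also have "\<dots> = (\<integral>\<^sup>+x. (\<integral>\<^sup>+y. ennreal (norm (x - y) powr (- (real DIM('a) + p * s))) * F (x, y) \<partial>lebesgue) \<partial>lebesgue)"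
    by (subst lebesgue.nn_integral_fst[symmetric]) (auto simp: case_prod_beta')
  finally show ?thesis .
qed

lemma nn_integral_frac_measure_swap:
  fixes F :: "'a::euclidean_space \<times> 'a \<Rightarrow> ennreal"
  assumes [measurable]: "F \<in> borel_measurable (lebesgue \<Otimes>\<^sub>M lebesgue)"
  shows "(\<integral>\<^sup>+z. F (prod.swap z) \<partial>frac_measure s p) = (\<integral>\<^sup>+z. F z \<partial>frac_measure s p)"
proof -
  have sw [measurable]: "(\<lambda>z. F (prod.swap z)) \<in> borel_measurable (lebesgue \<Otimes>\<^sub>M lebesgue)"
    unfolding prod.swap_def by measurable
  have "(\<integral>\<^sup>+z. F (prod.swap z) \<partial>frac_measure s p) =
    (\<integral>\<^sup>+x. (\<integral>\<^sup>+y. ennreal (norm (x - y) powr (- (real DIM('a) + p * s))) * F (y, x) \<partial>lebesgue) \<partial>lebesgue)"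
    by (subst nn_integral_frac_measure) auto
  also have "\<dots> = (\<integral>\<^sup>+y. (\<integral>\<^sup>+x. ennreal (norm (x - y) powr (- (real DIM('a) + p * s))) * F (y, x) \<partial>lebesgue) \<partial>lebesgue)"
    by (rule lebesgue_pair.Fubini') measurable
  also have "\<dots> = (\<integral>\<^sup>+z. F z \<partial>frac_measure s p)"
    by (subst nn_integral_frac_measure) (auto simp: norm_minus_commute)
  finally show ?thesis .
qed

text \<open>The strips over a null set are null in the product, and the density preserves null sets. Hence
changing a function on a null set changes none of the double integrals below.\<close>

lemma AE_frac_measure:
  assumes "AE x in lebesgue. Q (x :: 'a::euclidean_space)"
  shows "AE z in frac_measure s p. Q (fst z) \<and> Q (snd z)"
proof -
  obtain A :: "'a set" where A: "A \<in> null_sets lebesgue" "{x. \<not> Q x} \<subseteq> A"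
    using assms by (auto simp: eventually_ae_filter)
  have "A \<times> UNIV \<union> UNIV \<times> A \<in> null_sets (lebesgue \<Otimes>\<^sub>M lebesgue)"
  proof (rule null_sets.Un)
    have 1: "emeasure (lebesgue \<Otimes>\<^sub>M lebesgue) (A \<times> (UNIV :: 'a set)) = emeasure lebesgue A * emeasure lebesgue (UNIV :: 'a set)"
      using A by (intro lebesgue.emeasure_pair_measure_Times) auto
    have 2: "emeasure (lebesgue \<Otimes>\<^sub>M lebesgue) ((UNIV :: 'a set) \<times> A) = emeasure lebesgue (UNIV :: 'a set) * emeasure lebesgue A"
      using A by (intro lebesgue.emeasure_pair_measure_Times) auto
    show "A \<times> (UNIV :: 'a set) \<in> null_sets (lebesgue \<Otimes>\<^sub>M lebesgue)" "(UNIV :: 'a set) \<times> A \<in> null_sets (lebesgue \<Otimes>\<^sub>M lebesgue)"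
      using A 1 2 by (auto intro!: null_setsI pair_measureI simp: null_setsD1)
  qed
  then have "AE z in lebesgue \<Otimes>\<^sub>M lebesgue. z \<notin> A \<times> UNIV \<union> UNIV \<times> A" by (rule AE_not_in)
  then have "AE z in lebesgue \<Otimes>\<^sub>M lebesgue. Q (fst z) \<and> Q (snd z)"
    by (rule eventually_mono) (use A in auto)
  then show ?thesis unfolding frac_measure_eq by (subst AE_density) auto
qed

text \<open>The energy density at \<open>x\<close>: the inner integral of the Gagliardo seminorm when the double integral is
evaluated by Tonelli's theorem.\<close>

definition slice_energy :: "real \<Rightarrow> real \<Rightarrow> ('a::euclidean_space \<Rightarrow> real) \<Rightarrow> 'a \<Rightarrow> ennreal" where
  "slice_energy s p u x =
     (\<integral>\<^sup>+y. ennreal (norm (x - y) powr (- (real DIM('a) + p * s))) * ennreal (\<bar>u x - u y\<bar> powr p) \<partial>lebesgue)"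

lemma measurable_slice_energy [measurable]:
  assumes [measurable]: "u \<in> borel_measurable lebesgue"
  shows "slice_energy s p u \<in> borel_measurable lebesgue"
proof -
  have "(\<lambda>x. \<integral>\<^sup>+y. (\<lambda>z. ennreal (norm (fst z - snd z) powr (- (real DIM('a) + p * s))) *
      ennreal (\<bar>u (fst z) - u (snd z)\<bar> powr p)) (x, y) \<partial>lebesgue) \<in> borel_measurable lebesgue"
    by (rule lebesgue.borel_measurable_nn_integral_fst) measurable
  then show ?thesis by (simp add: slice_energy_def[abs_def])
qed

lemma gagliardo_UNIV:
  "gagliardo s p UNIV u = (\<integral>\<^sup>+z. ennreal (\<bar>u (fst z) - u (snd z)\<bar> powr p) \<partial>frac_measure s p)"
  by (simp add: gagliardo_def)

lemma nn_integral_slice_energy: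
  fixes u :: "'a::euclidean_space \<Rightarrow> real"
  assumes [measurable]: "u \<in> borel_measurable lebesgue"
  shows "(\<integral>\<^sup>+x. slice_energy s p u x \<partial>lebesgue) = gagliardo s p UNIV u"
  unfolding gagliardo_UNIV slice_energy_def by (subst nn_integral_frac_measure) auto

lemma gagliardo_mono:
  assumes "0 \<le> p" and "\<And>x y. \<bar>v x - v y\<bar> \<le> \<bar>u x - u y\<bar>"
  shows "gagliardo s p UNIV v \<le> gagliardo s p UNIV u"
  unfolding gagliardo_UNIV using assms by (intro nn_integral_mono ennreal_leI powr_mono2) auto

lemma gagliardo_cong_AE:
  assumes "AE x in lebesgue. u x = v x"
  shows "gagliardo s p UNIV u = gagliardo s p UNIV v"
  unfolding gagliardo_UNIV using AE_frac_measure[OF assms, of s p]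
  by (intro nn_integral_cong_AE) (fastforce elim: eventually_mono)

section \<open>The fractional Sobolev inequality\<close>

text \<open>The dimension is a parameter \<open>N\<close> of its own so that derived constants depend on a number and not on
a type; the parameter \<open>space_type\<close> only fixes the type \<open>'a\<close>.\<close>

locale sobolev_exponents =
  fixes space_type :: "'a::euclidean_space itself" and N s p :: real
  assumes N_eq: "N = real DIM('a)"
    and s_pos: "0 < s" and s_less: "s < 1" and p_ge: "2 \<le> p" and ps_less: "p * s < N"
begin

lemma N_pos: "0 < N" by (simp add: N_eq)

lemma DIM_eq [simp]: "real DIM('a) = N" by (simp add: N_eq)

lemma slice_energy_eq:
  fixes u :: "'a \<Rightarrow> real"
  shows "slice_energy s p u x =
     (\<integral>\<^sup>+y. ennreal (norm (x - y) powr (- (N + p * s))) * ennreal (\<bar>u x - u y\<bar> powr p) \<partial>lebesgue)"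
  by (simp add: slice_energy_def)

text \<open>The critical Sobolev exponent.\<close>

definition P :: real where "P = N * p / (N - p * s)"

lemma p_less_P: "p < P"
proof -
  have "p * (N - p * s) < N * p" using p_ge s_pos ps_less by (simp add: algebra_simps)
  then show ?thesis using ps_less unfolding P_def by (simp add: pos_less_divide_eq)
qed

lemma measure_ball: "0 \<le> r \<Longrightarrow> measure lebesgue (ball c r :: 'a set) = unit_ball_vol N * r powr N"
proof (cases "r = 0")
  case False
  assume "0 \<le> r"
  then have "r > 0" using False by simp
  then have "r powr N = r ^ DIM('a)" unfolding N_eq by (rule powr_realpow)
  then show ?thesis using \<open>0 \<le> r\<close> by (simp add: content_ball)
qed simp

lemma unit_ball_vol_N_pos [simp]: "unit_ball_vol N > 0" using N_pos by simp

definition dev_const :: real where "dev_const = 2 powr (N + p * s) / unit_ball_vol N"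

lemma dev_const_pos: "dev_const > 0" by (simp add: dev_const_def)

text \<open>For \<open>y\<close> in the ball, \<open>\<bar>x - y\<bar> \<le> 2 r\<close>, so the kernel is at least \<open>(2 r) powr (- (N + p s))\<close>. Hence the
integral of \<open>\<bar>u x - u y\<bar>\<^sup>p\<close> over the ball is controlled by the energy density at \<open>x\<close>, and Jensen's
inequality passes from the mean of the \<open>p\<close>-th powers to the \<open>p\<close>-th power of the mean. The centre
may differ from \<open>x\<close> because compactness uses finitely many centres for all \<open>x\<close>.\<close>

lemma deviation_from_average:
  fixes u :: "'a \<Rightarrow> real"
  assumes u [measurable]: "u \<in> borel_measurable lebesgue" and r: "0 < r" and x: "dist x c \<le> r"
    and g: "slice_energy s p u x \<le> ennreal g" "0 \<le> g"
  shows "integrable (lebesgue_on (ball c r)) u"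
    and "\<bar>u x - (\<integral>y. u y \<partial>lebesgue_on (ball c r)) / measure lebesgue (ball c r)\<bar> powr p
         \<le> dev_const * r powr (p * s) * g"
proof -
  let ?B = "ball c r" and ?M = "lebesgue_on (ball c r)"
  define V where "V = measure lebesgue ?B"
  have V: "V = unit_ball_vol N * r powr N" unfolding V_def using r by (intro measure_ball) simp
  then have "V > 0" using r by simp
  note V = V this
  have B: "?B \<in> sets lebesgue" by simp
  have fin: "finite_measure ?M" by (intro finite_measure_lebesgue_on) auto
  have sp: "measure ?M (space ?M) = V" using B by (simp add: V_def measure_restrict_space)
  have um [measurable]: "u \<in> borel_measurable ?M" using u by (rule measurable_restrict_space1)
  define w where "w y = u x - u y" for y
  have wm: "w \<in> borel_measurable ?M" unfolding w_def by measurable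
  have "(\<integral>\<^sup>+y. ennreal (\<bar>w y\<bar> powr p) \<partial>?M) = (\<integral>\<^sup>+y. ennreal (\<bar>w y\<bar> powr p) * indicator ?B y \<partial>lebesgue)"
    using B by (intro nn_integral_restrict_space) auto
  also have "\<dots> \<le> (\<integral>\<^sup>+y. ennreal ((2 * r) powr (N + p * s)) *
      (ennreal (norm (x - y) powr (- (N + p * s))) * ennreal (\<bar>u x - u y\<bar> powr p)) \<partial>lebesgue)"
  proof (rule nn_integral_mono)
    fix y :: 'a
    show "ennreal (\<bar>w y\<bar> powr p) * indicator ?B y \<le> ennreal ((2 * r) powr (N + p * s)) *
      (ennreal (norm (x - y) powr (- (N + p * s))) * ennreal (\<bar>u x - u y\<bar> powr p))"
    proof (cases "y \<in> ?B \<and> x \<noteq> y")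
      case True
      then have "norm (x - y) \<le> 2 * r" using x dist_triangle[of x y c] by (auto simp: dist_norm)
      moreover have N0: "0 < N + p * s" using p_ge s_pos N_pos by (simp add: add_pos_pos)
      ultimately have "norm (x - y) powr (N + p * s) \<le> (2 * r) powr (N + p * s)"
        using r by (intro powr_mono2) auto
      then have "1 \<le> (2 * r) powr (N + p * s) * norm (x - y) powr (- (N + p * s))"
        using True unfolding powr_minus by (simp add: divide_simps)
      then have "1 * \<bar>u x - u y\<bar> powr p \<le>
          ((2 * r) powr (N + p * s) * norm (x - y) powr (- (N + p * s))) * \<bar>u x - u y\<bar> powr p"
        by (intro mult_right_mono) auto
      then show ?thesis using True
        by (simp add: w_def ennreal_mult'[symmetric] mult.assoc ennreal_leI)
    qed (auto simp: w_def)
  qed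
  also have "\<dots> = ennreal ((2 * r) powr (N + p * s)) * slice_energy s p u x"
    unfolding slice_energy_eq by (rule nn_integral_cmult) measurable
  also have "\<dots> \<le> ennreal ((2 * r) powr (N + p * s)) * ennreal g"
    using g by (intro mult_left_mono) auto
  finally have nn: "(\<integral>\<^sup>+y. ennreal (\<bar>w y\<bar> powr p) \<partial>?M) \<le> ennreal ((2 * r) powr (N + p * s) * g)"
    using g by (simp add: ennreal_mult)
  have iw: "integrable ?M (\<lambda>y. \<bar>w y\<bar> powr p)"
    using nn wm by (intro integrableI_bounded) (auto simp: le_less_trans[OF _ ennreal_less_top])
  have D: "(\<integral>y. \<bar>w y\<bar> powr p \<partial>?M) \<le> (2 * r) powr (N + p * s) * g"
    using nn iw g by (subst (asm) nn_integral_eq_integral) auto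
  note J = powr_mean_le_mean_powr[OF fin wm _ iw]
  have w_int: "integrable ?M w" using J(1) p_ge by simp
  have c_int: "integrable ?M (\<lambda>_. d)" for d :: real
    using fin by (simp add: finite_measure.integrable_const)
  have "integrable ?M (\<lambda>y. u x - w y)" using w_int c_int by (rule Bochner_Integration.integrable_diff[rotated])
  then show iu: "integrable ?M u" by (simp add: w_def)
  have wI: "(\<integral>y. w y \<partial>?M) = u x * V - (\<integral>y. u y \<partial>?M)"
    using iu c_int sp by (simp add: w_def)
  have "\<bar>u x - (\<integral>y. u y \<partial>?M) / V\<bar> = \<bar>\<integral>y. w y \<partial>?M\<bar> / V"
  proof -
    have "u x - (\<integral>y. u y \<partial>?M) / V = (\<integral>y. w y \<partial>?M) / V" using V(2) by (simp add: wI diff_divide_distrib)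
    then show ?thesis using V(2) by (simp add: abs_divide)
  qed
  also have "\<dots> \<le> (\<integral>y. \<bar>w y\<bar> \<partial>?M) / V"
    using V(2) by (intro divide_right_mono integral_abs_bound) auto
  finally have "\<bar>u x - (\<integral>y. u y \<partial>?M) / V\<bar> powr p \<le> ((\<integral>y. \<bar>w y\<bar> \<partial>?M) / V) powr p"
    using p_ge by (intro powr_mono2) auto
  also have "\<dots> = (\<integral>y. \<bar>w y\<bar> \<partial>?M) powr p / V powr p" using V(2) by (intro powr_divide)
  also have "\<dots> \<le> (V powr (p - 1) * (\<integral>y. \<bar>w y\<bar> powr p \<partial>?M)) / V powr p"
    using J(2) p_ge sp by (intro divide_right_mono) auto
  also have "\<dots> = (\<integral>y. \<bar>w y\<bar> powr p \<partial>?M) / V" using V(2) by (simp add: powr_diff)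
  also have "\<dots> \<le> ((2 * r) powr (N + p * s) * g) / V" using D V(2) by (intro divide_right_mono) auto
  also have "\<dots> = dev_const * r powr (p * s) * g"
    using r unfolding V(1) dev_const_def by (simp add: powr_mult powr_add field_simps)
  finally show "\<bar>u x - (\<integral>y. u y \<partial>?M) / measure lebesgue ?B\<bar> powr p \<le> dev_const * r powr (p * s) * g"
    unfolding V_def .
qed

definition sob_const :: real where
  "sob_const = 2 powr p * dev_const * (2 powr P / unit_ball_vol N) powr (p * s / N)"

lemma sob_const_pos: "sob_const > 0"
proof -
  have "unit_ball_vol N \<noteq> 0" using unit_ball_vol_N_pos by linarith
  then show ?thesis by (simp add: sob_const_def dev_const_pos)
qed

text \<open>The mean of \<open>\<bar>w\<bar>\<close> over a ball of radius \<open>r\<close> around \<open>x\<close> decays like \<open>S powr (1 / P) * r powr (- N / P)\<close>.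
At the radius where this bound equals \<open>\<bar>w x\<bar> / 2\<close>, the deviation of \<open>w x\<close> from the mean accounts
for the other half, and the estimate for the deviation becomes the claim. The exponent \<open>P\<close> is the one
for which the powers of \<open>\<bar>w x\<bar>\<close> collect to \<open>P\<close> again.\<close>

lemma sobolev_pointwise:
  fixes w :: "'a \<Rightarrow> real"
  assumes w [measurable]: "w \<in> borel_measurable lebesgue" and iw: "integrable lebesgue (\<lambda>x. \<bar>w x\<bar> powr P)"
    and g: "slice_energy s p w x \<le> ennreal g" "0 \<le> g" and nz: "w x \<noteq> 0"
    and S: "S = (\<integral>x. \<bar>w x\<bar> powr P \<partial>lebesgue)" "S > 0"
  shows "\<bar>w x\<bar> powr P \<le> sob_const * S powr (p * s / N) * g"
proof -
  define a where "a = \<bar>w x\<bar>"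
  have a: "a > 0" using nz by (simp add: a_def)
  have Pp: "P > 0" using p_less_P p_ge by simp
  define om where "om = unit_ball_vol N"
  have om: "om > 0" by (simp add: om_def)
  define r where "r = (S / (om * (a / 2) powr P)) powr (1 / N)"
  have r: "r > 0" using a S om by (simp add: r_def)
  have rN: "r powr N = S / (om * (a / 2) powr P)" using S(2) om a N_pos by (simp add: r_def powr_powr)
  let ?M = "lebesgue_on (ball x r)"
  define V where "V = measure lebesgue (ball x r)"
  have "V = om * r powr N" unfolding V_def om_def using r by (intro measure_ball) simp
  then have V: "V = S / (a / 2) powr P" using rN om by simp
  then have "V > 0" using a S(2) by simp
  note V = V this
  have fin: "finite_measure ?M" by (intro finite_measure_lebesgue_on) auto
  have sp: "measure ?M (space ?M) = V" by (simp add: V_def measure_restrict_space)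
  have wm [measurable]: "w \<in> borel_measurable ?M" using w by (rule measurable_restrict_space1)
  have iM: "integrable ?M (\<lambda>x. \<bar>w x\<bar> powr P)"
    using integrable_mult_indicator[of "ball x r" lebesgue, OF _ iw]
    by (simp add: integrable_restrict_space)
  have "(\<integral>x. \<bar>w x\<bar> powr P \<partial>?M) \<le> S" unfolding S(1)
    using integrable_mult_indicator[of "ball x r" lebesgue, OF _ iw] iw
    by (auto simp: integral_restrict_space intro!: integral_mono simp del: indicator_simps split: split_indicator)
  note J = powr_mean_le_mean_powr[OF fin wm _ iM]
  have "(\<integral>y. \<bar>w y\<bar> \<partial>?M) powr P \<le> V powr (P - 1) * S"
    using J(2) sp p_less_P p_ge \<open>(\<integral>x. \<bar>w x\<bar> powr P \<partial>?M) \<le> S\<close>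
    by (smt (verit) mult_left_mono powr_ge_zero)
  also have "\<dots> = (V * (a / 2)) powr P"
  proof -
    have SV: "S = V * (a / 2) powr P" using V(1) a by simp
    have "V powr (P - 1) * V = V powr P" using V(2) by (simp add: powr_diff)
    moreover have "(V * (a / 2)) powr P = V powr P * (a / 2) powr P" by (rule powr_mult)
    ultimately show ?thesis unfolding SV by (metis mult.assoc)
  qed
  finally have "(\<integral>y. \<bar>w y\<bar> \<partial>?M) \<le> V * (a / 2)"
    using Pp V a by (smt (verit) powr_less_mono2 integral_nonneg_AE mult_pos_pos half_gt_zero)
  then have "\<bar>\<integral>y. w y \<partial>?M\<bar> \<le> V * (a / 2)"
    using integral_abs_bound[of ?M w] by linarith
  then have "\<bar>(\<integral>y. w y \<partial>?M) / V\<bar> \<le> a / 2"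
    using V(2) by (simp add: abs_divide pos_divide_le_eq mult.commute)
  then have "a / 2 \<le> \<bar>w x - (\<integral>y. w y \<partial>?M) / V\<bar>" unfolding a_def by linarith
  then have "(a / 2) powr p \<le> \<bar>w x - (\<integral>y. w y \<partial>?M) / V\<bar> powr p"
    using a p_ge by (intro powr_mono2) auto
  also have "\<dots> \<le> dev_const * r powr (p * s) * g" unfolding V_def
    using r g by (intro deviation_from_average) auto
  also have "r powr (p * s) = (r powr N) powr (p * s / N)" using N_pos by (simp add: powr_powr)
  also have "r powr N = (2 powr P / om) * S * a powr (- P)"
    unfolding rN using a by (simp add: powr_divide powr_minus field_simps)
  also have "((2 powr P / om) * S * a powr (- P)) powr (p * s / N)
     = (2 powr P / om) powr (p * s / N) * S powr (p * s / N) * a powr (- (P * p * s / N))"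
    unfolding powr_mult powr_powr by (simp add: mult.assoc)
  finally have "(a / 2) powr p * a powr (P * p * s / N) * 2 powr p
     \<le> (dev_const * ((2 powr P / om) powr (p * s / N) * S powr (p * s / N) * a powr (- (P * p * s / N))) * g)
        * a powr (P * p * s / N) * 2 powr p"
    using a by (intro mult_right_mono) auto
  also have "\<dots> = sob_const * S powr (p * s / N) * g"
    using a by (simp add: sob_const_def om_def powr_minus field_simps)
  also have "(a / 2) powr p * a powr (P * p * s / N) * 2 powr p = a powr (p + P * p * s / N)"
    using a by (simp add: powr_divide powr_add)
  also have "p + P * p * s / N = P"
  proof -
    have "P * (N - p * s) = N * p" using ps_less by (simp add: P_def)
    then have "P * p * s = N * (P - p)" by (simp add: algebra_simps)
    then show ?thesis using N_pos by simp
  qed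
  finally show ?thesis by (simp add: a_def)
qed

text \<open>Integrating the pointwise bound gives \<open>S \<le> sob_const * S powr (p s / N) * e\<close>. Since \<open>p s < N\<close>, the
power of \<open>S\<close> can be absorbed, provided that \<open>S\<close> is finite; boundedness of \<open>w\<close> and finite measure of its
support ensure this.\<close>

lemma sobolev_bounded:
  fixes w :: "'a \<Rightarrow> real"
  assumes w [measurable]: "w \<in> borel_measurable lebesgue" and bd: "\<And>x. \<bar>w x\<bar> \<le> K"
    and \<Omega>: "\<Omega> \<in> lmeasurable" and z: "AE x in lebesgue. x \<notin> \<Omega> \<longrightarrow> w x = 0"
    and e: "gagliardo s p UNIV w \<le> ennreal e" "0 \<le> e"
  shows "(\<integral>\<^sup>+x. ennreal (\<bar>w x\<bar> powr P) \<partial>lebesgue) \<le> ennreal ((sob_const * e) powr (N / (N - p * s)))"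
proof -
  have Pp: "P > 0" using p_less_P p_ge by simp
  have K: "K \<ge> 0" using bd[of undefined] by linarith
  have iw: "integrable lebesgue (\<lambda>x. \<bar>w x\<bar> powr P)"
  proof (rule Bochner_Integration.integrable_bound)
    show "integrable lebesgue (\<lambda>x. K powr P * indicator \<Omega> x)"
      using \<Omega> by (intro integrable_mult_right integrable_real_indicator) (auto simp: fmeasurable_def)
    show "AE x in lebesgue. norm (\<bar>w x\<bar> powr P) \<le> norm (K powr P * indicator \<Omega> x)"
      using z by eventually_elim (use bd K Pp in \<open>auto simp: indicator_def intro!: powr_mono2\<close>)
  qed measurable
  define S where "S = (\<integral>x. \<bar>w x\<bar> powr P \<partial>lebesgue)"
  have S0: "S \<ge> 0" unfolding S_def by simp
  have nnS: "(\<integral>\<^sup>+x. ennreal (\<bar>w x\<bar> powr P) \<partial>lebesgue) = ennreal S"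
    unfolding S_def using iw by (intro nn_integral_eq_integral) auto
  have "S \<le> (sob_const * e) powr (N / (N - p * s))"
  proof (cases "S = 0")
    case False
    then have Sp: "S > 0" using S0 by simp
    define c where "c = sob_const * S powr (p * s / N)"
    have c: "c \<ge> 0" using sob_const_pos by (simp add: c_def)
    have "AE x in lebesgue. slice_energy s p w x \<noteq> \<infinity>"
      using e by (intro nn_integral_noteq_infinite) (auto simp: nn_integral_slice_energy top_unique neq_top_trans)
    then have "AE x in lebesgue. ennreal (\<bar>w x\<bar> powr P) \<le> ennreal c * slice_energy s p w x"
    proof eventually_elim
      case (elim x)
      then obtain g where g: "slice_energy s p w x = ennreal g" "0 \<le> g"
        by (cases "slice_energy s p w x") auto
      have "\<bar>w x\<bar> powr P \<le> c * g"
      proof (cases "w x = 0")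
        case False
        show ?thesis unfolding c_def
          by (rule sobolev_pointwise[OF w iw _ g(2) False S_def Sp]) (simp add: g)
      qed (use c g in simp)
      then show ?case using c g by (simp add: ennreal_mult[symmetric] ennreal_leI)
    qed
    then have "ennreal S \<le> (\<integral>\<^sup>+x. ennreal c * slice_energy s p w x \<partial>lebesgue)"
      unfolding nnS[symmetric] by (rule nn_integral_mono_AE)
    also have "\<dots> = ennreal c * gagliardo s p UNIV w"
      by (subst nn_integral_cmult) (auto simp: nn_integral_slice_energy)
    also have "\<dots> \<le> ennreal (c * e)" using e c by (simp add: ennreal_mult mult_left_mono)
    finally have "S \<le> c * e" using c e by (simp add: ennreal_le_iff)
    then have "S / S powr (p * s / N) \<le> sob_const * e"
      using Sp by (simp add: c_def field_simps)
    then have "S powr (1 - p * s / N) \<le> sob_const * e" using Sp by (simp add: powr_diff)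
    then have "(S powr (1 - p * s / N)) powr (N / (N - p * s)) \<le> (sob_const * e) powr (N / (N - p * s))"
      using ps_less N_pos by (intro powr_mono2) auto
    moreover have "(1 - p * s / N) * (N / (N - p * s)) = 1" using ps_less N_pos
      by (simp add: field_simps)
    ultimately have "S powr 1 \<le> (sob_const * e) powr (N / (N - p * s))"
      by (metis powr_powr)
    then show ?thesis using Sp by simp
  qed simp
  then show ?thesis unfolding nnS by (rule ennreal_leI)
qed

text \<open>Truncation does not increase the energy, so the bound for bounded functions passes to the limit.\<close>

lemma sobolev_inequality:
  fixes u :: "'a \<Rightarrow> real"
  assumes u [measurable]: "u \<in> borel_measurable lebesgue"
    and \<Omega>: "\<Omega> \<in> lmeasurable" and z: "AE x in lebesgue. x \<notin> \<Omega> \<longrightarrow> u x = 0"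
    and e: "gagliardo s p UNIV u \<le> ennreal e" "0 \<le> e"
  shows "integrable lebesgue (\<lambda>x. \<bar>u x\<bar> powr P)"
    and "(\<integral>x. \<bar>u x\<bar> powr P \<partial>lebesgue) \<le> (sob_const * e) powr (N / (N - p * s))"
proof -
  have Pp: "P > 0" using p_less_P p_ge by simp
  define w where "w k x = max (- real k) (min (real k) (u x))" for k x
  have [measurable]: "w k \<in> borel_measurable lebesgue" for k unfolding w_def by measurable
  have nn: "(\<integral>\<^sup>+x. ennreal (\<bar>u x\<bar> powr P) \<partial>lebesgue) \<le> ennreal ((sob_const * e) powr (N / (N - p * s)))"
  proof (rule nn_integral_le_of_AE_tendsto)
    fix k
    show "(\<integral>\<^sup>+x. ennreal (\<bar>w k x\<bar> powr P) \<partial>lebesgue) \<le> ennreal ((sob_const * e) powr (N / (N - p * s)))"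
    proof (rule sobolev_bounded[where K = "real k", OF _ _ \<Omega> _ _ e(2)])
      show "AE x in lebesgue. x \<notin> \<Omega> \<longrightarrow> w k x = 0" using z by eventually_elim (auto simp: w_def)
      have "gagliardo s p UNIV (w k) \<le> gagliardo s p UNIV u"
        using p_ge by (intro gagliardo_mono) (auto simp: w_def)
      then show "gagliardo s p UNIV (w k) \<le> ennreal e" using e by simp
    qed (auto simp: w_def)
  next
    show "AE x in lebesgue. (\<lambda>k. ennreal (\<bar>w k x\<bar> powr P)) \<longlonglongrightarrow> ennreal (\<bar>u x\<bar> powr P)"
    proof (rule AE_I2, rule tendsto_eventually)
      fix x
      obtain k0 :: nat where "\<bar>u x\<bar> \<le> real k0" using real_arch_simple by blast
      then show "\<forall>\<^sub>F k in sequentially. ennreal (\<bar>w k x\<bar> powr P) = ennreal (\<bar>u x\<bar> powr P)"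
        by (intro eventually_sequentiallyI[of k0]) (auto simp: w_def)
    qed
  qed auto
  show i: "integrable lebesgue (\<lambda>x. \<bar>u x\<bar> powr P)"
    using nn by (intro integrableI_bounded) (auto simp: le_less_trans[OF _ ennreal_less_top])
  show "(\<integral>x. \<bar>u x\<bar> powr P \<partial>lebesgue) \<le> (sob_const * e) powr (N / (N - p * s))"
    using nn by (subst (asm) nn_integral_eq_integral[OF i]) auto
qed

end

section \<open>The energy space\<close>

lemma powr_abs_add_le:
  fixes a b p :: real
  assumes "0 \<le> p"
  shows "\<bar>a + b\<bar> powr p \<le> 2 powr p * (\<bar>a\<bar> powr p + \<bar>b\<bar> powr p)"
proof -
  have "\<bar>a + b\<bar> powr p \<le> (2 * max \<bar>a\<bar> \<bar>b\<bar>) powr p" using assms by (intro powr_mono2) auto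
  also have "\<dots> = 2 powr p * max \<bar>a\<bar> \<bar>b\<bar> powr p" by (rule powr_mult)
  also have "\<dots> \<le> 2 powr p * (\<bar>a\<bar> powr p + \<bar>b\<bar> powr p)"
    by (intro mult_left_mono) (auto simp: max_def)
  finally show ?thesis .
qed

lemma measurable_powr_diff [measurable]:
  fixes u :: "'a::euclidean_space \<Rightarrow> real"
  assumes [measurable]: "u \<in> borel_measurable lebesgue"
  shows "(\<lambda>z. \<bar>u (fst z) - u (snd z)\<bar> powr p) \<in> borel_measurable (frac_measure s p)"
  by measurable

lemma gagliardo_add:
  fixes u v :: "'a::euclidean_space \<Rightarrow> real"
  assumes [measurable]: "u \<in> borel_measurable lebesgue" "v \<in> borel_measurable lebesgue" and "0 \<le> p"
  shows "gagliardo s p UNIV (\<lambda>x. u x + v x) \<le> ennreal (2 powr p) * (gagliardo s p UNIV u + gagliardo s p UNIV v)"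
proof -
  have "gagliardo s p UNIV (\<lambda>x. u x + v x) \<le> (\<integral>\<^sup>+z. ennreal (2 powr p) *
      (ennreal (\<bar>u (fst z) - u (snd z)\<bar> powr p) + ennreal (\<bar>v (fst z) - v (snd z)\<bar> powr p)) \<partial>frac_measure s p)"
    unfolding gagliardo_UNIV
  proof (rule nn_integral_mono)
    fix z :: "'a \<times> 'a"
    have "\<bar>u (fst z) + v (fst z) - (u (snd z) + v (snd z))\<bar> powr p \<le>
      2 powr p * (\<bar>u (fst z) - u (snd z)\<bar> powr p + \<bar>v (fst z) - v (snd z)\<bar> powr p)"
      using powr_abs_add_le[OF assms(3), of "u (fst z) - u (snd z)" "v (fst z) - v (snd z)"]
      by (simp add: algebra_simps)
    then show "ennreal (\<bar>u (fst z) + v (fst z) - (u (snd z) + v (snd z))\<bar> powr p) \<le> ennreal (2 powr p) *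
      (ennreal (\<bar>u (fst z) - u (snd z)\<bar> powr p) + ennreal (\<bar>v (fst z) - v (snd z)\<bar> powr p))"
      by (simp add: ennreal_mult[symmetric] ennreal_plus[symmetric] ennreal_leI del: ennreal_plus)
  qed
  also have "\<dots> = ennreal (2 powr p) * (gagliardo s p UNIV u + gagliardo s p UNIV v)"
    unfolding gagliardo_UNIV by (subst nn_integral_cmult) (auto simp: nn_integral_add)
  finally show ?thesis .
qed

lemma gagliardo_cmult:
  fixes u :: "'a::euclidean_space \<Rightarrow> real"
  assumes [measurable]: "u \<in> borel_measurable lebesgue"
  shows "gagliardo s p UNIV (\<lambda>x. c * u x) = ennreal (\<bar>c\<bar> powr p) * gagliardo s p UNIV u"
proof -
  have "\<bar>c * a - c * b\<bar> powr p = \<bar>c\<bar> powr p * \<bar>a - b\<bar> powr p" for a b :: real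
    by (simp add: right_diff_distrib[symmetric] abs_mult powr_mult)
  then show ?thesis unfolding gagliardo_UNIV
    by (subst nn_integral_cmult[symmetric]) (auto simp: ennreal_mult)
qed

context sobolev_exponents
begin

lemma P_gt_2: "2 < P" using p_less_P p_ge by simp

lemma powr_p_le_P: "\<bar>t\<bar> powr p \<le> 1 + \<bar>t\<bar> powr P" for t :: real
proof (cases "\<bar>t\<bar> \<le> 1")
  case True
  then have "\<bar>t\<bar> powr p \<le> 1" using p_ge by (intro powr_le1) auto
  then show ?thesis using powr_ge_zero[of "\<bar>t\<bar>" P] by linarith
next
  case False
  then have "\<bar>t\<bar> powr p \<le> \<bar>t\<bar> powr P" using p_less_P by (intro powr_mono) auto
  then show ?thesis by simp
qed

lemma abs_le_P: "\<bar>t\<bar> \<le> 1 + \<bar>t\<bar> powr P" for t :: real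
proof (cases "\<bar>t\<bar> \<le> 1")
  case False
  then have "\<bar>t\<bar> powr 1 \<le> \<bar>t\<bar> powr P" using P_gt_2 by (intro powr_mono) auto
  then show ?thesis by simp
qed (use powr_ge_zero[of "\<bar>t\<bar>" P] in linarith)

lemma integrable_indicator_lmeasurable: "\<Omega> \<in> lmeasurable \<Longrightarrow> integrable lebesgue (indicat_real \<Omega>)"
  by (rule integrable_real_indicator) (auto simp: fmeasurable_def)

text \<open>A short name for \<open>W\<^sub>0\<^sup>s\<^sup>,\<^sup>p(\<Omega>)\<close> with the exponents fixed.\<close>

definition W0 :: "'a set \<Rightarrow> ('a \<Rightarrow> real) set" where
  "W0 \<Omega> = frac_sobolev0 s p \<Omega>"

text \<open>Membership in \<open>L\<^sup>p\<close> is automatic: by the Sobolev inequality, finite energy and support of finite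
measure give integrability of the higher power \<open>P\<close>.\<close>

lemma W0_iff:
  fixes u :: "'a \<Rightarrow> real"
  assumes "\<Omega> \<in> lmeasurable"
  shows "u \<in> W0 \<Omega> \<longleftrightarrow> u \<in> borel_measurable lebesgue \<and> (AE x in lebesgue. x \<notin> \<Omega> \<longrightarrow> u x = 0) \<and>
           gagliardo s p UNIV u < \<infinity>"
proof
  assume r: "u \<in> borel_measurable lebesgue \<and> (AE x in lebesgue. x \<notin> \<Omega> \<longrightarrow> u x = 0) \<and>
           gagliardo s p UNIV u < \<infinity>"
  then obtain e where e: "gagliardo s p UNIV u \<le> ennreal e" "0 \<le> e"
    by (cases "gagliardo s p UNIV u") auto
  have [measurable]: "u \<in> borel_measurable lebesgue" using r by simp
  have "integrable lebesgue (\<lambda>x. \<bar>u x\<bar> powr p)"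
  proof (rule Bochner_Integration.integrable_bound)
    show "integrable lebesgue (\<lambda>x. indicator \<Omega> x + \<bar>u x\<bar> powr P)"
      using sobolev_inequality(1)[of u \<Omega> e] r e assms
      by (intro Bochner_Integration.integrable_add integrable_indicator_lmeasurable) auto
    have "AE x in lebesgue. x \<notin> \<Omega> \<longrightarrow> u x = 0" using r by simp
    then show "AE x in lebesgue. norm (\<bar>u x\<bar> powr p) \<le> norm (indicator \<Omega> x + \<bar>u x\<bar> powr P)"
      by eventually_elim (use powr_p_le_P in \<open>auto simp: indicator_def abs_of_nonneg add_nonneg_nonneg\<close>)
  qed measurable
  then show "u \<in> W0 \<Omega>" using r
    by (simp add: W0_def frac_sobolev0_def frac_sobolev_def Lp_space_def lebesgue_on_UNIV_eq)
qed (auto simp: W0_def frac_sobolev0_def frac_sobolev_def Lp_space_def lebesgue_on_UNIV_eq)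

lemma
  fixes u :: "'a \<Rightarrow> real"
  assumes "u \<in> W0 \<Omega>"
  shows W0_measurable: "u \<in> borel_measurable lebesgue"
    and W0_zero: "AE x in lebesgue. x \<notin> \<Omega> \<longrightarrow> u x = 0"
    and W0_gagliardo: "gagliardo s p UNIV u < \<infinity>"
  using assms by (auto simp: W0_def frac_sobolev0_def frac_sobolev_def Lp_space_def lebesgue_on_UNIV_eq)

definition energy :: "('a \<Rightarrow> real) \<Rightarrow> real" where
  "energy u = enn2real (gagliardo s p UNIV u)"

lemma energy_nonneg [simp]: "0 \<le> energy u" by (simp add: energy_def)

lemma gagliardo_eq_energy: "u \<in> W0 \<Omega> \<Longrightarrow> gagliardo s p UNIV u = ennreal (energy u)"
  using W0_gagliardo unfolding energy_def by (simp add: less_top)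

lemma W0_integrable_powr:
  assumes "u \<in> W0 \<Omega>"
  shows "integrable (frac_measure s p) (\<lambda>z. \<bar>u (fst z) - u (snd z)\<bar> powr p)"
proof (rule integrableI_bounded)
  show "(\<lambda>z. \<bar>u (fst z) - u (snd z)\<bar> powr p) \<in> borel_measurable (frac_measure s p)"
    by (rule measurable_powr_diff[OF W0_measurable[OF assms]])
  show "(\<integral>\<^sup>+z. ennreal (norm (\<bar>u (fst z) - u (snd z)\<bar> powr p)) \<partial>frac_measure s p) < \<infinity>"
    using W0_gagliardo[OF assms] unfolding gagliardo_UNIV by simp
qed

lemma energy_eq_integral:
  assumes "u \<in> W0 \<Omega>"
  shows "energy u = (\<integral>z. \<bar>u (fst z) - u (snd z)\<bar> powr p \<partial>frac_measure s p)"
  unfolding energy_def gagliardo_UNIV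
  by (subst nn_integral_eq_integral[OF W0_integrable_powr[OF assms]]) auto

lemma W0_add:
  assumes "\<Omega> \<in> lmeasurable" "u \<in> W0 \<Omega>" "v \<in> W0 \<Omega>"
  shows "(\<lambda>x. u x + v x) \<in> W0 \<Omega>"
proof -
  have m [measurable]: "u \<in> borel_measurable lebesgue" "v \<in> borel_measurable lebesgue"
    using assms W0_measurable by auto
  have "gagliardo s p UNIV (\<lambda>x. u x + v x) \<le> ennreal (2 powr p) * (gagliardo s p UNIV u + gagliardo s p UNIV v)"
    using p_ge m by (intro gagliardo_add) auto
  also have "\<dots> < \<infinity>" using assms W0_gagliardo by (simp add: ennreal_mult_less_top)
  finally show ?thesis using W0_zero[OF assms(2)] W0_zero[OF assms(3)]
    unfolding W0_iff[OF assms(1)] by auto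
qed

lemma W0_cmult:
  assumes "\<Omega> \<in> lmeasurable" "u \<in> W0 \<Omega>"
  shows "(\<lambda>x. c * u x) \<in> W0 \<Omega>"
proof -
  have m [measurable]: "u \<in> borel_measurable lebesgue" using assms W0_measurable by auto
  have "gagliardo s p UNIV (\<lambda>x. c * u x) < \<infinity>" unfolding gagliardo_cmult[OF m]
    using W0_gagliardo[OF assms(2)] by (simp add: ennreal_mult_less_top)
  then show ?thesis using W0_zero[OF assms(2)] unfolding W0_iff[OF assms(1)] by auto
qed

lemma W0_diff:
  assumes "\<Omega> \<in> lmeasurable" "u \<in> W0 \<Omega>" "v \<in> W0 \<Omega>"
  shows "(\<lambda>x. u x - v x) \<in> W0 \<Omega>"
  using W0_add[OF assms(1,2) W0_cmult[OF assms(1,3), of "-1"]] by simp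

lemma energy_cmult:
  assumes "u \<in> W0 \<Omega>"
  shows "energy (\<lambda>x. c * u x) = \<bar>c\<bar> powr p * energy u"
  unfolding energy_def gagliardo_cmult[OF W0_measurable[OF assms]] by (simp add: enn2real_mult)

lemma W0_positive_part:
  assumes "\<Omega> \<in> lmeasurable" "u \<in> W0 \<Omega>"
  shows "(\<lambda>x. max 0 (u x)) \<in> W0 \<Omega>"
proof -
  have [measurable]: "u \<in> borel_measurable lebesgue" using assms W0_measurable by auto
  have "gagliardo s p UNIV (\<lambda>x. max 0 (u x)) \<le> gagliardo s p UNIV u"
    using p_ge by (intro gagliardo_mono) auto
  then show ?thesis using W0_zero[OF assms(2)] W0_gagliardo[OF assms(2)] unfolding W0_iff[OF assms(1)]
    by auto
qed

lemma W0_powr_P: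
  assumes "\<Omega> \<in> lmeasurable" "u \<in> W0 \<Omega>" "energy u \<le> e"
  shows "integrable lebesgue (\<lambda>x. \<bar>u x\<bar> powr P)"
    and "(\<integral>x. \<bar>u x\<bar> powr P \<partial>lebesgue) \<le> (sob_const * e) powr (N / (N - p * s))"
  using sobolev_inequality[OF W0_measurable[OF assms(2)] assms(1) W0_zero[OF assms(2)], of e]
    gagliardo_eq_energy[OF assms(2)] assms(3) energy_nonneg[of u]
  by (auto simp: ennreal_leI intro: order_trans)

section \<open>Compactness\<close>

lemma finite_dense_centers:
  assumes "bounded (\<Omega> :: 'a set)" "\<And>X. open X \<Longrightarrow> X \<noteq> {} \<Longrightarrow> \<exists>d\<in>D. d \<in> (X :: 'a set)" "0 < r"
  obtains F where "finite F" "F \<subseteq> D" "\<Omega> \<subseteq> (\<Union>c\<in>F. ball c r)"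
proof -
  have "closure \<Omega> \<subseteq> (\<Union>c\<in>D. ball c r)"
  proof
    fix x
    obtain d where "d \<in> D" "d \<in> ball x r" using assms(2)[of "ball x r"] assms(3) by auto
    then show "x \<in> (\<Union>c\<in>D. ball c r)" by (auto simp: dist_commute)
  qed
  moreover have "compact (closure \<Omega>)" using assms(1) by (simp add: compact_closure)
  ultimately obtain F where "F \<subseteq> D" "finite F" "closure \<Omega> \<subseteq> (\<Union>c\<in>F. ball c r)"
    by (metis compactE_image[of "closure \<Omega>" D "\<lambda>c. ball c r"] open_ball)
  then show thesis using that closure_subset[of \<Omega>] by blast
qed

text \<open>The \<open>p\<close>-th root in the deviation estimate is avoided by \<open>t \<le> \<eta> + \<eta> powr (1 - p) * t powr p\<close>, so that the
right-hand side can be integrated in terms of the energy.\<close>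

lemma deviation_le:
  fixes u :: "'a \<Rightarrow> real"
  assumes u: "u \<in> borel_measurable lebesgue" and r: "0 < r" and x: "dist x c \<le> r"
    and g: "slice_energy s p u x \<le> ennreal g" "0 \<le> g" and eta: "0 < \<eta>"
  shows "\<bar>u x - (\<integral>y. u y \<partial>lebesgue_on (ball c r)) / measure lebesgue (ball c r)\<bar>
    \<le> \<eta> + \<eta> powr (1 - p) * dev_const * r powr (p * s) * g"
proof -
  define t where "t = \<bar>u x - (\<integral>y. u y \<partial>lebesgue_on (ball c r)) / measure lebesgue (ball c r)\<bar>"
  have t: "t powr p \<le> dev_const * r powr (p * s) * g"
    unfolding t_def by (rule deviation_from_average[OF u r x g])
  have "t \<le> \<eta> + \<eta> powr (1 - p) * t powr p"
  proof (cases "t \<le> \<eta>")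
    case True
    have "0 \<le> \<eta> powr (1 - p) * t powr p" by simp
    then show ?thesis using True by linarith
  next
    case False
    then have t0: "t > 0" using eta by simp
    have "t = t powr (1 - p) * t powr p" using t0 by (simp add: powr_add[symmetric])
    also have "\<dots> \<le> \<eta> powr (1 - p) * t powr p" using False eta p_ge
      by (intro mult_right_mono powr_mono2') auto
    finally show ?thesis using eta by linarith
  qed
  also have "\<dots> \<le> \<eta> + \<eta> powr (1 - p) * (dev_const * r powr (p * s) * g)"
    using t by (intro add_left_mono mult_left_mono) auto
  finally show ?thesis by (simp add: t_def mult.assoc)
qed

text \<open>If the means of \<open>u\<close> and \<open>v\<close> agree up to \<open>\<delta>\<close> on finitely many balls of radius \<open>r\<close> covering \<open>\<Omega>\<close>, then
at almost every point of \<open>\<Omega>\<close> the functions differ by at most \<open>\<delta>\<close> plus their two deviations from these means.\<close>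

lemma L1_distance_le:
  fixes u v :: "'a \<Rightarrow> real"
  assumes \<Omega>: "\<Omega> \<in> lmeasurable" and u: "u \<in> W0 \<Omega>" "energy u \<le> e" and v: "v \<in> W0 \<Omega>" "energy v \<le> e"
    and iu: "integrable lebesgue u" "integrable lebesgue v"
    and r: "0 < r" and eta: "0 < \<eta>" and dl: "0 \<le> \<delta>" and cover: "\<Omega> \<subseteq> (\<Union>c\<in>F. ball c r)"
    and close: "\<And>c. c \<in> F \<Longrightarrow> \<bar>(\<integral>y. u y \<partial>lebesgue_on (ball c r)) - (\<integral>y. v y \<partial>lebesgue_on (ball c r))\<bar>
        \<le> \<delta> * measure lebesgue (ball c r)"
  shows "(\<integral>x. \<bar>u x - v x\<bar> \<partial>lebesgue) \<le> (2 * \<eta> + \<delta>) * measure lebesgue \<Omega>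
    + 2 * (\<eta> powr (1 - p) * dev_const * r powr (p * s) * e)"
proof -
  define A where "A = \<eta> powr (1 - p) * dev_const * r powr (p * s)"
  have A: "A \<ge> 0" using dev_const_pos by (simp add: A_def)
  have e: "e \<ge> 0" using u(2) energy_nonneg[of u] by linarith
  have [measurable]: "u \<in> borel_measurable lebesgue" "v \<in> borel_measurable lebesgue"
    using u v W0_measurable by auto
  have fin: "AE x in lebesgue. slice_energy s p w x \<noteq> \<infinity>" if w: "w \<in> W0 \<Omega>" for w
  proof (rule nn_integral_noteq_infinite)
    show "slice_energy s p w \<in> borel_measurable lebesgue"
      using W0_measurable[OF w] by (rule measurable_slice_energy)
    show "(\<integral>\<^sup>+x. slice_energy s p w x \<partial>lebesgue) \<noteq> \<infinity>"
      using W0_gagliardo[OF w] by (simp add: nn_integral_slice_energy[OF W0_measurable[OF w]])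
  qed
  have "AE x in lebesgue. ennreal \<bar>u x - v x\<bar> \<le> ennreal (2 * \<eta> + \<delta>) * indicator \<Omega> x
      + ennreal A * (slice_energy s p u x + slice_energy s p v x)"
    using fin[OF u(1)] fin[OF v(1)] W0_zero[OF u(1)] W0_zero[OF v(1)]
  proof eventually_elim
    case (elim x)
    show ?case
    proof (cases "x \<in> \<Omega>")
      case True
      then obtain c where c: "c \<in> F" "dist x c \<le> r" using cover by (force simp: dist_commute)
      let ?I = "\<lambda>w. (\<integral>y. w y \<partial>lebesgue_on (ball c r))" and ?V = "measure lebesgue (ball c r)"
      obtain g h where g: "slice_energy s p u x = ennreal g" "0 \<le> g"
        and h: "slice_energy s p v x = ennreal h" "0 \<le> h"
        using elim by (cases "slice_energy s p u x"; cases "slice_energy s p v x") auto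
      have V: "?V > 0" using r by (subst measure_ball) auto
      have "\<bar>?I u / ?V - ?I v / ?V\<bar> \<le> \<delta>"
        using close[OF c(1)] V by (simp add: diff_divide_distrib[symmetric] abs_divide pos_divide_le_eq)
      moreover have "\<bar>u x - ?I u / ?V\<bar> \<le> \<eta> + A * g" unfolding A_def
        using g r c eta by (intro deviation_le) auto
      moreover have "\<bar>v x - ?I v / ?V\<bar> \<le> \<eta> + A * h" unfolding A_def
        using h r c eta by (intro deviation_le) auto
      ultimately have "\<bar>u x - v x\<bar> \<le> (2 * \<eta> + \<delta>) + A * (g + h)" unfolding distrib_left by linarith
      then have "ennreal \<bar>u x - v x\<bar> \<le> ennreal ((2 * \<eta> + \<delta>) + A * (g + h))" by (rule ennreal_leI)
      also have "\<dots> = ennreal (2 * \<eta> + \<delta>) * indicator \<Omega> x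
      + ennreal A * (slice_energy s p u x + slice_energy s p v x)"
        using True g h A eta dl
        by (simp add: ennreal_plus[symmetric] ennreal_mult[symmetric] del: ennreal_plus)
      finally show ?thesis .
    qed (use elim in simp)
  qed
  then have "(\<integral>\<^sup>+x. ennreal \<bar>u x - v x\<bar> \<partial>lebesgue) \<le> (\<integral>\<^sup>+x. ennreal (2 * \<eta> + \<delta>) * indicator \<Omega> x
      + ennreal A * (slice_energy s p u x + slice_energy s p v x) \<partial>lebesgue)"
    by (rule nn_integral_mono_AE)
  also have "\<dots> = ennreal (2 * \<eta> + \<delta>) * emeasure lebesgue \<Omega>
      + ennreal A * (gagliardo s p UNIV u + gagliardo s p UNIV v)"
    using fmeasurableD[OF \<Omega>]
    by (subst nn_integral_add) (auto simp: nn_integral_cmult nn_integral_add nn_integral_slice_energy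
        nn_integral_cmult_indicator)
  also have "\<dots> = ennreal ((2 * \<eta> + \<delta>) * measure lebesgue \<Omega> + A * (energy u + energy v))"
    using gagliardo_eq_energy[OF u(1)] gagliardo_eq_energy[OF v(1)] A eta dl
    by (simp add: emeasure_eq_measure2[OF \<Omega>] ennreal_plus[symmetric] ennreal_mult[symmetric] del: ennreal_plus)
  finally have "(\<integral>\<^sup>+x. ennreal \<bar>u x - v x\<bar> \<partial>lebesgue)
      \<le> ennreal ((2 * \<eta> + \<delta>) * measure lebesgue \<Omega> + A * (energy u + energy v))" .
  moreover have "(\<integral>\<^sup>+x. ennreal \<bar>u x - v x\<bar> \<partial>lebesgue) = ennreal (\<integral>x. \<bar>u x - v x\<bar> \<partial>lebesgue)"
    using iu by (intro nn_integral_eq_integral) auto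
  moreover have "0 \<le> (2 * \<eta> + \<delta>) * measure lebesgue \<Omega> + A * (energy u + energy v)"
    using A eta dl by simp
  ultimately have "(\<integral>x. \<bar>u x - v x\<bar> \<partial>lebesgue) \<le> (2 * \<eta> + \<delta>) * measure lebesgue \<Omega> + A * (energy u + energy v)"
    by (simp add: ennreal_le_iff)
  also have "\<dots> \<le> (2 * \<eta> + \<delta>) * measure lebesgue \<Omega> + A * (2 * e)"
    using A u v by (intro add_left_mono mult_left_mono) auto
  finally show ?thesis by (simp add: A_def algebra_simps)
qed

text \<open>A Rellich theorem. A diagonal argument makes the integrals over all balls with centre in a countable
dense set and radius \<open>1 / (k + 1)\<close> converge. For a small radius, finitely many of these balls cover \<open>\<Omega>\<close>,
and the preceding estimate shows that the subsequence is Cauchy in \<open>L\<^sup>1\<close>; a further subsequence then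
converges almost everywhere.\<close>

lemma compactness:
  fixes u :: "nat \<Rightarrow> 'a \<Rightarrow> real"
  assumes \<Omega>: "\<Omega> \<in> lmeasurable" "bounded \<Omega>" and u: "\<And>n. u n \<in> W0 \<Omega>" "\<And>n. energy (u n) \<le> e"
  obtains r v where "strict_mono r" "v \<in> borel_measurable lebesgue"
    "AE x in lebesgue. (\<lambda>k. u (r k) x) \<longlonglongrightarrow> v x"
proof -
  define K where "K = measure lebesgue \<Omega> + (sob_const * e) powr (N / (N - p * s))"
  have um [measurable]: "u n \<in> borel_measurable lebesgue" for n using u W0_measurable by auto
  have iP: "integrable lebesgue (\<lambda>x. indicator \<Omega> x + \<bar>u n x\<bar> powr P)" for n
    using W0_powr_P[OF \<Omega>(1) u(1) u(2)] \<Omega>(1)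
    by (intro Bochner_Integration.integrable_add integrable_indicator_lmeasurable) auto
  have leP: "AE x in lebesgue. \<bar>u n x\<bar> \<le> indicator \<Omega> x + \<bar>u n x\<bar> powr P" for n
    using W0_zero[OF u(1)[of n]] by eventually_elim (use abs_le_P in \<open>auto simp: indicator_def\<close>)
  have iu: "integrable lebesgue (u n)" for n
    by (rule Bochner_Integration.integrable_bound[OF iP[of n]])
      (use leP[of n] in \<open>auto elim!: eventually_mono\<close>)
  have K: "(\<integral>x. \<bar>u n x\<bar> \<partial>lebesgue) \<le> K" for n
  proof -
    have "(\<integral>x. \<bar>u n x\<bar> \<partial>lebesgue) \<le> (\<integral>x. indicator \<Omega> x + \<bar>u n x\<bar> powr P \<partial>lebesgue)"
      using iu iP leP by (intro integral_mono_AE) auto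
    also have "\<dots> = measure lebesgue \<Omega> + (\<integral>x. \<bar>u n x\<bar> powr P \<partial>lebesgue)"
      using W0_powr_P(1)[OF \<Omega>(1) u(1) u(2)] integrable_indicator_lmeasurable[OF \<Omega>(1)] \<Omega>(1)
      by (subst Bochner_Integration.integral_add) auto
    also have "\<dots> \<le> K" unfolding K_def using W0_powr_P(2)[OF \<Omega>(1) u(1) u(2)] by simp
    finally show ?thesis .
  qed
  have ball_bd: "\<bar>\<integral>y. u n y \<partial>lebesgue_on (ball c \<rho>)\<bar> \<le> K" for n c \<rho>
  proof -
    have i: "integrable lebesgue (\<lambda>x. indicat_real (ball c \<rho>) x *\<^sub>R u n x)"
      by (rule integrable_mult_indicator[OF _ iu]) simp
    have "(\<integral>y. u n y \<partial>lebesgue_on (ball c \<rho>)) = (\<integral>x. indicat_real (ball c \<rho>) x *\<^sub>R u n x \<partial>lebesgue)"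
      by (rule integral_restrict_space) auto
    also have "\<bar>\<dots>\<bar> \<le> (\<integral>x. \<bar>indicat_real (ball c \<rho>) x *\<^sub>R u n x\<bar> \<partial>lebesgue)" by (rule integral_abs_bound)
    also have "\<dots> \<le> (\<integral>x. \<bar>u n x\<bar> \<partial>lebesgue)"
      using i iu by (intro integral_mono) (auto simp: indicator_def)
    also have "\<dots> \<le> K" by (rule K)
    finally show ?thesis .
  qed
  obtain D :: "'a set" where D: "countable D" "\<And>X. open X \<Longrightarrow> X \<noteq> {} \<Longrightarrow> \<exists>d\<in>D. d \<in> X"
    by (rule countable_dense_setE) blast
  define \<rho> where "\<rho> k = 1 / real (Suc k)" for k
  have \<rho>: "\<rho> k > 0" for k by (simp add: \<rho>_def)
  define I where "I n ck = (\<integral>y. u n y \<partial>lebesgue_on (ball (fst ck) (\<rho> (snd ck))))" for n and ck :: "'a \<times> nat"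
  have "countable (D \<times> (UNIV :: nat set))" using D(1) by simp
  then obtain r where r: "strict_mono r" "\<And>ck. ck \<in> D \<times> UNIV \<Longrightarrow> \<exists>l. (\<lambda>n. I (r n) ck) \<longlonglongrightarrow> l"
    by (rule function_convergent_subsequence[where f = I and M = K]) (use ball_bd in \<open>auto simp: I_def\<close>)
  have cauchy: "\<exists>n0. \<forall>i\<ge>n0. \<forall>j\<ge>n0. (\<integral>x. norm (u (r i) x - u (r j) x) \<partial>lebesgue) < \<epsilon>" if eps: "\<epsilon> > 0" for \<epsilon>
  proof -
    define m where "m = measure lebesgue \<Omega> + 1"
    have m: "m > 0" "measure lebesgue \<Omega> \<le> m" by (simp_all add: m_def add_nonneg_pos)
    \<comment> \<open>The parameter \<open>\<eta>\<close> is fixed before the radius, because the second error term contains a negative power of it.\<close>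
    define \<eta> where "\<eta> = \<epsilon> / (8 * m)"
    have eta: "\<eta> > 0" using eps m by (simp add: \<eta>_def)
    have "(\<lambda>k. 2 * (\<eta> powr (1 - p) * dev_const * \<rho> k powr (p * s) * e)) \<longlonglongrightarrow> 2 * (\<eta> powr (1 - p) * dev_const * 0 * e)"
    proof (intro tendsto_intros)
      have "\<rho> \<longlonglongrightarrow> 0" unfolding \<rho>_def by (rule LIMSEQ_Suc[OF lim_1_over_n, unfolded One_nat_def])
      then have "(\<lambda>k. \<rho> k powr (p * s)) \<longlonglongrightarrow> 0 powr (p * s)"
        using p_ge s_pos \<rho> by (intro tendsto_powr') (auto intro: always_eventually less_imp_le)
      then show "(\<lambda>k. \<rho> k powr (p * s)) \<longlonglongrightarrow> 0" by simp
    qed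
    then have "\<forall>\<^sub>F k in sequentially. 2 * (\<eta> powr (1 - p) * dev_const * \<rho> k powr (p * s) * e) < \<epsilon> / 2"
      by (rule order_tendstoD(2)) (use eps in simp)
    then obtain k where k: "2 * (\<eta> powr (1 - p) * dev_const * \<rho> k powr (p * s) * e) < \<epsilon> / 2"
      by (auto simp: eventually_sequentially)
    obtain F where F: "finite F" "F \<subseteq> D" "\<Omega> \<subseteq> (\<Union>c\<in>F. ball c (\<rho> k))"
      using finite_dense_centers[OF \<Omega>(2) D(2) \<rho>] by metis
    define V where "V = unit_ball_vol N * \<rho> k powr N"
    have V: "V > 0" "\<And>c :: 'a. measure lebesgue (ball c (\<rho> k)) = V"
      using \<rho>[of k] measure_ball[of "\<rho> k"] unfolding V_def by (auto simp del: measure_completion)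
    have "\<exists>n0. \<forall>i\<ge>n0. \<forall>j\<ge>n0. \<bar>I (r i) (c, k) - I (r j) (c, k)\<bar> < \<eta> * V" if "c \<in> F" for c
    proof -
      have "Cauchy (\<lambda>n. I (r n) (c, k))" using r(2)[of "(c, k)"] F that
        by (auto intro!: convergent_Cauchy simp: convergent_def)
      moreover have "0 < \<eta> * V" using V eta by simp
      ultimately show ?thesis using CauchyD by fastforce
    qed
    then obtain n0 where n0: "\<And>c i j. c \<in> F \<Longrightarrow> n0 c \<le> i \<Longrightarrow> n0 c \<le> j \<Longrightarrow>
        \<bar>I (r i) (c, k) - I (r j) (c, k)\<bar> < \<eta> * V" by metis
    have fm: "n0 c \<le> Max (n0 ` F)" if "c \<in> F" for c using F that by auto
    have "(\<integral>x. norm (u (r i) x - u (r j) x) \<partial>lebesgue) < \<epsilon>" if ij: "Max (n0 ` F) \<le> i" "Max (n0 ` F) \<le> j" for i j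
    proof -
      have "(\<integral>x. \<bar>u (r i) x - u (r j) x\<bar> \<partial>lebesgue) \<le> (2 * \<eta> + \<eta>) * measure lebesgue \<Omega>
        + 2 * (\<eta> powr (1 - p) * dev_const * \<rho> k powr (p * s) * e)"
      proof (rule L1_distance_le[OF \<Omega>(1) u u iu iu \<rho> eta _ F(3)])
        fix c assume c: "c \<in> F"
        have "\<bar>I (r i) (c, k) - I (r j) (c, k)\<bar> < \<eta> * V" using n0 c fm[OF c] ij by (meson order_trans)
        then show "\<bar>(\<integral>y. u (r i) y \<partial>lebesgue_on (ball c (\<rho> k))) - (\<integral>y. u (r j) y \<partial>lebesgue_on (ball c (\<rho> k)))\<bar>
            \<le> \<eta> * measure lebesgue (ball c (\<rho> k))" unfolding V(2) by (simp add: I_def)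
      qed (use eta in simp)
      also have "\<dots> < (2 * \<eta> + \<eta>) * m + \<epsilon> / 2" using k m eta by (intro add_le_less_mono mult_left_mono) auto
      also have "\<dots> < \<epsilon>" using m eps by (simp add: \<eta>_def field_simps)
      finally show ?thesis by simp
    qed
    then show ?thesis by blast
  qed
  obtain r' where r': "strict_mono r'" "AE x in lebesgue. Cauchy (\<lambda>i. u (r (r' i)) x)"
    by (rule cauchy_L1_AE_cauchy_subseq[of lebesgue "\<lambda>n. u (r n)"]) (use iu cauchy in auto)
  show thesis
  proof (rule that)
    show "strict_mono (r \<circ> r')" using r r' by (simp add: strict_mono_o)
    show "(\<lambda>x. lim (\<lambda>k. u ((r \<circ> r') k) x)) \<in> borel_measurable lebesgue" by (rule borel_measurable_lim_metric) auto
    show "AE x in lebesgue. (\<lambda>k. u ((r \<circ> r') k) x) \<longlonglongrightarrow> lim (\<lambda>k. u ((r \<circ> r') k) x)"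
      using r'(2) by eventually_elim (simp add: Cauchy_convergent_iff convergent_LIMSEQ_iff)
  qed
qed

end

section \<open>Caratheodory functions and their antiderivatives\<close>

text \<open>Approximating \<open>u\<close> by functions with values in a grid of mesh \<open>1 / (n + 1)\<close> reduces the composition to
countably many measurable functions \<open>g (\<cdot>, t)\<close>; continuity in \<open>t\<close> allows the passage to the limit.\<close>

lemma caratheodory_compose_measurable:
  fixes g :: "'b \<Rightarrow> real \<Rightarrow> real"
  assumes g: "\<And>t. (\<lambda>x. g x t) \<in> borel_measurable M" and cont: "\<And>x. continuous_on UNIV (g x)"
    and u [measurable]: "u \<in> borel_measurable M"
  shows "(\<lambda>x. g x (u x)) \<in> borel_measurable M"
proof (rule borel_measurable_LIMSEQ_real)
  define a where "a n i = real_of_int i / real (Suc n)" for n i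
  show "(\<lambda>x. g x (a n \<lfloor>real (Suc n) * u x\<rfloor>)) \<in> borel_measurable M" for n
    by (rule measurable_compose_countable[where f = "\<lambda>i x. g x (a n i)" and g = "\<lambda>x. \<lfloor>real (Suc n) * u x\<rfloor>"])
      (auto intro!: g)
  fix x
  have "(\<lambda>n. a n \<lfloor>real (Suc n) * u x\<rfloor>) \<longlonglongrightarrow> u x"
  proof (rule real_tendsto_sandwich)
    show "\<forall>\<^sub>F n in sequentially. u x - 1 / real (Suc n) \<le> a n \<lfloor>real (Suc n) * u x\<rfloor>"
    proof (intro always_eventually allI)
      fix n
      have "real (Suc n) * u x - 1 \<le> real_of_int \<lfloor>real (Suc n) * u x\<rfloor>" by linarith
      then have "(real (Suc n) * u x - 1) / real (Suc n) \<le> a n \<lfloor>real (Suc n) * u x\<rfloor>"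
        unfolding a_def by (intro divide_right_mono) auto
      then show "u x - 1 / real (Suc n) \<le> a n \<lfloor>real (Suc n) * u x\<rfloor>"
        by (simp add: diff_divide_distrib)
    qed
    show "\<forall>\<^sub>F n in sequentially. a n \<lfloor>real (Suc n) * u x\<rfloor> \<le> u x"
      by (intro always_eventually allI) (simp add: a_def pos_divide_le_eq mult.commute del: of_nat_Suc)
    show "(\<lambda>n. u x - 1 / real (Suc n)) \<longlonglongrightarrow> u x"
      using tendsto_diff[OF tendsto_const[of "u x"] LIMSEQ_Suc[OF lim_1_over_n]] by simp
  qed simp
  moreover have "isCont (g x) (u x)" using cont[of x] by (simp add: continuous_on_eq_continuous_at)
  ultimately show "(\<lambda>n. g x (a n \<lfloor>real (Suc n) * u x\<rfloor>)) \<longlonglongrightarrow> g x (u x)"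
    by (rule isCont_tendsto_compose[rotated])
qed

definition antideriv :: "('b \<Rightarrow> real \<Rightarrow> real) \<Rightarrow> 'b \<Rightarrow> real \<Rightarrow> real" where
  "antideriv g x t = (LBINT \<tau>=ereal 0..ereal t. g x \<tau>)"

lemma antideriv_0 [simp]: "antideriv g x 0 = 0"
  unfolding antideriv_def by (rule interval_integral_endpoints_same)

lemma antideriv_has_derivative:
  assumes "continuous_on UNIV (g x)"
  shows "(antideriv g x has_real_derivative g x t) (at t)"
proof -
  let ?S = "{- \<bar>t\<bar> - 1 .. \<bar>t\<bar> + 1}"
  have "((\<lambda>u. LBINT y=ereal 0..ereal u. g x y) has_vector_derivative g x t) (at t within ?S)"
    by (rule interval_integral_FTC2) (use assms in \<open>auto intro: continuous_on_subset\<close>)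
  moreover have "at t within ?S = at t" by (rule at_within_interior) (simp, linarith)
  ultimately show ?thesis
    unfolding antideriv_def[abs_def] has_real_derivative_iff_has_vector_derivative by simp
qed

lemma antideriv_lipschitz:
  assumes "continuous_on UNIV (g x)" "\<And>t. \<bar>g x t\<bar> \<le> H"
  shows "\<bar>antideriv g x a - antideriv g x b\<bar> \<le> H * \<bar>a - b\<bar>"
  using field_differentiable_bound[of UNIV "antideriv g x" "g x" H a b]
    antideriv_has_derivative[of g x, OF assms(1)] assms(2) by simp

lemma antideriv_continuous: "continuous_on UNIV (g x) \<Longrightarrow> continuous_on UNIV (antideriv g x)"
  using antideriv_has_derivative[of g x] DERIV_isCont continuous_at_imp_continuous_on by blast

text \<open>The previous lemma, applied to the second coordinate on the product with the line, gives joint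
measurability of \<open>g\<close>, and then Fubini's theorem applies.\<close>

lemma antideriv_measurable:
  fixes g :: "'b \<Rightarrow> real \<Rightarrow> real"
  assumes g: "\<And>t. (\<lambda>x. g x t) \<in> borel_measurable M" and cont: "\<And>x. continuous_on UNIV (g x)"
  shows "(\<lambda>x. antideriv g x t) \<in> borel_measurable M"
proof -
  have joint [measurable]: "(\<lambda>z. g (fst z) (snd z)) \<in> borel_measurable (M \<Otimes>\<^sub>M lborel)"
    by (rule caratheodory_compose_measurable[where g = "\<lambda>z. g (fst z)"])
      (use g cont in \<open>auto intro: measurable_compose[OF measurable_fst]\<close>)
  have "(\<lambda>x. \<integral>\<tau>. indicat_real A \<tau> *\<^sub>R g x \<tau> \<partial>lborel) \<in> borel_measurable M"
    if [measurable]: "A \<in> sets borel" for A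
  proof (rule lborel.borel_measurable_lebesgue_integral)
    have "(\<lambda>z. indicat_real A (snd z) *\<^sub>R g (fst z) (snd z)) \<in> borel_measurable (M \<Otimes>\<^sub>M lborel)"
      by measurable
    then show "(\<lambda>(x, \<tau>). indicat_real A \<tau> *\<^sub>R g x \<tau>) \<in> borel_measurable (M \<Otimes>\<^sub>M lborel)"
      by (simp add: case_prod_beta')
  qed
  then show ?thesis
    unfolding antideriv_def interval_lebesgue_integral_def set_lebesgue_integral_def
    by (cases "ereal 0 \<le> ereal t") auto
qed

section \<open>The signed power and the duality pairing\<close>

definition signed_power :: "real \<Rightarrow> real \<Rightarrow> real" where
  "signed_power p t = \<bar>t\<bar> powr (p - 2) * t"

lemma signed_power_minus: "signed_power p (- t) = - signed_power p t"
  by (simp add: signed_power_def)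

lemma signed_power_eq: "2 \<le> p \<Longrightarrow> signed_power p t = max t 0 powr (p - 1) - max (- t) 0 powr (p - 1)"
proof -
  assume p: "2 \<le> p"
  have pos: "x powr (p - 2) * x = x powr (p - 1)" if "x > 0" for x :: real
    using that powr_add[of x "p - 2" 1] by simp
  show ?thesis
  proof (cases t "0 :: real" rule: linorder_cases)
    case less
    then show ?thesis using pos[of "- t"] by (simp add: signed_power_def)
  next
    case greater
    then show ?thesis using pos[of t] by (simp add: signed_power_def)
  qed (simp add: signed_power_def)
qed

lemma abs_signed_power: "2 \<le> p \<Longrightarrow> \<bar>signed_power p t\<bar> = \<bar>t\<bar> powr (p - 1)"
  by (cases "t \<ge> 0") (auto simp: signed_power_eq max_def)

lemma signed_power_continuous: "2 \<le> p \<Longrightarrow> continuous_on UNIV (signed_power p)"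
proof -
  assume p: "2 \<le> p"
  have "signed_power p = (\<lambda>t. max t 0 powr (p - 1) - max (- t) 0 powr (p - 1))"
    using signed_power_eq[OF p] by (rule ext)
  then show ?thesis using p by (auto intro!: continuous_intros continuous_on_powr')
qed

lemma signed_power_strict_mono:
  assumes "2 \<le> p" "a < b"
  shows "signed_power p a < signed_power p b"
proof -
  have "max a 0 powr (p - 1) \<le> max b 0 powr (p - 1)"
    "max (- b) 0 powr (p - 1) \<le> max (- a) 0 powr (p - 1)"
    using assms by (auto intro!: powr_mono2)
  moreover have "max a 0 powr (p - 1) < max b 0 powr (p - 1)" if "b > 0"
    using assms that by (intro powr_less_mono2) auto
  moreover have "max (- b) 0 powr (p - 1) < max (- a) 0 powr (p - 1)" if "b \<le> 0"
    using assms that by (intro powr_less_mono2) auto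
  ultimately show ?thesis using assms unfolding signed_power_eq[OF assms(1)]
    by (smt (verit))
qed

lemma powr_mult_le_add:
  fixes a b p :: real
  assumes "1 \<le> p" "0 \<le> a" "0 \<le> b"
  shows "a powr (p - 1) * b \<le> a powr p + b powr p"
proof (cases "a \<le> b")
  case True
  have "a powr (p - 1) * b \<le> b powr (p - 1) * b" using True assms by (intro mult_right_mono powr_mono2) auto
  also have "\<dots> = b powr p" using assms by (cases "b = 0") (auto simp: powr_diff)
  finally show ?thesis using powr_ge_zero[of a p] by linarith
next
  case False
  have "a powr (p - 1) * b \<le> a powr (p - 1) * a" using False by (intro mult_left_mono) auto
  also have "\<dots> = a powr p" using assms by (cases "a = 0") (auto simp: powr_diff)
  finally show ?thesis using powr_ge_zero[of b p] by linarith
qed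

text \<open>Young's inequality with a small factor at the second term, from a case distinction on whether
\<open>a \<le> l * b\<close> with \<open>l powr (p - 1) = \<delta>\<close>.\<close>

lemma powr_mult_le_eps:
  fixes p \<delta> :: real
  assumes "1 < p" "0 < \<delta>"
  obtains C :: real where "0 \<le> C" "\<And>a b. 0 \<le> a \<Longrightarrow> 0 \<le> b \<Longrightarrow> a powr (p - 1) * b \<le> C * a powr p + \<delta> * b powr p"
proof
  define l where "l = \<delta> powr (1 / (p - 1))"
  have l: "l > 0" "l powr (p - 1) = \<delta>" using assms by (auto simp: l_def powr_powr)
  show "0 \<le> 1 / l" using l by simp
  fix a b :: real assume ab: "0 \<le> a" "0 \<le> b"
  show "a powr (p - 1) * b \<le> 1 / l * a powr p + \<delta> * b powr p"
  proof (cases "a \<le> l * b")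
    case True
    have "a powr (p - 1) * b \<le> (l * b) powr (p - 1) * b" using True assms ab by (intro mult_right_mono powr_mono2) auto
    also have "\<dots> = \<delta> * (b powr (p - 1) * b)" using l by (simp add: powr_mult)
    also have "b powr (p - 1) * b = b powr p" using ab by (cases "b = 0") (auto simp: powr_diff)
    finally show ?thesis using l by (smt (verit) powr_ge_zero divide_nonneg_pos mult_nonneg_nonneg)
  next
    case False
    then have "b \<le> a / l" using l by (simp add: pos_le_divide_eq mult.commute)
    then have "a powr (p - 1) * b \<le> a powr (p - 1) * (a / l)" by (intro mult_left_mono) auto
    also have "\<dots> = 1 / l * (a powr (p - 1) * a)" by simp
    also have "a powr (p - 1) * a = a powr p" using ab by (cases "a = 0") (auto simp: powr_diff)
    finally show ?thesis using assms by (smt (verit) powr_ge_zero mult_nonneg_nonneg)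
  qed
qed

text \<open>Convexity of \<open>\<bar>\<cdot>\<bar>\<^sup>p\<close>, with the tangent taken at \<open>b\<close>. It replaces the differentiation of the energy
under the integral sign in the Euler-Lagrange equation.\<close>

lemma powr_abs_convex_tangent:
  assumes "2 \<le> p"
  shows "\<bar>b\<bar> powr p - \<bar>a\<bar> powr p \<le> p * (signed_power p b * (b - a))"
proof -
  have bb: "signed_power p b * b = \<bar>b\<bar> powr p"
  proof (cases "b = 0")
    case False
    have "signed_power p b * b = \<bar>b\<bar> powr (p - 2) * \<bar>b\<bar> powr 2"
      using False by (simp add: signed_power_def power2_eq_square)
    also have "\<dots> = \<bar>b\<bar> powr p" using False by (simp add: powr_add[symmetric] del: powr_numeral)
    finally show ?thesis .
  qed (simp add: signed_power_def)
  have "signed_power p b * a \<le> \<bar>signed_power p b\<bar> * \<bar>a\<bar>"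
    by (metis abs_ge_self abs_mult)
  also have "\<dots> = \<bar>b\<bar> powr (p - 1) * \<bar>a\<bar>" using assms by (simp add: abs_signed_power)
  also have "\<dots> \<le> (\<bar>b\<bar> powr (p - 1)) powr (p / (p - 1)) / (p / (p - 1)) + \<bar>a\<bar> powr p / p"
    using assms by (intro Youngs_inequality) (auto simp: field_simps)
  also have "(\<bar>b\<bar> powr (p - 1)) powr (p / (p - 1)) = \<bar>b\<bar> powr p" using assms by (simp add: powr_powr)
  finally have "p * (signed_power p b * a) \<le> p * (\<bar>b\<bar> powr p / (p / (p - 1)) + \<bar>a\<bar> powr p / p)"
    using assms by (intro mult_left_mono) auto
  also have "\<dots> = (p - 1) * \<bar>b\<bar> powr p + \<bar>a\<bar> powr p" using assms by (simp add: field_simps)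
  finally have "p * (signed_power p b * a) \<le> (p - 1) * \<bar>b\<bar> powr p + \<bar>a\<bar> powr p" .
  moreover have "signed_power p b * (b - a) = \<bar>b\<bar> powr p - signed_power p b * a"
    by (simp add: right_diff_distrib bb)
  ultimately show ?thesis by (simp add: left_diff_distrib right_diff_distrib)
qed

lemma frac_plaplacian_eq:
  "frac_plaplacian s p u v =
     (\<integral>z. signed_power p (u (fst z) - u (snd z)) * (v (fst z) - v (snd z)) \<partial>frac_measure s p)"
  unfolding frac_plaplacian_def by (simp add: signed_power_def case_prod_beta')

lemma signed_power_measurable [measurable]: "2 \<le> p \<Longrightarrow> signed_power p \<in> borel_measurable borel"
  by (intro borel_measurable_continuous_onI signed_power_continuous)

context sobolev_exponents
begin

lemma signed_power_p_measurable [measurable]: "signed_power p \<in> borel_measurable borel"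
  using p_ge by (rule signed_power_measurable)

lemma pairing_integrand_measurable:
  fixes u v :: "'a \<Rightarrow> real"
  assumes [measurable]: "u \<in> borel_measurable lebesgue" "v \<in> borel_measurable lebesgue"
  shows "(\<lambda>z. signed_power p (u (fst z) - u (snd z)) * (v (fst z) - v (snd z))) \<in> borel_measurable (frac_measure s p)"
  by measurable

lemma signed_power_mult_le: "\<bar>signed_power p a * b\<bar> \<le> \<bar>a\<bar> powr p + \<bar>b\<bar> powr p"
  using powr_mult_le_add[of p "\<bar>a\<bar>" "\<bar>b\<bar>"] p_ge by (simp add: abs_mult abs_signed_power)

lemma W0_pairing_integrable:
  assumes "u \<in> W0 \<Omega>" "v \<in> W0 \<Omega>"
  shows "integrable (frac_measure s p) (\<lambda>z. signed_power p (u (fst z) - u (snd z)) * (v (fst z) - v (snd z)))"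
proof (rule Bochner_Integration.integrable_bound)
  show "integrable (frac_measure s p) (\<lambda>z. \<bar>u (fst z) - u (snd z)\<bar> powr p + \<bar>v (fst z) - v (snd z)\<bar> powr p)"
    using assms W0_integrable_powr by (intro Bochner_Integration.integrable_add) auto
  show "AE z in frac_measure s p. norm (signed_power p (u (fst z) - u (snd z)) * (v (fst z) - v (snd z)))
      \<le> norm (\<bar>u (fst z) - u (snd z)\<bar> powr p + \<bar>v (fst z) - v (snd z)\<bar> powr p)"
  proof (rule AE_I2)
    fix z
    show "norm (signed_power p (u (fst z) - u (snd z)) * (v (fst z) - v (snd z)))
      \<le> norm (\<bar>u (fst z) - u (snd z)\<bar> powr p + \<bar>v (fst z) - v (snd z)\<bar> powr p)"
      using signed_power_mult_le[of "u (fst z) - u (snd z)" "v (fst z) - v (snd z)"] by simp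
  qed
qed (rule pairing_integrand_measurable[OF W0_measurable[OF assms(1)] W0_measurable[OF assms(2)]])

lemma frac_plaplacian_uminus: "frac_plaplacian s p u (\<lambda>x. - v x) = - frac_plaplacian s p u v"
proof -
  have "signed_power p a * (- b - - c) = - (signed_power p a * (b - c))" for a b c
    by (simp add: algebra_simps)
  note neg = this
  show ?thesis unfolding frac_plaplacian_eq neg by simp
qed

lemma frac_plaplacian_uminus_left: "frac_plaplacian s p (\<lambda>x. - u x) v = - frac_plaplacian s p u v"
proof -
  have "signed_power p (- a - - b) = - signed_power p (a - b)" for a b
  proof -
    have "- a - - b = - (a - b)" by simp
    then show ?thesis by (simp only: signed_power_minus)
  qed
  note neg = this
  show ?thesis unfolding frac_plaplacian_eq neg by simp
qed

end

section \<open>Existence for a right-hand side bounded uniformly in the unknown\<close>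

text \<open>The bound \<open>c * m powr (P - 1)\<close> with \<open>m\<close> in \<open>L\<^sup>P\<close> describes the dual exponent of \<open>P\<close> without naming it:
by Young's inequality, its product with any function in \<open>L\<^sup>P\<close> is integrable.\<close>

locale bounded_rhs = sobolev_exponents space_type N s p
  for space_type :: "'a::euclidean_space itself" and N s p :: real +
  fixes \<Omega> :: "'a set" and g :: "'a \<Rightarrow> real \<Rightarrow> real" and m :: "'a \<Rightarrow> real" and c :: real
  assumes \<Omega>: "\<Omega> \<in> lmeasurable" "bounded \<Omega>"
    and g_measurable: "\<And>t. (\<lambda>x. g x t) \<in> borel_measurable lebesgue"
    and g_continuous: "\<And>x. continuous_on UNIV (g x)"
    and m_measurable [measurable]: "m \<in> borel_measurable lebesgue"
    and m_nonneg: "\<And>x. 0 \<le> m x" and c_nonneg: "0 \<le> c"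
    and m_integrable: "integrable lebesgue (\<lambda>x. m x powr P)"
    and g_bound: "\<And>x t. \<bar>g x t\<bar> \<le> c * m x powr (P - 1)"
begin

definition h :: "'a \<Rightarrow> real" where "h x = c * m x powr (P - 1)"

lemma h_nonneg: "0 \<le> h x" using c_nonneg by (simp add: h_def)

lemma h_measurable [measurable]: "h \<in> borel_measurable lebesgue"
  unfolding h_def[abs_def] by measurable

lemma h_mult_le: "h x * \<bar>t\<bar> \<le> c * (m x powr P + \<bar>t\<bar> powr P)"
  using mult_left_mono[OF powr_mult_le_add[of P "m x" "\<bar>t\<bar>"] c_nonneg] P_gt_2 m_nonneg[of x]
  by (simp add: h_def mult.assoc)

lemma h_mult_integrable:
  assumes "v \<in> W0 \<Omega>"
  shows "integrable lebesgue (\<lambda>x. h x * \<bar>v x\<bar>)"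
proof (rule Bochner_Integration.integrable_bound)
  have [measurable]: "v \<in> borel_measurable lebesgue" using assms by (rule W0_measurable)
  show "integrable lebesgue (\<lambda>x. c * (m x powr P + \<bar>v x\<bar> powr P))"
    using W0_powr_P(1)[OF \<Omega>(1) assms order_refl] m_integrable by simp
  show "(\<lambda>x. h x * \<bar>v x\<bar>) \<in> borel_measurable lebesgue" by measurable
  show "AE x in lebesgue. norm (h x * \<bar>v x\<bar>) \<le> norm (c * (m x powr P + \<bar>v x\<bar> powr P))"
  proof (rule AE_I2)
    fix x
    have "0 \<le> h x * \<bar>v x\<bar>" using h_nonneg by simp
    then show "norm (h x * \<bar>v x\<bar>) \<le> norm (c * (m x powr P + \<bar>v x\<bar> powr P))"
      using h_mult_le[of x "v x"] by simp
  qed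
qed

text \<open>Young's inequality bounds the pairing on the unit ball of the energy, and homogeneity extends this to
linear growth in the \<open>p\<close>-th root of the energy. Applied without rescaling, Young's inequality would
give the power \<open>P / p > 1\<close> of the energy, which is useless for coercivity.\<close>

lemma h_pairing_bound:
  obtains K where "0 \<le> K" "\<And>v. v \<in> W0 \<Omega> \<Longrightarrow> (\<integral>x. h x * \<bar>v x\<bar> \<partial>lebesgue) \<le> K * (1 + energy v powr (1 / p))"
proof
  define K where "K = c * ((\<integral>x. m x powr P \<partial>lebesgue) + (sob_const * 1) powr (N / (N - p * s)))"
  show "0 \<le> K" unfolding K_def using c_nonneg by (intro mult_nonneg_nonneg add_nonneg_nonneg) auto
  fix v assume v: "v \<in> W0 \<Omega>"
  define R where "R = 1 + energy v powr (1 / p)"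
  have R: "R \<ge> 1" by (simp add: R_def)
  define w where "w x = (1 / R) * v x" for x
  have w: "w \<in> W0 \<Omega>" unfolding w_def by (rule W0_cmult[OF \<Omega>(1) v])
  have "energy v = (energy v powr (1 / p)) powr p"
    using p_ge by (simp add: powr_powr)
  also have "\<dots> \<le> R powr p" unfolding R_def using p_ge by (intro powr_mono2) auto
  finally have "energy v \<le> R powr p" .
  then have "energy w \<le> 1" unfolding w_def energy_cmult[OF v]
    using R by (simp add: powr_divide field_simps)
  note wP = W0_powr_P[OF \<Omega>(1) w this]
  have "(\<integral>x. h x * \<bar>w x\<bar> \<partial>lebesgue) \<le> (\<integral>x. c * (m x powr P + \<bar>w x\<bar> powr P) \<partial>lebesgue)"
    using h_mult_integrable[OF w] wP(1) m_integrable by (intro integral_mono h_mult_le) auto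
  also have "\<dots> = c * ((\<integral>x. m x powr P \<partial>lebesgue) + (\<integral>x. \<bar>w x\<bar> powr P \<partial>lebesgue))"
    using wP(1) m_integrable by simp
  also have "\<dots> \<le> K" unfolding K_def using wP(2) c_nonneg by (intro mult_left_mono add_left_mono) auto
  finally have "(\<integral>x. h x * \<bar>w x\<bar> \<partial>lebesgue) \<le> K" .
  moreover have "(\<integral>x. h x * \<bar>v x\<bar> \<partial>lebesgue) = R * (\<integral>x. h x * \<bar>w x\<bar> \<partial>lebesgue)"
    unfolding integral_mult_right_zero[symmetric] using R by (intro Bochner_Integration.integral_cong) (auto simp: w_def abs_mult)
  ultimately show "(\<integral>x. h x * \<bar>v x\<bar> \<partial>lebesgue) \<le> K * (1 + energy v powr (1 / p))"
    using R mult_left_mono[of "\<integral>x. h x * \<bar>w x\<bar> \<partial>lebesgue" K R] by (simp add: R_def mult.commute)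
qed

text \<open>Vitali convergence by hand. Young's inequality with a small factor splits \<open>h * \<bar>w n\<bar>\<close> into a part
dominated by a multiple of \<open>m powr P\<close>, to which dominated convergence applies, and \<open>\<delta>\<close> times the
\<open>P\<close>-th powers, whose integrals are bounded by the Sobolev inequality.\<close>

lemma h_pairing_tendsto_0:
  assumes w: "\<And>n. w n \<in> W0 \<Omega>" "\<And>n. energy (w n) \<le> e" and lim: "AE x in lebesgue. (\<lambda>n. w n x) \<longlonglongrightarrow> 0"
  shows "(\<lambda>n. \<integral>x. h x * \<bar>w n x\<bar> \<partial>lebesgue) \<longlonglongrightarrow> 0"
proof (rule LIMSEQ_I)
  fix \<epsilon> :: real assume eps: "\<epsilon> > 0"
  define S where "S = (sob_const * e) powr (N / (N - p * s))"
  have S: "S \<ge> 0" by (simp add: S_def)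
  define \<delta> where "\<delta> = \<epsilon> / (2 * (c * S + 1))"
  have cS: "c * S + 1 > 0" using S c_nonneg by (simp add: add_nonneg_pos)
  have dl: "\<delta> > 0" using eps cS by (simp add: \<delta>_def)
  obtain C where C: "0 \<le> C" "\<And>a b. 0 \<le> a \<Longrightarrow> 0 \<le> b \<Longrightarrow> a powr (P - 1) * b \<le> C * a powr P + \<delta> * b powr P"
    using powr_mult_le_eps[of P \<delta>] P_gt_2 dl by auto
  have [measurable]: "w n \<in> borel_measurable lebesgue" for n using w(1) by (rule W0_measurable)
  note iP = W0_powr_P[OF \<Omega>(1) w]
  \<comment> \<open>The positive part keeps the excess over the small term nonnegative and dominated.\<close>
  define q where "q n x = max 0 (h x * \<bar>w n x\<bar> - c * \<delta> * \<bar>w n x\<bar> powr P)" for n x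
  have qle: "q n x \<le> c * C * m x powr P" for n x
  proof -
    have "h x * \<bar>w n x\<bar> \<le> c * (C * m x powr P + \<delta> * \<bar>w n x\<bar> powr P)"
      using mult_left_mono[OF C(2)[of "m x" "\<bar>w n x\<bar>"] c_nonneg] m_nonneg by (simp add: h_def mult.assoc)
    then show ?thesis using C(1) c_nonneg by (simp add: q_def algebra_simps)
  qed
  have qint: "integrable lebesgue (q n)" for n
    by (rule Bochner_Integration.integrable_bound[of _ "\<lambda>x. c * C * m x powr P"])
      (use qle m_integrable in \<open>auto simp: q_def[abs_def] intro!: AE_I2 abs_leI order_trans[OF _ abs_ge_self]\<close>)
  have "(\<lambda>n. \<integral>x. q n x \<partial>lebesgue) \<longlonglongrightarrow> (\<integral>x. 0 \<partial>(lebesgue :: 'a measure))"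
  proof (rule integral_dominated_convergence[where w = "\<lambda>x. c * C * m x powr P"])
    show "AE x in lebesgue. (\<lambda>n. q n x) \<longlonglongrightarrow> 0" using lim
    proof eventually_elim
      case (elim x)
      have "(\<lambda>n. max 0 (h x * \<bar>w n x\<bar> - c * \<delta> * \<bar>w n x\<bar> powr P)) \<longlonglongrightarrow> max 0 (h x * \<bar>0\<bar> - c * \<delta> * \<bar>0\<bar> powr P)"
        using elim P_gt_2 by (intro tendsto_intros tendsto_powr') auto
      then show ?case by (simp add: q_def)
    qed
    show "AE x in lebesgue. norm (q n x) \<le> c * C * m x powr P" for n
      using qle by (auto simp: q_def)
  qed (use qint m_integrable in auto)
  then have "\<forall>\<^sub>F n in sequentially. (\<integral>x. q n x \<partial>lebesgue) < \<epsilon> / 2"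
    by (rule order_tendstoD(2)) (use eps in simp)
  then obtain n0 where n0: "\<And>n. n \<ge> n0 \<Longrightarrow> (\<integral>x. q n x \<partial>lebesgue) < \<epsilon> / 2" by (auto simp: eventually_sequentially)
  have "norm ((\<integral>x. h x * \<bar>w n x\<bar> \<partial>lebesgue) - 0) < \<epsilon>" if n: "n \<ge> n0" for n
  proof -
    have "(\<integral>x. h x * \<bar>w n x\<bar> \<partial>lebesgue) \<le> (\<integral>x. q n x + c * \<delta> * \<bar>w n x\<bar> powr P \<partial>lebesgue)"
      using h_mult_integrable[OF w(1)] qint iP(1) by (intro integral_mono) (auto simp: q_def)
    also have "\<dots> = (\<integral>x. q n x \<partial>lebesgue) + c * \<delta> * (\<integral>x. \<bar>w n x\<bar> powr P \<partial>lebesgue)"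
      using qint iP(1) by simp
    also have "\<dots> < \<epsilon> / 2 + c * \<delta> * S"
      using n0[OF n] iP(2) dl c_nonneg unfolding S_def by (intro add_less_le_mono mult_left_mono) auto
    also have "c * \<delta> * S \<le> \<epsilon> / 2"
    proof -
      have "c * S * \<delta> \<le> (c * S + 1) * \<delta>" using dl by (intro mult_right_mono) auto
      also have "\<dots> = \<epsilon> / 2"
      proof -
        have "D * (\<epsilon> / (2 * D)) = \<epsilon> / 2" if "D > 0" for D :: real using that by simp
        then show ?thesis unfolding \<delta>_def using cS by blast
      qed
      finally show ?thesis by (simp add: mult_ac)
    qed
    finally have "(\<integral>x. h x * \<bar>w n x\<bar> \<partial>lebesgue) < \<epsilon>" by simp
    moreover have "0 \<le> (\<integral>x. h x * \<bar>w n x\<bar> \<partial>lebesgue)" using h_nonneg by simp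
    ultimately show ?thesis by simp
  qed
  then show "\<exists>n0. \<forall>n\<ge>n0. norm ((\<integral>x. h x * \<bar>w n x\<bar> \<partial>lebesgue) - 0) < \<epsilon>" by blast
qed

definition G :: "'a \<Rightarrow> real \<Rightarrow> real" where "G = antideriv g"

lemma G_lipschitz: "\<bar>G x a - G x b\<bar> \<le> h x * \<bar>a - b\<bar>"
  unfolding G_def h_def by (rule antideriv_lipschitz[OF g_continuous g_bound])

lemma G_compose_measurable:
  assumes "u \<in> borel_measurable lebesgue"
  shows "(\<lambda>x. G x (u x)) \<in> borel_measurable lebesgue"
  unfolding G_def
  by (rule caratheodory_compose_measurable[OF antideriv_measurable[OF g_measurable g_continuous]
        antideriv_continuous[OF g_continuous] assms])

lemma G_integrable:
  assumes "u \<in> W0 \<Omega>"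
  shows "integrable lebesgue (\<lambda>x. G x (u x))"
proof (rule Bochner_Integration.integrable_bound[OF h_mult_integrable[OF assms]])
  show "AE x in lebesgue. norm (G x (u x)) \<le> norm (h x * \<bar>u x\<bar>)"
  proof (rule AE_I2)
    fix x
    show "norm (G x (u x)) \<le> norm (h x * \<bar>u x\<bar>)"
      using G_lipschitz[of x "u x" 0] h_nonneg[of x] by (simp add: G_def abs_mult)
  qed
qed (rule G_compose_measurable[OF W0_measurable[OF assms]])

definition J :: "('a \<Rightarrow> real) \<Rightarrow> real" where
  "J u = energy u / p - (\<integral>x. G x (u x) \<partial>lebesgue)"

text \<open>The linear growth of the pairing is absorbed into half of the energy term, because \<open>p > 1\<close>.\<close>

lemma J_coercive:
  obtains L where "\<And>u. u \<in> W0 \<Omega> \<Longrightarrow> energy u / (2 * p) - L \<le> J u"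
proof -
  obtain K where K: "0 \<le> K" "\<And>v. v \<in> W0 \<Omega> \<Longrightarrow> (\<integral>x. h x * \<bar>v x\<bar> \<partial>lebesgue) \<le> K * (1 + energy v powr (1 / p))"
    by (rule h_pairing_bound) blast
  \<comment> \<open>Beyond \<open>R0\<close>, the \<open>p\<close>-th root of the energy makes half of the energy term exceed the linear term.\<close>
  define R0 where "R0 = (2 * p * K) powr (1 / (p - 1))"
  have R0: "R0 \<ge> 0" "R0 powr (p - 1) = 2 * p * K" using p_ge K(1) by (simp_all add: R0_def powr_powr)
  show thesis
  proof (rule that)
    fix u assume u: "u \<in> W0 \<Omega>"
    define R where "R = energy u powr (1 / p)"
    have R: "R \<ge> 0" "R powr p = energy u" using p_ge by (auto simp: R_def powr_powr)
    have "(\<integral>x. G x (u x) \<partial>lebesgue) \<le> (\<integral>x. h x * \<bar>u x\<bar> \<partial>lebesgue)"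
    proof (rule integral_mono[OF G_integrable[OF u] h_mult_integrable[OF u]])
      fix x show "G x (u x) \<le> h x * \<bar>u x\<bar>" using G_lipschitz[of x "u x" 0] by (simp add: G_def)
    qed
    also have "\<dots> \<le> K + K * R" using K(2)[OF u] by (simp add: R_def distrib_left)
    also have "K * R \<le> energy u / (2 * p) + K * R0"
    proof (cases "R \<le> R0")
      case True
      then have "K * R \<le> K * R0" using K by (intro mult_left_mono) auto
      then show ?thesis using p_ge energy_nonneg[of u] by (smt (verit) divide_nonneg_pos)
    next
      case False
      then have "R0 powr (p - 1) \<le> R powr (p - 1)" using R0 p_ge by (intro powr_mono2) auto
      then have "2 * p * K * R \<le> R powr (p - 1) * R" unfolding R0(2) using R by (intro mult_right_mono) auto
      also have "\<dots> = energy u" using False R R0 by (simp add: powr_diff R(2)[symmetric])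
      finally have "K * R \<le> energy u / (2 * p)" using p_ge by (simp add: field_simps)
      then show ?thesis using K R0 by (smt (verit) mult_nonneg_nonneg)
    qed
    finally have "J u \<ge> energy u / p - (K + (energy u / (2 * p) + K * R0))" unfolding J_def by simp
    moreover have "energy u / p = energy u / (2 * p) + energy u / (2 * p)" by simp
    ultimately show "energy u / (2 * p) - (K + K * R0) \<le> J u" by linarith
  qed
qed

text \<open>A minimising sequence has bounded energy, hence a subsequence converging almost everywhere. The lower
order term is continuous along it, so the energies are bounded by a convergent sequence, and
Fatou's lemma transfers the limit of that bound to the energy of the limit function.\<close>

lemma minimizer_exists:
  obtains v where "v \<in> W0 \<Omega>" "\<And>w. w \<in> W0 \<Omega> \<Longrightarrow> J v \<le> J w"
proof -
  obtain L where L: "\<And>u. u \<in> W0 \<Omega> \<Longrightarrow> energy u / (2 * p) - L \<le> J u" by (rule J_coercive) blast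
  have zero: "(\<lambda>x. 0) \<in> W0 \<Omega>" using p_ge unfolding W0_iff[OF \<Omega>(1)] by (simp add: gagliardo_UNIV)
  define J0 where "J0 = Inf (J ` W0 \<Omega>)"
  have bdd: "bdd_below (J ` W0 \<Omega>)"
  proof (rule bdd_belowI2)
    fix u assume u: "u \<in> W0 \<Omega>"
    have "0 \<le> energy u / (2 * p)" using p_ge by simp
    then show "- L \<le> J u" using L[OF u] by linarith
  qed
  have J0le: "J0 \<le> J w" if "w \<in> W0 \<Omega>" for w unfolding J0_def using that bdd by (intro cINF_lower) auto
  have "\<exists>u\<in>W0 \<Omega>. J u < J0 + 1 / real (Suc n)" for n
  proof -
    have "Inf (J ` W0 \<Omega>) < J0 + 1 / real (Suc n)" by (simp add: J0_def)
    then show ?thesis using zero bdd by (subst (asm) cINF_less_iff) auto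
  qed
  then obtain u where u: "\<And>n. u n \<in> W0 \<Omega>" "\<And>n. J (u n) < J0 + 1 / real (Suc n)" by metis
  define e where "e = 2 * p * (J0 + 1 + L)"
  have en: "energy (u n) \<le> e" for n
  proof -
    have "1 / real (Suc n) \<le> 1" by simp
    then have "energy (u n) / (2 * p) \<le> J0 + 1 + L" using L[OF u(1)[of n]] u(2)[of n] by linarith
    then show ?thesis using p_ge by (simp add: e_def field_simps)
  qed
  obtain r v where r: "strict_mono r" and vm [measurable]: "v \<in> borel_measurable lebesgue"
    and lim: "AE x in lebesgue. (\<lambda>k. u (r k) x) \<longlonglongrightarrow> v x"
    by (rule compactness[OF \<Omega> u(1) en])
  have [measurable]: "u n \<in> borel_measurable lebesgue" for n using u(1) by (rule W0_measurable)
  have limit_energy: "gagliardo s p UNIV v \<le> C"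
    if "\<And>k. gagliardo s p UNIV (u (r k)) \<le> cc k" "cc \<longlonglongrightarrow> C" for cc C
    unfolding gagliardo_UNIV
  proof (rule nn_integral_le_of_AE_tendsto[OF _ _ _ that(2)])
    show "AE z in frac_measure s p. (\<lambda>k. ennreal (\<bar>u (r k) (fst z) - u (r k) (snd z)\<bar> powr p)) \<longlonglongrightarrow>
        ennreal (\<bar>v (fst z) - v (snd z)\<bar> powr p)"
      using AE_frac_measure[OF lim, of s p]
    proof eventually_elim
      case (elim z)
      then show ?case using p_ge
        by (intro tendsto_ennrealI tendsto_powr' tendsto_rabs tendsto_diff tendsto_const) auto
    qed
    show "(\<integral>\<^sup>+z. ennreal (\<bar>u (r k) (fst z) - u (r k) (snd z)\<bar> powr p) \<partial>frac_measure s p) \<le> cc k" for k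
      using that(1)[of k] by (simp add: gagliardo_UNIV)
  qed measurable
  have "gagliardo s p UNIV v \<le> ennreal e"
    by (rule limit_energy[of "\<lambda>_. ennreal e"]) (auto simp: gagliardo_eq_energy[OF u(1)] en ennreal_leI)
  moreover have "AE x in lebesgue. x \<notin> \<Omega> \<longrightarrow> v x = 0"
  proof -
    have "AE x in lebesgue. \<forall>n. x \<notin> \<Omega> \<longrightarrow> u n x = 0" unfolding AE_all_countable using W0_zero[OF u(1)] by blast
    then show ?thesis using lim by eventually_elim (auto intro: LIMSEQ_unique)
  qed
  ultimately have v: "v \<in> W0 \<Omega>" unfolding W0_iff[OF \<Omega>(1)] by (auto simp: le_less_trans[OF _ ennreal_less_top])
  have "(\<lambda>k. \<integral>x. h x * \<bar>u (r k) x - v x\<bar> \<partial>lebesgue) \<longlonglongrightarrow> 0"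
  proof (rule h_pairing_tendsto_0)
    show d: "(\<lambda>x. u (r k) x - v x) \<in> W0 \<Omega>" for k by (rule W0_diff[OF \<Omega>(1) u(1) v])
    show "energy (\<lambda>x. u (r k) x - v x) \<le> 2 powr p * (e + energy v)" for k
    proof -
      have "gagliardo s p UNIV (\<lambda>x. u (r k) x + (-1) * v x) \<le>
          ennreal (2 powr p) * (gagliardo s p UNIV (u (r k)) + gagliardo s p UNIV (\<lambda>x. (-1) * v x))"
        using p_ge by (intro gagliardo_add) auto
      then have "ennreal (energy (\<lambda>x. u (r k) x - v x)) \<le> ennreal (2 powr p * (energy (u (r k)) + energy v))"
        unfolding gagliardo_cmult[OF vm] gagliardo_eq_energy[OF v] gagliardo_eq_energy[OF u(1)]
        using gagliardo_eq_energy[OF d, of k]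
        by (simp add: ennreal_plus[symmetric] ennreal_mult[symmetric] del: ennreal_plus)
      then have "energy (\<lambda>x. u (r k) x - v x) \<le> 2 powr p * (energy (u (r k)) + energy v)"
        by (subst (asm) ennreal_le_iff) auto
      also have "\<dots> \<le> 2 powr p * (e + energy v)" using en[of "r k"] by (intro mult_left_mono) auto
      finally show ?thesis .
    qed
    show "AE x in lebesgue. (\<lambda>k. u (r k) x - v x) \<longlonglongrightarrow> 0"
      using lim by eventually_elim (simp add: LIM_zero_iff)
  qed
  then have Glim: "(\<lambda>k. \<integral>x. G x (u (r k) x) \<partial>lebesgue) \<longlonglongrightarrow> (\<integral>x. G x (v x) \<partial>lebesgue)"
  proof (rule Lim_transform_bound[rotated, THEN LIM_zero_cancel])
    show "\<forall>\<^sub>F k in sequentially. norm ((\<integral>x. G x (u (r k) x) \<partial>lebesgue) - (\<integral>x. G x (v x) \<partial>lebesgue))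
        \<le> norm (\<integral>x. h x * \<bar>u (r k) x - v x\<bar> \<partial>lebesgue)"
    proof (intro always_eventually allI)
      fix k
      have hi: "integrable lebesgue (\<lambda>x. h x * \<bar>u (r k) x - v x\<bar>)"
        using h_mult_integrable[OF W0_diff[OF \<Omega>(1) u(1) v]] .
      have "\<bar>(\<integral>x. G x (u (r k) x) \<partial>lebesgue) - (\<integral>x. G x (v x) \<partial>lebesgue)\<bar>
        = \<bar>\<integral>x. G x (u (r k) x) - G x (v x) \<partial>lebesgue\<bar>"
        using G_integrable[OF u(1)] G_integrable[OF v] by simp
      also have "\<dots> \<le> (\<integral>x. \<bar>G x (u (r k) x) - G x (v x)\<bar> \<partial>lebesgue)" by (rule integral_abs_bound)
      also have "\<dots> \<le> (\<integral>x. h x * \<bar>u (r k) x - v x\<bar> \<partial>lebesgue)"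
        using G_integrable[OF u(1)] G_integrable[OF v] hi by (intro integral_mono G_lipschitz) auto
      finally show "norm ((\<integral>x. G x (u (r k) x) \<partial>lebesgue) - (\<integral>x. G x (v x) \<partial>lebesgue))
        \<le> norm (\<integral>x. h x * \<bar>u (r k) x - v x\<bar> \<partial>lebesgue)" by simp
    qed
  qed
  define cc where "cc k = p * (J0 + 1 / real (Suc (r k)) + (\<integral>x. G x (u (r k) x) \<partial>lebesgue))" for k
  have ecc: "energy (u (r k)) \<le> cc k" for k
  proof -
    have "energy (u (r k)) / p \<le> J0 + 1 / real (Suc (r k)) + (\<integral>x. G x (u (r k) x) \<partial>lebesgue)"
      using u(2)[of "r k"] unfolding J_def by linarith
    then show ?thesis using p_ge by (simp add: cc_def pos_divide_le_eq mult.commute)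
  qed
  have "(\<lambda>k. 1 / real (Suc (r k))) \<longlonglongrightarrow> 0"
    using LIMSEQ_subseq_LIMSEQ[OF LIMSEQ_Suc[OF lim_1_over_n] r] by (simp add: o_def)
  then have "cc \<longlonglongrightarrow> p * (J0 + 0 + (\<integral>x. G x (v x) \<partial>lebesgue))"
    unfolding cc_def by (intro tendsto_intros Glim)
  then have cclim: "cc \<longlonglongrightarrow> p * (J0 + (\<integral>x. G x (v x) \<partial>lebesgue))" by simp
  have nn: "0 \<le> p * (J0 + (\<integral>x. G x (v x) \<partial>lebesgue))"
    by (rule LIMSEQ_le_const[OF cclim]) (use ecc energy_nonneg order_trans in blast)
  have "gagliardo s p UNIV v \<le> ennreal (p * (J0 + (\<integral>x. G x (v x) \<partial>lebesgue)))"
    by (rule limit_energy[of "\<lambda>k. ennreal (cc k)"])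
      (auto simp: gagliardo_eq_energy[OF u(1)] ecc ennreal_leI intro!: tendsto_ennrealI cclim)
  then have "energy v \<le> p * (J0 + (\<integral>x. G x (v x) \<partial>lebesgue))"
    using nn by (simp add: gagliardo_eq_energy[OF v] ennreal_le_iff)
  then have "energy v / p \<le> J0 + (\<integral>x. G x (v x) \<partial>lebesgue)"
    using p_ge by (simp add: pos_divide_le_eq mult.commute)
  then have "J v \<le> J0" by (simp add: J_def)
  then show thesis using that[OF v] J0le by fastforce
qed

text \<open>Comparing \<open>v\<close> with \<open>v + t * w\<close> and using the tangent inequality at \<open>v + t * w\<close> gives
\<open>\<integral> (G(x, v + t w) - G(x, v)) / t \<le> frac_plaplacian s p (v + t w) w\<close>; both sides converge by
dominated convergence as \<open>t\<close> tends to \<open>0\<close>.\<close>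

lemma minimizer_inequality:
  assumes v: "v \<in> W0 \<Omega>" and min: "\<And>w. w \<in> W0 \<Omega> \<Longrightarrow> J v \<le> J w" and w: "w \<in> W0 \<Omega>"
  shows "(\<integral>x. g x (v x) * w x \<partial>lebesgue) \<le> frac_plaplacian s p v w"
proof -
  have [measurable]: "v \<in> borel_measurable lebesgue" "w \<in> borel_measurable lebesgue"
    using v w W0_measurable by auto
  define t where "t k = 1 / real (Suc k)" for k
  have t: "0 < t k" "t k \<le> 1" for k by (auto simp: t_def)
  have tlim: "t \<longlonglongrightarrow> 0" unfolding t_def by (rule LIMSEQ_Suc[OF lim_1_over_n, unfolded One_nat_def])
  define vk where "vk k x = v x + t k * w x" for k x
  have vk: "vk k \<in> W0 \<Omega>" for k unfolding vk_def by (rule W0_add[OF \<Omega>(1) v W0_cmult[OF \<Omega>(1) w]])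
  have [measurable]: "vk k \<in> borel_measurable lebesgue" for k using vk by (rule W0_measurable)
  let ?\<mu> = "frac_measure s p"
  let ?d = "\<lambda>u z. u (fst z) - (u (snd z) :: real)"
  have step: "(\<integral>x. (G x (vk k x) - G x (v x)) / t k \<partial>lebesgue) \<le> frac_plaplacian s p (vk k) w" for k
  proof -
    have "(\<integral>x. G x (vk k x) - G x (v x) \<partial>lebesgue) = (\<integral>x. G x (vk k x) \<partial>lebesgue) - (\<integral>x. G x (v x) \<partial>lebesgue)"
      using G_integrable[OF vk] G_integrable[OF v] by simp
    also have "\<dots> \<le> (energy (vk k) - energy v) / p" using min[OF vk[of k]] by (simp add: J_def diff_divide_distrib)
    also have "energy (vk k) - energy v = (\<integral>z. \<bar>?d (vk k) z\<bar> powr p - \<bar>?d v z\<bar> powr p \<partial>?\<mu>)"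
      using W0_integrable_powr[OF vk] W0_integrable_powr[OF v]
      by (simp add: energy_eq_integral[OF vk] energy_eq_integral[OF v])
    also have "\<dots> \<le> (\<integral>z. p * (t k * (signed_power p (?d (vk k) z) * ?d w z)) \<partial>?\<mu>)"
    proof (rule integral_mono)
      show "integrable ?\<mu> (\<lambda>z. p * (t k * (signed_power p (?d (vk k) z) * ?d w z)))"
        using W0_pairing_integrable[OF vk w] by simp
      fix z :: "'a \<times> 'a"
      have "?d (vk k) z - ?d v z = t k * ?d w z" by (simp add: vk_def algebra_simps)
      then show "\<bar>?d (vk k) z\<bar> powr p - \<bar>?d v z\<bar> powr p \<le> p * (t k * (signed_power p (?d (vk k) z) * ?d w z))"
        using powr_abs_convex_tangent[OF p_ge, of "?d (vk k) z" "?d v z"] by (simp add: mult.left_commute)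
    qed (use W0_integrable_powr[OF vk] W0_integrable_powr[OF v] in simp)
    also have "\<dots> = p * (t k * frac_plaplacian s p (vk k) w)" by (simp add: frac_plaplacian_eq)
    finally have "(\<integral>x. G x (vk k x) - G x (v x) \<partial>lebesgue) \<le> t k * frac_plaplacian s p (vk k) w"
      using p_ge by (simp add: divide_right_mono)
    then show ?thesis using t[of k] by (simp add: pos_divide_le_eq mult.commute)
  qed
  have "(\<lambda>k. frac_plaplacian s p (vk k) w) \<longlonglongrightarrow> frac_plaplacian s p v w"
    unfolding frac_plaplacian_eq
  proof (rule integral_dominated_convergence)
    show "integrable ?\<mu> (\<lambda>z. 2 powr p * (\<bar>?d v z\<bar> powr p + \<bar>?d w z\<bar> powr p) + \<bar>?d w z\<bar> powr p)"
      using W0_integrable_powr[OF w] W0_integrable_powr[OF v] by simp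
    show "AE z in ?\<mu>. (\<lambda>k. signed_power p (?d (vk k) z) * ?d w z) \<longlonglongrightarrow> signed_power p (?d v z) * ?d w z"
    proof (rule AE_I2)
      fix z :: "'a \<times> 'a"
      have "(\<lambda>k. ?d (vk k) z) \<longlonglongrightarrow> (v (fst z) + 0 * w (fst z)) - (v (snd z) + 0 * w (snd z))"
        unfolding vk_def by (intro tendsto_intros tlim)
      moreover have "isCont (signed_power p) (?d v z)"
        using signed_power_continuous[OF p_ge] by (simp add: continuous_on_eq_continuous_at)
      ultimately show "(\<lambda>k. signed_power p (?d (vk k) z) * ?d w z) \<longlonglongrightarrow> signed_power p (?d v z) * ?d w z"
        by (intro tendsto_mult tendsto_const isCont_tendsto_compose[of _ "signed_power p"]) simp_all
    qed
    show "AE z in ?\<mu>. norm (signed_power p (?d (vk k) z) * ?d w z)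
        \<le> 2 powr p * (\<bar>?d v z\<bar> powr p + \<bar>?d w z\<bar> powr p) + \<bar>?d w z\<bar> powr p" for k
    proof (rule AE_I2)
      fix z :: "'a \<times> 'a"
      have "?d (vk k) z = ?d v z + t k * ?d w z" by (simp add: vk_def algebra_simps)
      then have "\<bar>?d (vk k) z\<bar> powr p \<le> 2 powr p * (\<bar>?d v z\<bar> powr p + \<bar>t k * ?d w z\<bar> powr p)"
        using powr_abs_add_le[of p "?d v z" "t k * ?d w z"] p_ge by simp
      also have "\<bar>t k * ?d w z\<bar> powr p \<le> \<bar>?d w z\<bar> powr p"
        using t[of k] p_ge by (intro powr_mono2) (auto simp: abs_mult mult_left_le_one_le)
      finally have "\<bar>?d (vk k) z\<bar> powr p \<le> 2 powr p * (\<bar>?d v z\<bar> powr p + \<bar>?d w z\<bar> powr p)" by simp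
      then show "norm (signed_power p (?d (vk k) z) * ?d w z)
        \<le> 2 powr p * (\<bar>?d v z\<bar> powr p + \<bar>?d w z\<bar> powr p) + \<bar>?d w z\<bar> powr p"
        using signed_power_mult_le[of "?d (vk k) z" "?d w z"] by simp
    qed
  qed (rule pairing_integrand_measurable; measurable)+
  moreover have "(\<lambda>k. \<integral>x. (G x (vk k x) - G x (v x)) / t k \<partial>lebesgue) \<longlonglongrightarrow> (\<integral>x. g x (v x) * w x \<partial>lebesgue)"
  proof (rule integral_dominated_convergence[OF _ _ h_mult_integrable[OF w]])
    show "AE x in lebesgue. (\<lambda>k. (G x (vk k x) - G x (v x)) / t k) \<longlonglongrightarrow> g x (v x) * w x"
    proof (rule AE_I2)
      fix x
      have "((\<lambda>\<tau>. v x + \<tau> * w x) has_real_derivative w x) (at 0)"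
        by (auto intro!: derivative_eq_intros)
      then have "((\<lambda>\<tau>. G x (v x + \<tau> * w x)) has_real_derivative g x (v x) * w x) (at 0)"
        using DERIV_chain2[of "antideriv g x" "g x (v x)" "\<lambda>\<tau>. v x + \<tau> * w x" 0 "w x" UNIV]
          antideriv_has_derivative[of g x "v x", OF g_continuous]
        by (simp add: G_def)
      then have "((\<lambda>\<tau>. (G x (v x + \<tau> * w x) - G x (v x)) / \<tau>) \<longlongrightarrow> g x (v x) * w x) (at 0)"
        by (simp add: DERIV_def)
      moreover have "filterlim t (at 0) sequentially"
        using tlim t by (auto simp: filterlim_at intro!: always_eventually less_imp_neq[symmetric])
      ultimately show "(\<lambda>k. (G x (vk k x) - G x (v x)) / t k) \<longlonglongrightarrow> g x (v x) * w x"
        unfolding vk_def by (rule filterlim_compose)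
    qed
    show "AE x in lebesgue. norm ((G x (vk k x) - G x (v x)) / t k) \<le> h x * \<bar>w x\<bar>" for k
    proof (rule AE_I2)
      fix x
      have "\<bar>G x (vk k x) - G x (v x)\<bar> \<le> h x * \<bar>w x\<bar> * t k"
        using G_lipschitz[of x "vk k x" "v x"] t[of k] by (simp add: vk_def abs_mult mult_ac)
      then show "norm ((G x (vk k x) - G x (v x)) / t k) \<le> h x * \<bar>w x\<bar>"
        using t[of k] by (simp add: abs_divide pos_divide_le_eq)
    qed
    have [measurable]: "(\<lambda>x. g x (v x)) \<in> borel_measurable lebesgue"
      by (rule caratheodory_compose_measurable[OF g_measurable g_continuous]) measurable
    show "(\<lambda>x. g x (v x) * w x) \<in> borel_measurable lebesgue" by measurable
    have [measurable]: "(\<lambda>x. G x (v x)) \<in> borel_measurable lebesgue" "(\<lambda>x. G x (vk k x)) \<in> borel_measurable lebesgue" for k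
      by (rule G_compose_measurable; measurable)+
    show "(\<lambda>x. (G x (vk k x) - G x (v x)) / t k) \<in> borel_measurable lebesgue" for k by measurable
  qed
  ultimately show ?thesis using step by (meson LIMSEQ_le)
qed

text \<open>The inequality for \<open>w\<close> and for \<open>- w\<close> is an equation, because both sides are linear in \<open>w\<close>.\<close>

theorem weak_solution_exists:
  obtains u where "u \<in> W0 \<Omega>"
    "\<And>w. w \<in> W0 \<Omega> \<Longrightarrow> frac_plaplacian s p u w = (\<integral>x. g x (u x) * w x \<partial>lebesgue)"
proof -
  obtain u where u: "u \<in> W0 \<Omega>" "\<And>w. w \<in> W0 \<Omega> \<Longrightarrow> J u \<le> J w" by (rule minimizer_exists) blast
  show thesis
  proof (rule that[OF u(1)], rule antisym)
    fix w assume w: "w \<in> W0 \<Omega>"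
    have "(\<integral>x. g x (u x) * (- w x) \<partial>lebesgue) \<le> frac_plaplacian s p u (\<lambda>x. - w x)"
      by (rule minimizer_inequality[OF u]) (use W0_cmult[OF \<Omega>(1) w, of "-1"] in simp_all)
    then show "frac_plaplacian s p u w \<le> (\<integral>x. g x (u x) * w x \<partial>lebesgue)"
      by (simp add: frac_plaplacian_uminus)
    show "(\<integral>x. g x (u x) * w x \<partial>lebesgue) \<le> frac_plaplacian s p u w"
      by (rule minimizer_inequality[OF u w])
  qed
qed

end

context sobolev_exponents
begin

lemma W0_mono:
  assumes "A \<subseteq> B" "u \<in> W0 A"
  shows "u \<in> W0 B"
  using assms by (auto simp: W0_def frac_sobolev0_def elim: eventually_mono)

section \<open>Comparison\<close>

text \<open>The difference \<open>v x - v y\<close> of the test function \<open>v = (u - z)\<^sup>+\<close> never has the sign opposite to that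
of \<open>(u x - u y) - (z x - z y)\<close>, and it vanishes if the latter does. As the signed power is strictly
increasing, the integrand of \<open>frac_plaplacian u v - frac_plaplacian z v\<close> is nonnegative and vanishes only
where \<open>v x = v y\<close>. So \<open>v\<close> has energy zero, and by the Sobolev inequality it vanishes.\<close>

lemma comparison:
  fixes u z :: "'a \<Rightarrow> real"
  assumes \<Omega>: "\<Omega> \<in> lmeasurable"
    and v: "(\<lambda>x. max 0 (u x - z x)) \<in> W0 \<Omega>"
    and iu: "integrable (frac_measure s p) (\<lambda>\<xi>. signed_power p (u (fst \<xi>) - u (snd \<xi>)) *
               (max 0 (u (fst \<xi>) - z (fst \<xi>)) - max 0 (u (snd \<xi>) - z (snd \<xi>))))"
    and iz: "integrable (frac_measure s p) (\<lambda>\<xi>. signed_power p (z (fst \<xi>) - z (snd \<xi>)) *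
               (max 0 (u (fst \<xi>) - z (fst \<xi>)) - max 0 (u (snd \<xi>) - z (snd \<xi>))))"
    and le: "frac_plaplacian s p u (\<lambda>x. max 0 (u x - z x)) \<le> frac_plaplacian s p z (\<lambda>x. max 0 (u x - z x))"
  shows "AE x in lebesgue. u x \<le> z x"
proof -
  define v where "v x = max 0 (u x - z x)" for x
  have vW: "v \<in> W0 \<Omega>" using v by (simp add: v_def[abs_def])
  let ?\<mu> = "frac_measure s p :: ('a \<times> 'a) measure"
  let ?d = "\<lambda>u \<xi>. u (fst \<xi>) - (u (snd \<xi>) :: real)"
  define D where "D \<xi> = signed_power p (?d u \<xi>) * ?d v \<xi> - signed_power p (?d z \<xi>) * ?d v \<xi>" for \<xi>
  have iD: "integrable ?\<mu> D" unfolding D_def v_def using iu iz by (rule Bochner_Integration.integrable_diff)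
  have D: "0 \<le> D \<xi> \<and> (?d v \<xi> \<noteq> 0 \<longrightarrow> D \<xi> \<noteq> 0)" for \<xi>
  proof -
    have eq: "D \<xi> = (signed_power p (?d u \<xi>) - signed_power p (?d z \<xi>)) * ?d v \<xi>"
      by (simp add: D_def left_diff_distrib)
    consider "?d u \<xi> = ?d z \<xi>" | "?d u \<xi> < ?d z \<xi>" | "?d z \<xi> < ?d u \<xi>" by linarith
    then show ?thesis
    proof cases
      case 1
      then have "?d v \<xi> = 0" by (auto simp: v_def)
      then show ?thesis unfolding eq by simp
    next
      case 2
      then have "?d v \<xi> \<le> 0" by (auto simp: v_def)
      moreover have "signed_power p (?d u \<xi>) - signed_power p (?d z \<xi>) < 0"
        using signed_power_strict_mono[OF p_ge 2] by simp
      ultimately show ?thesis unfolding eq by (auto intro: mult_nonpos_nonpos)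
    next
      case 3
      then have "?d v \<xi> \<ge> 0" by (auto simp: v_def)
      moreover have "signed_power p (?d u \<xi>) - signed_power p (?d z \<xi>) > 0"
        using signed_power_strict_mono[OF p_ge 3] by simp
      ultimately show ?thesis unfolding eq by (auto intro: mult_nonneg_nonneg)
    qed
  qed
  have "(\<integral>\<xi>. D \<xi> \<partial>?\<mu>) = frac_plaplacian s p u v - frac_plaplacian s p z v"
    unfolding D_def frac_plaplacian_eq v_def using iu iz by (rule Bochner_Integration.integral_diff)
  also have "\<dots> \<le> 0" using le by (simp add: v_def[abs_def])
  finally have "(\<integral>\<xi>. D \<xi> \<partial>?\<mu>) = 0" using D by (intro antisym integral_nonneg) auto
  then have "AE \<xi> in ?\<mu>. D \<xi> = 0"
    using integral_nonneg_eq_0_iff_AE[OF iD] D by auto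
  then have "AE \<xi> in ?\<mu>. ennreal (\<bar>?d v \<xi>\<bar> powr p) = 0" by (rule eventually_mono) (use D in auto)
  then have "(\<integral>\<^sup>+\<xi>. ennreal (\<bar>?d v \<xi>\<bar> powr p) \<partial>?\<mu>) = (\<integral>\<^sup>+\<xi>. 0 \<partial>?\<mu>)"
    by (rule nn_integral_cong_AE)
  then have "gagliardo s p UNIV v = 0" by (simp add: gagliardo_UNIV)
  then have "energy v \<le> 0" by (simp add: energy_def)
  note vP = W0_powr_P[OF \<Omega> vW this]
  have "(\<integral>x. \<bar>v x\<bar> powr P \<partial>lebesgue) \<le> 0" using vP(2) by simp
  moreover have "0 \<le> (\<integral>x. \<bar>v x\<bar> powr P \<partial>lebesgue)" by simp
  ultimately have "(\<integral>x. \<bar>v x\<bar> powr P \<partial>lebesgue) = 0" by (rule antisym)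
  then have "AE x in lebesgue. \<bar>v x\<bar> powr P = 0"
    using integral_nonneg_eq_0_iff_AE[OF vP(1)] by auto
  then show ?thesis by (rule eventually_mono) (auto simp: v_def)
qed

section \<open>The larger space: cutoff and testing\<close>

text \<open>Near the diagonal the Lipschitz bound reduces the singularity to the integrable order \<open>N + p s - p < N\<close>;
away from it the values of \<open>\<eta>\<close> differ by at most \<open>1\<close> and the kernel itself is integrable.\<close>

lemma slice_energy_lipschitz_bound:
  assumes "0 < L"
  obtains C where "0 \<le> C" "\<And>\<eta> x. (\<And>x. 0 \<le> \<eta> x \<and> \<eta> x \<le> 1) \<Longrightarrow> (\<And>x y. \<bar>\<eta> x - \<eta> y\<bar> \<le> L * dist x y) \<Longrightarrow>
    slice_energy s p \<eta> (x :: 'a) \<le> ennreal C"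
proof -
  have ps: "0 < p * s" "p * s < p" using p_ge s_pos s_less by auto
  obtain C1 where C1: "0 \<le> C1" "\<And>x::'a. (\<integral>\<^sup>+y. ennreal (norm (x - y) powr (- (N + p * s - p))) * indicator (ball x 1) y \<partial>lebesgue) \<le> ennreal C1"
    using nn_integral_kernel_near[where 'a = 'a, of "N + p * s - p"] ps by auto
  obtain C2 where C2: "0 \<le> C2" "\<And>x::'a. (\<integral>\<^sup>+y. ennreal (norm (x - y) powr (- (N + p * s))) * indicator (- ball x 1) y \<partial>lebesgue) \<le> ennreal C2"
    using nn_integral_kernel_far[where 'a = 'a, of "N + p * s" 1] ps by auto
  show thesis
  proof (rule that)
    show "0 \<le> L powr p * C1 + C2" using C1 C2 by simp
    fix \<eta> :: "'a \<Rightarrow> real" and x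
    assume eta: "\<And>x. 0 \<le> \<eta> x \<and> \<eta> x \<le> 1" and lip: "\<And>x y. \<bar>\<eta> x - \<eta> y\<bar> \<le> L * dist x y"
    have "slice_energy s p \<eta> x \<le> (\<integral>\<^sup>+y. ennreal (L powr p) * (ennreal (norm (x - y) powr (- (N + p * s - p))) * indicator (ball x 1) y)
        + ennreal (norm (x - y) powr (- (N + p * s))) * indicator (- ball x 1) y \<partial>lebesgue)"
      unfolding slice_energy_eq
    proof (rule nn_integral_mono)
      fix y :: 'a
      let ?k = "norm (x - y) powr (- (N + p * s))"
      show "ennreal ?k * ennreal (\<bar>\<eta> x - \<eta> y\<bar> powr p) \<le> ennreal (L powr p) * (ennreal (norm (x - y) powr (- (N + p * s - p))) * indicator (ball x 1) y)
        + ennreal ?k * indicator (- ball x 1) y"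
      proof (cases "y \<in> ball x 1")
        case True
        have "\<bar>\<eta> x - \<eta> y\<bar> powr p \<le> (L * dist x y) powr p" using lip p_ge by (intro powr_mono2) auto
        then have "?k * \<bar>\<eta> x - \<eta> y\<bar> powr p \<le> ?k * (L * dist x y) powr p" by (intro mult_left_mono) auto
        also have "\<dots> = L powr p * norm (x - y) powr (- (N + p * s - p))"
        proof -
          have "norm (x - y) powr (- (N + p * s - p)) = ?k * norm (x - y) powr p"
            by (simp add: powr_add[symmetric] algebra_simps)
          then show ?thesis by (simp add: powr_mult dist_norm)
        qed
        finally show ?thesis using True by (simp add: ennreal_mult[symmetric] ennreal_leI)
      next
        case False
        have "\<bar>\<eta> x - \<eta> y\<bar> \<le> 1" using eta[of x] eta[of y] by linarith
        then have "\<bar>\<eta> x - \<eta> y\<bar> powr p \<le> 1" using p_ge by (intro powr_le1) auto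
        then have "?k * \<bar>\<eta> x - \<eta> y\<bar> powr p \<le> ?k" by (intro mult_left_le) auto
        then show ?thesis using False by (simp add: ennreal_mult[symmetric] ennreal_leI)
      qed
    qed
    also have "\<dots> = ennreal (L powr p) * (\<integral>\<^sup>+y. ennreal (norm (x - y) powr (- (N + p * s - p))) * indicator (ball x 1) y \<partial>lebesgue)
        + (\<integral>\<^sup>+y. ennreal (norm (x - y) powr (- (N + p * s))) * indicator (- ball x 1) y \<partial>lebesgue)"
    proof -
      have [measurable]: "ball x 1 \<in> sets lebesgue" "- ball x 1 \<in> sets lebesgue" by auto
      show ?thesis by (subst nn_integral_add) (auto simp: nn_integral_cmult)
    qed
    also have "\<dots> \<le> ennreal (L powr p) * ennreal C1 + ennreal C2"
      by (intro add_mono mult_left_mono C1 C2) auto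
    also have "\<dots> = ennreal (L powr p * C1 + C2)" using C1 C2 by (simp add: ennreal_mult)
    finally show "slice_energy s p \<eta> x \<le> ennreal (L powr p * C1 + C2)" .
  qed
qed

text \<open>By \<open>\<eta> x * u x - \<eta> y * u y = \<eta> y * (u x - u y) + u x * (\<eta> x - \<eta> y)\<close>, pairs in \<open>U \<times> U\<close> are controlled by
the energy of \<open>u\<close> on \<open>U\<close> and by the energy density of \<open>\<eta>\<close>. If only \<open>x\<close> lies in \<open>U\<close>, then
\<open>\<eta> y = 0\<close> and the second term alone is exact, so no values of \<open>u\<close> outside \<open>U\<close> enter.\<close>

lemma gagliardo_cutoff:
  fixes u \<eta> :: "'a \<Rightarrow> real"
  assumes u [measurable]: "u \<in> borel_measurable lebesgue" and U: "open U"
    and fin: "gagliardo s p U u < \<infinity>" "(\<integral>\<^sup>+x. ennreal (\<bar>u x\<bar> powr p) * indicator U x \<partial>lebesgue) < \<infinity>"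
    and L: "0 < L" and eta: "\<And>x. 0 \<le> \<eta> x \<and> \<eta> x \<le> 1" "\<And>x y. \<bar>\<eta> x - \<eta> y\<bar> \<le> L * dist x y"
    and off: "\<And>x. x \<notin> U \<Longrightarrow> \<eta> x = 0" and m [measurable]: "\<eta> \<in> borel_measurable lebesgue"
  shows "gagliardo s p UNIV (\<lambda>x. \<eta> x * u x) < \<infinity>"
proof -
  obtain C where C: "0 \<le> C" "\<And>x. slice_energy s p \<eta> x \<le> ennreal C"
    using slice_energy_lipschitz_bound[OF L] eta by metis
  have [measurable]: "U \<in> sets lebesgue" using U by auto
  let ?\<mu> = "frac_measure s p :: ('a \<times> 'a) measure"
  define A where "A \<xi> = ennreal (\<bar>u (fst \<xi>) - u (snd \<xi>)\<bar> powr p) * indicator (U \<times> U) \<xi>" for \<xi> :: "'a \<times> 'a"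
  define B where "B \<xi> = ennreal (\<bar>u (fst \<xi>)\<bar> powr p) * indicator U (fst \<xi>) * ennreal (\<bar>\<eta> (fst \<xi>) - \<eta> (snd \<xi>)\<bar> powr p)"
    for \<xi> :: "'a \<times> 'a"
  have UU: "U \<times> U \<in> sets (lebesgue \<Otimes>\<^sub>M lebesgue)" by (intro pair_measureI) auto
  have Am [measurable]: "A \<in> borel_measurable (lebesgue \<Otimes>\<^sub>M lebesgue)"
    unfolding A_def[abs_def] using UU by measurable
  have ind [measurable]: "(\<lambda>\<xi>. indicator U (fst \<xi>) :: ennreal) \<in> borel_measurable (lebesgue \<Otimes>\<^sub>M lebesgue)"
    by (rule measurable_compose[OF measurable_fst]) measurable
  have Bm [measurable]: "B \<in> borel_measurable (lebesgue \<Otimes>\<^sub>M lebesgue)"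
    unfolding B_def[abs_def] by measurable
  have Bsm [measurable]: "(\<lambda>\<xi>. B (prod.swap \<xi>)) \<in> borel_measurable (lebesgue \<Otimes>\<^sub>M lebesgue)"
    unfolding prod.swap_def by measurable
  have IB: "(\<integral>\<^sup>+\<xi>. B \<xi> \<partial>?\<mu>) < \<infinity>"
  proof -
    have "(\<integral>\<^sup>+\<xi>. B \<xi> \<partial>?\<mu>) = (\<integral>\<^sup>+x. (\<integral>\<^sup>+y. ennreal (norm (x - y) powr (- (N + p * s))) * B (x, y) \<partial>lebesgue) \<partial>lebesgue)"
      by (subst nn_integral_frac_measure) auto
    also have "\<dots> \<le> (\<integral>\<^sup>+x. ennreal C * (ennreal (\<bar>u x\<bar> powr p) * indicator U x) \<partial>lebesgue)"
    proof (rule nn_integral_mono)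
      fix x :: 'a
      have "(\<integral>\<^sup>+y. ennreal (norm (x - y) powr (- (N + p * s))) * B (x, y) \<partial>lebesgue)
        = (\<integral>\<^sup>+y. (ennreal (\<bar>u x\<bar> powr p) * indicator U x) *
            (ennreal (norm (x - y) powr (- (N + p * s))) * ennreal (\<bar>\<eta> x - \<eta> y\<bar> powr p)) \<partial>lebesgue)"
        by (simp add: B_def mult_ac)
      also have "\<dots> = (ennreal (\<bar>u x\<bar> powr p) * indicator U x) * slice_energy s p \<eta> x"
        unfolding slice_energy_eq by (rule nn_integral_cmult) measurable
      also have "\<dots> \<le> (ennreal (\<bar>u x\<bar> powr p) * indicator U x) * ennreal C" by (intro mult_left_mono C) auto
      finally show "(\<integral>\<^sup>+y. ennreal (norm (x - y) powr (- (N + p * s))) * B (x, y) \<partial>lebesgue)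
        \<le> ennreal C * (ennreal (\<bar>u x\<bar> powr p) * indicator U x)" by (simp add: mult_ac)
    qed
    also have "\<dots> = ennreal C * (\<integral>\<^sup>+x. ennreal (\<bar>u x\<bar> powr p) * indicator U x \<partial>lebesgue)"
      by (rule nn_integral_cmult) measurable
    also have "\<dots> < \<infinity>" using fin(2) by (simp add: ennreal_mult_less_top)
    finally show ?thesis .
  qed
  have "gagliardo s p UNIV (\<lambda>x. \<eta> x * u x) \<le> (\<integral>\<^sup>+\<xi>. ennreal (2 powr p) * (A \<xi> + (B \<xi> + B (prod.swap \<xi>))) \<partial>?\<mu>)"
    unfolding gagliardo_UNIV
  proof (rule nn_integral_mono)
    fix \<xi> :: "'a \<times> 'a"
    obtain x y where xi: "\<xi> = (x, y)" by (cases \<xi>)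
    have p0: "0 \<le> p" and one: "1 \<le> 2 powr p" using p_ge ge_one_powr_ge_zero[of 2 p] by auto
    have up: "ennreal X \<le> ennreal (2 powr p) * (a + ennreal X)" for X a
    proof -
      have "1 * ennreal X \<le> ennreal (2 powr p) * (a + ennreal X)"
        using one by (intro mult_mono) (auto simp: ennreal_ge_1)
      then show ?thesis by simp
    qed
    show "ennreal (\<bar>\<eta> (fst \<xi>) * u (fst \<xi>) - \<eta> (snd \<xi>) * u (snd \<xi>)\<bar> powr p) \<le> ennreal (2 powr p) * (A \<xi> + (B \<xi> + B (prod.swap \<xi>)))"
    proof (cases "x \<in> U"; cases "y \<in> U")
      assume xy: "x \<in> U" "y \<in> U"
      have "\<eta> x * u x - \<eta> y * u y = \<eta> y * (u x - u y) + u x * (\<eta> x - \<eta> y)" by (simp add: algebra_simps)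
      then have "\<bar>\<eta> x * u x - \<eta> y * u y\<bar> powr p \<le> 2 powr p * (\<bar>\<eta> y * (u x - u y)\<bar> powr p + \<bar>u x * (\<eta> x - \<eta> y)\<bar> powr p)"
        using powr_abs_add_le[OF p0] by simp
      also have "\<dots> \<le> 2 powr p * (\<bar>u x - u y\<bar> powr p + \<bar>u x\<bar> powr p * \<bar>\<eta> x - \<eta> y\<bar> powr p)"
        using eta(1)[of y] p0
        by (intro mult_left_mono add_mono powr_mono2) (auto simp: abs_mult powr_mult mult_left_le_one_le)
      finally have "ennreal (\<bar>\<eta> x * u x - \<eta> y * u y\<bar> powr p) \<le> ennreal (2 powr p * (\<bar>u x - u y\<bar> powr p + \<bar>u x\<bar> powr p * \<bar>\<eta> x - \<eta> y\<bar> powr p))"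
        by (rule ennreal_leI)
      also have "\<dots> = ennreal (2 powr p) * (A \<xi> + B \<xi>)" using xy by (simp add: xi A_def B_def ennreal_mult)
      also have "\<dots> \<le> ennreal (2 powr p) * (A \<xi> + (B \<xi> + B (prod.swap \<xi>)))"
        by (intro mult_left_mono add_left_mono) auto
      finally show ?thesis by (simp add: xi)
    next
      assume xy: "x \<in> U" "y \<notin> U"
      have "\<bar>\<eta> x * u x - \<eta> y * u y\<bar> powr p = \<bar>u x\<bar> powr p * \<bar>\<eta> x - \<eta> y\<bar> powr p"
        using off[OF xy(2)] by (simp add: abs_mult powr_mult mult.commute)
      moreover have "B \<xi> = ennreal (\<bar>u x\<bar> powr p * \<bar>\<eta> x - \<eta> y\<bar> powr p)" using xy by (simp add: xi B_def ennreal_mult)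
      ultimately show ?thesis using up[of "\<bar>u x\<bar> powr p * \<bar>\<eta> x - \<eta> y\<bar> powr p" "A \<xi> + B (prod.swap \<xi>)"] by (simp add: xi add_ac)
    next
      assume xy: "x \<notin> U" "y \<in> U"
      have "\<bar>\<eta> x * u x - \<eta> y * u y\<bar> powr p = \<bar>u y\<bar> powr p * \<bar>\<eta> y - \<eta> x\<bar> powr p"
        using off[OF xy(1)] by (simp add: abs_mult powr_mult mult.commute)
      moreover have "B (prod.swap \<xi>) = ennreal (\<bar>u y\<bar> powr p * \<bar>\<eta> y - \<eta> x\<bar> powr p)" using xy by (simp add: xi B_def ennreal_mult)
      ultimately show ?thesis using up[of "\<bar>u y\<bar> powr p * \<bar>\<eta> y - \<eta> x\<bar> powr p" "A \<xi> + B \<xi>"] by (simp add: xi add_ac)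
    next
      assume "x \<notin> U" "y \<notin> U"
      then show ?thesis using off by (simp add: xi)
    qed
  qed
  also have "\<dots> = ennreal (2 powr p) * ((\<integral>\<^sup>+\<xi>. A \<xi> \<partial>?\<mu>) + ((\<integral>\<^sup>+\<xi>. B \<xi> \<partial>?\<mu>) + (\<integral>\<^sup>+\<xi>. B \<xi> \<partial>?\<mu>)))"
    by (subst nn_integral_cmult, measurable)
      (simp add: nn_integral_add nn_integral_frac_measure_swap)
  also have "\<dots> < \<infinity>" using IB fin(1) by (simp add: A_def gagliardo_def ennreal_mult_less_top)
  finally show ?thesis .
qed

text \<open>The factor \<open>\<eta>\<close> falls linearly from \<open>1\<close> on \<open>\<Omega>\<close> to \<open>0\<close> at distance \<open>d\<close>, where \<open>d\<close> is the distance from the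
closure of \<open>\<Omega>\<close> to the complement of the neighbourhood on which \<open>u\<close> has finite energy. Being
nonnegative, it keeps the sign of \<open>u\<close> outside \<open>\<Omega>\<close>, which is what makes \<open>(l - z)\<^sup>+\<close> vanish there
for a subsolution \<open>l\<close>.\<close>

lemma tilde_cutoff:
  assumes \<Omega>: "bounded \<Omega>" "\<Omega> \<noteq> {}" and u: "u \<in> frac_sobolev_tilde s p (\<Omega> :: 'a set)"
  obtains V w where "V \<in> lmeasurable" "\<Omega> \<subseteq> V" "w \<in> W0 V" "\<And>x. x \<in> \<Omega> \<Longrightarrow> w x = u x"
    "\<And>x. u x \<le> 0 \<Longrightarrow> w x \<le> 0"
proof -
  have um [measurable]: "u \<in> borel_measurable lebesgue"
    using u by (simp add: frac_sobolev_tilde_def Lp_loc_space_def)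
  obtain U where U: "open U" "closure \<Omega> \<subseteq> U" "u \<in> frac_sobolev s p U"
    using u by (auto simp: frac_sobolev_tilde_def)
  have Um: "U \<in> sets lebesgue" using U(1) by auto
  have gag: "gagliardo s p U u < \<infinity>" using U(3) by (simp add: frac_sobolev_def)
  have iU: "integrable (lebesgue_on U) (\<lambda>x. \<bar>u x\<bar> powr p)" using U(3) by (simp add: frac_sobolev_def Lp_space_def)
  have nU: "(\<integral>\<^sup>+x. ennreal (\<bar>u x\<bar> powr p) * indicator U x \<partial>lebesgue) < \<infinity>"
  proof -
    have "(\<integral>\<^sup>+x. ennreal (\<bar>u x\<bar> powr p) * indicator U x \<partial>lebesgue) = (\<integral>\<^sup>+x. ennreal (\<bar>u x\<bar> powr p) \<partial>lebesgue_on U)"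
      using Um by (intro nn_integral_restrict_space[symmetric]) auto
    also have "\<dots> < \<infinity>" by (subst nn_integral_eq_integral[OF iU]) auto
    finally show ?thesis .
  qed
  have "compact (closure \<Omega>)" using \<Omega>(1) by (simp add: compact_closure)
  moreover have "closed (- U)" "closure \<Omega> \<inter> - U = {}" using U(1,2) by auto
  ultimately obtain d where d: "0 < d" "\<And>x y. x \<in> closure \<Omega> \<Longrightarrow> y \<in> - U \<Longrightarrow> d \<le> dist x y"
    using separate_compact_closed by metis
  define \<eta> where "\<eta> x = max 0 (1 - infdist x \<Omega> / d)" for x
  have e1: "0 \<le> \<eta> x \<and> \<eta> x \<le> 1" for x using d by (simp add: \<eta>_def infdist_nonneg)
  have e2: "\<bar>\<eta> x - \<eta> y\<bar> \<le> (1 / d) * dist x y" for x y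
  proof -
    have "\<bar>infdist x \<Omega> / d - infdist y \<Omega> / d\<bar> \<le> dist x y / d"
      using infdist_triangle_abs[of x \<Omega> y] d by (simp add: diff_divide_distrib[symmetric] abs_divide divide_right_mono)
    then show ?thesis unfolding \<eta>_def by (simp add: abs_le_iff max_def)
  qed
  have e3: "\<eta> x = 0" if x: "x \<notin> U" for x
  proof -
    have "d \<le> infdist x \<Omega>" unfolding infdist_notempty[OF \<Omega>(2)]
      using x d(2) closure_subset[of \<Omega>] by (intro cINF_greatest \<Omega>) (auto simp: dist_commute)
    then show ?thesis using d by (simp add: \<eta>_def)
  qed
  have "continuous_on UNIV \<eta>" unfolding \<eta>_def using d by (intro continuous_intros) auto
  then have em [measurable]: "\<eta> \<in> borel_measurable lebesgue"
    by (intro measurable_completion) (simp add: borel_measurable_continuous_onI)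
  define w where "w x = \<eta> x * u x" for x
  have wm [measurable]: "w \<in> borel_measurable lebesgue" unfolding w_def[abs_def] by measurable
  have gw: "gagliardo s p UNIV w < \<infinity>" unfolding w_def[abs_def]
    by (rule gagliardo_cutoff[OF um U(1) gag nU _ e1 e2 e3 em]) (use d in auto)
  define V where "V = (\<Union>x\<in>\<Omega>. ball x d)"
  obtain R where R: "\<And>x. x \<in> \<Omega> \<Longrightarrow> norm x \<le> R" using \<Omega>(1) by (auto simp: bounded_iff)
  have "bounded V"
  proof (rule boundedI)
    fix y assume "y \<in> V"
    then obtain x where "x \<in> \<Omega>" "dist x y < d" by (auto simp: V_def)
    then show "norm y \<le> R + d" using R[of x] norm_triangle_sub[of y x] by (simp add: dist_norm norm_minus_commute)
  qed
  moreover have "open V" by (auto simp: V_def)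
  ultimately have V: "V \<in> lmeasurable" by (rule lmeasurable_open)
  have z: "w x = 0" if x: "x \<notin> V" for x
  proof -
    have "d \<le> infdist x \<Omega>" unfolding infdist_notempty[OF \<Omega>(2)]
      using x by (intro cINF_greatest \<Omega>) (auto simp: V_def dist_commute not_less)
    then show ?thesis using d by (simp add: \<eta>_def w_def)
  qed
  show thesis
  proof (rule that[OF V])
    show "\<Omega> \<subseteq> V" using d by (auto simp: V_def)
    show "w \<in> W0 V" unfolding W0_iff[OF V] using gw z by (auto intro!: AE_I2)
    show "w x = u x" if "x \<in> \<Omega>" for x using that by (simp add: w_def \<eta>_def)
    show "w x \<le> 0" if "u x \<le> 0" for x using that e1[of x] by (simp add: w_def mult_nonneg_nonpos)
  qed
qed

text \<open>On \<open>U \<times> U\<close> both functions have finite energy. Otherwise the integrand is nonzero only if one point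
\<open>x\<close> lies in \<open>\<Omega>\<close> and the other point \<open>y\<close> outside \<open>U\<close>, at distance at least \<open>d\<close>; there the kernel is integrable
in \<open>y\<close> and comparable to \<open>(1 + \<bar>y\<bar>) powr (- (N + p s))\<close>, the weight in the tail condition of the space.\<close>

lemma tilde_pairing_integrable:
  assumes \<Omega>: "\<Omega> \<in> lmeasurable" "bounded \<Omega>" and u: "u \<in> frac_sobolev_tilde s p (\<Omega> :: 'a set)"
    and v: "v \<in> W0 \<Omega>"
  shows "integrable (frac_measure s p) (\<lambda>z. signed_power p (u (fst z) - u (snd z)) * (v (fst z) - v (snd z)))"
proof -
  have um [measurable]: "u \<in> borel_measurable lebesgue"
    using u by (simp add: frac_sobolev_tilde_def Lp_loc_space_def)
  have vm [measurable]: "v \<in> borel_measurable lebesgue" using v by (rule W0_measurable)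
  have \<Omega>m [measurable]: "\<Omega> \<in> sets lebesgue" using \<Omega>(1) by auto
  have ps: "0 < p * s" using p_ge s_pos by auto
  obtain U where U: "open U" "closure \<Omega> \<subseteq> U" "u \<in> frac_sobolev s p U"
    using u by (auto simp: frac_sobolev_tilde_def)
  have Um [measurable]: "U \<in> sets lebesgue" using U(1) by auto
  have gag: "gagliardo s p U u < \<infinity>" using U(3) by (simp add: frac_sobolev_def)
  have iU: "integrable (lebesgue_on U) (\<lambda>x. \<bar>u x\<bar> powr p)" using U(3) by (simp add: frac_sobolev_def Lp_space_def)
  define T where "T y = \<bar>u y\<bar> powr (p - 1) / (1 + norm y) powr (N + p * s)" for y
  have iT: "integrable lebesgue T" using u by (simp add: frac_sobolev_tilde_def T_def[abs_def])
  have T0: "0 \<le> T y" for y by (simp add: T_def)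
  have Tm [measurable]: "T \<in> borel_measurable lebesgue" using iT by simp
  have "compact (closure \<Omega>)" using \<Omega>(2) by (simp add: compact_closure)
  moreover have "closed (- U)" "closure \<Omega> \<inter> - U = {}" using U(1,2) by auto
  ultimately obtain d where d: "0 < d" "\<And>x y. x \<in> closure \<Omega> \<Longrightarrow> y \<in> - U \<Longrightarrow> d \<le> dist x y"
    using separate_compact_closed by metis
  have d': "d \<le> norm (x - y)" if "x \<in> \<Omega>" "y \<notin> U" for x y
    using d(2)[of x y] that closure_subset[of \<Omega>] by (auto simp: dist_norm)
  obtain C where C: "0 \<le> C" "\<And>x::'a. (\<integral>\<^sup>+y. ennreal (norm (x - y) powr (- (N + p * s))) * indicator (- ball x d) y \<partial>lebesgue) \<le> ennreal C"
    using nn_integral_kernel_far[where 'a = 'a, of "N + p * s" d] ps d by auto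
  obtain R where R: "0 < R" "\<And>x. x \<in> \<Omega> \<Longrightarrow> norm x \<le> R" using \<Omega>(2) by (auto simp: bounded_pos)
  \<comment> \<open>From \<open>1 + norm y \<le> (1 + R) + norm (x - y)\<close> and \<open>d \<le> norm (x - y)\<close>.\<close>
  define c where "c = 1 + (1 + R) / d"
  have c: "c > 0" using R d by (simp add: c_def add_pos_pos)
  have tail: "norm (x - y) powr (- (N + p * s)) * \<bar>u y\<bar> powr (p - 1) \<le> c powr (N + p * s) * T y"
    if x: "x \<in> \<Omega>" and y: "y \<notin> U" for x y
  proof -
    have pos: "norm (x - y) > 0" using d'[OF x y] d by linarith
    have "1 + norm y \<le> 1 + R + norm (x - y)" using R(2)[OF x] norm_triangle_sub[of y x] by (simp add: norm_minus_commute)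
    also have "1 + R \<le> (1 + R) / d * norm (x - y)"
    proof -
      have "1 \<le> norm (x - y) / d" using d'[OF x y] d(1) by simp
      then have "(1 + R) * 1 \<le> (1 + R) * (norm (x - y) / d)" using R(1) by (intro mult_left_mono) auto
      then show ?thesis by simp
    qed
    finally have "1 + norm y \<le> c * norm (x - y)" by (simp add: c_def distrib_right)
    then have "(1 + norm y) powr (N + p * s) \<le> (c * norm (x - y)) powr (N + p * s)"
      using ps N_pos by (intro powr_mono2) (auto simp: add_nonneg_nonneg)
    also have "\<dots> = c powr (N + p * s) * norm (x - y) powr (N + p * s)" by (rule powr_mult)
    finally have "(1 + norm y) powr (N + p * s) \<le> c powr (N + p * s) * norm (x - y) powr (N + p * s)" .
    then have k: "norm (x - y) powr (- (N + p * s)) \<le> c powr (N + p * s) / (1 + norm y) powr (N + p * s)"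
    proof -
      have frac: "inverse X \<le> C / Y" if "Y \<le> C * X" "0 < X" "0 < Y" for X Y C :: real
        using that by (simp add: field_simps)
      have "0 < 1 + norm y" by (simp add: add_pos_nonneg)
      then have "(1 + norm y) powr (N + p * s) > 0" by simp
      then show ?thesis unfolding powr_minus by (rule frac[OF \<open>(1 + norm y) powr (N + p * s) \<le> c powr (N + p * s) * norm (x - y) powr (N + p * s)\<close>, rotated])
        (use pos in simp)
    qed
    have "norm (x - y) powr (- (N + p * s)) * \<bar>u y\<bar> powr (p - 1)
       \<le> c powr (N + p * s) / (1 + norm y) powr (N + p * s) * \<bar>u y\<bar> powr (p - 1)"
      using k by (intro mult_right_mono) auto
    then show ?thesis by (simp add: T_def)
  qed
  let ?\<mu> = "frac_measure s p :: ('a \<times> 'a) measure"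
  let ?d = "\<lambda>u z. u (fst z) - (u (snd z) :: real)"
  define A where "A z = ennreal (\<bar>?d u z\<bar> powr p) * indicator (U \<times> U) z + ennreal (\<bar>?d v z\<bar> powr p)" for z
  define B where "B z = indicator \<Omega> (fst z) * indicator (- U) (snd z) *
     ennreal (2 powr p * (\<bar>u (fst z)\<bar> powr (p - 1) + \<bar>u (snd z)\<bar> powr (p - 1)) * \<bar>v (fst z)\<bar>)" for z :: "'a \<times> 'a"
  have UU: "U \<times> U \<in> sets (lebesgue \<Otimes>\<^sub>M lebesgue)" by (intro pair_measureI) auto
  have Am [measurable]: "A \<in> borel_measurable (lebesgue \<Otimes>\<^sub>M lebesgue)"
    unfolding A_def[abs_def] using UU by measurable
  have ind [measurable]: "(\<lambda>\<xi>. indicator \<Omega> (fst \<xi>) :: ennreal) \<in> borel_measurable (lebesgue \<Otimes>\<^sub>M lebesgue)"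
    "(\<lambda>\<xi>. indicator (- U) (snd \<xi>) :: ennreal) \<in> borel_measurable (lebesgue \<Otimes>\<^sub>M lebesgue)"
    by (rule measurable_compose[OF measurable_fst] measurable_compose[OF measurable_snd]; measurable)+
  have Bm [measurable]: "B \<in> borel_measurable (lebesgue \<Otimes>\<^sub>M lebesgue)"
    unfolding B_def[abs_def] by measurable
  have Bsm [measurable]: "(\<lambda>\<xi>. B (prod.swap \<xi>)) \<in> borel_measurable (lebesgue \<Otimes>\<^sub>M lebesgue)"
    unfolding prod.swap_def by measurable
  have vp: "integrable lebesgue (\<lambda>x. \<bar>v x\<bar> powr p)"
    using v by (simp add: W0_def frac_sobolev0_def frac_sobolev_def Lp_space_def lebesgue_on_UNIV_eq)
  have iv: "integrable lebesgue (\<lambda>x. \<bar>v x\<bar>)"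
  proof (rule Bochner_Integration.integrable_bound)
    show "integrable lebesgue (\<lambda>x. indicator \<Omega> x + \<bar>v x\<bar> powr P)"
      using W0_powr_P(1)[OF \<Omega>(1) v order_refl] \<Omega>(1)
      by (intro Bochner_Integration.integrable_add integrable_indicator_lmeasurable) auto
    show "AE x in lebesgue. norm \<bar>v x\<bar> \<le> norm (indicator \<Omega> x + \<bar>v x\<bar> powr P)"
      using W0_zero[OF v] by eventually_elim (use abs_le_P in \<open>auto simp: indicator_def\<close>)
  qed measurable
  have up: "integrable lebesgue (\<lambda>x. indicat_real U x * \<bar>u x\<bar> powr p)"
    using iU Um by (simp add: integrable_restrict_space)
  define K where "K = c powr (N + p * s) * (\<integral>y. T y \<partial>lebesgue)"
  have K: "0 \<le> K" unfolding K_def using T0 by simp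
  define bd where "bd x = 2 powr p * (C * (indicat_real U x * \<bar>u x\<bar> powr p + \<bar>v x\<bar> powr p) + K * \<bar>v x\<bar>)" for x
  have bd: "integrable lebesgue bd" unfolding bd_def[abs_def] using up vp iv by simp
  have IB: "(\<integral>\<^sup>+z. B z \<partial>?\<mu>) < \<infinity>"
  proof -
    have "(\<integral>\<^sup>+z. B z \<partial>?\<mu>) = (\<integral>\<^sup>+x. (\<integral>\<^sup>+y. ennreal (norm (x - y) powr (- (N + p * s))) * B (x, y) \<partial>lebesgue) \<partial>lebesgue)"
      by (subst nn_integral_frac_measure) auto
    also have "\<dots> \<le> (\<integral>\<^sup>+x. ennreal (bd x) \<partial>lebesgue)"
    proof (rule nn_integral_mono)
      fix x :: 'a
      show "(\<integral>\<^sup>+y. ennreal (norm (x - y) powr (- (N + p * s))) * B (x, y) \<partial>lebesgue) \<le> ennreal (bd x)"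
      proof (cases "x \<in> \<Omega>")
        case False
        then show ?thesis by (simp add: B_def)
      next
        case True
        then have xU: "x \<in> U" using U(2) closure_subset[of \<Omega>] by auto
        define a where "a = 2 powr p * (\<bar>u x\<bar> powr (p - 1) * \<bar>v x\<bar>)"
        define b where "b = 2 powr p * \<bar>v x\<bar> * c powr (N + p * s)"
        have ab: "0 \<le> a" "0 \<le> b" by (auto simp: a_def b_def)
        have "(\<integral>\<^sup>+y. ennreal (norm (x - y) powr (- (N + p * s))) * B (x, y) \<partial>lebesgue)
          \<le> (\<integral>\<^sup>+y. ennreal a * (ennreal (norm (x - y) powr (- (N + p * s))) * indicator (- ball x d) y) + ennreal b * ennreal (T y) \<partial>lebesgue)"
        proof (rule nn_integral_mono)
          fix y :: 'a
          show "ennreal (norm (x - y) powr (- (N + p * s))) * B (x, y)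
            \<le> ennreal a * (ennreal (norm (x - y) powr (- (N + p * s))) * indicator (- ball x d) y) + ennreal b * ennreal (T y)"
          proof (cases "y \<in> U")
            case False
            let ?k = "norm (x - y) powr (- (N + p * s))"
            have nb: "y \<notin> ball x d" using d'[OF True False] by (auto simp: dist_norm)
            have "?k * (2 powr p * (\<bar>u x\<bar> powr (p - 1) + \<bar>u y\<bar> powr (p - 1)) * \<bar>v x\<bar>)
              = a * ?k + 2 powr p * \<bar>v x\<bar> * (?k * \<bar>u y\<bar> powr (p - 1))" by (simp add: a_def algebra_simps)
            also have "\<dots> \<le> a * ?k + 2 powr p * \<bar>v x\<bar> * (c powr (N + p * s) * T y)"
              using tail[OF True False] by (intro add_left_mono mult_left_mono) auto
            also have "\<dots> = a * ?k + b * T y" by (simp add: b_def)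
            finally have "ennreal (?k * (2 powr p * (\<bar>u x\<bar> powr (p - 1) + \<bar>u y\<bar> powr (p - 1)) * \<bar>v x\<bar>)) \<le> ennreal (a * ?k + b * T y)"
              by (rule ennreal_leI)
            then show ?thesis using True False nb ab T0[of y]
              by (simp add: B_def ennreal_mult ennreal_plus del: ennreal_plus[symmetric])
          qed (simp add: B_def)
        qed
        also have "\<dots> = ennreal a * (\<integral>\<^sup>+y. ennreal (norm (x - y) powr (- (N + p * s))) * indicator (- ball x d) y \<partial>lebesgue)
            + ennreal b * (\<integral>\<^sup>+y. ennreal (T y) \<partial>lebesgue)"
        proof -
          have [measurable]: "- ball x d \<in> sets lebesgue" by auto
          show ?thesis by (subst nn_integral_add) (auto simp: nn_integral_cmult)
        qed
        also have "\<dots> \<le> ennreal a * ennreal C + ennreal b * ennreal (\<integral>y. T y \<partial>lebesgue)"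
          using C(2)[of x] T0 by (intro add_mono mult_left_mono) (auto simp: nn_integral_eq_integral[OF iT])
        also have "\<dots> = ennreal (a * C + b * (\<integral>y. T y \<partial>lebesgue))"
          using ab C(1) T0 by (simp add: ennreal_mult ennreal_plus)
        also have "\<dots> \<le> ennreal (bd x)"
        proof (rule ennreal_leI)
          have "\<bar>u x\<bar> powr (p - 1) * \<bar>v x\<bar> \<le> \<bar>u x\<bar> powr p + \<bar>v x\<bar> powr p"
            using p_ge by (intro powr_mult_le_add) auto
          then have "a * C \<le> 2 powr p * (\<bar>u x\<bar> powr p + \<bar>v x\<bar> powr p) * C"
            unfolding a_def using C(1) by (intro mult_right_mono mult_left_mono) auto
          moreover have "b * (\<integral>y. T y \<partial>lebesgue) = 2 powr p * (K * \<bar>v x\<bar>)" by (simp add: b_def K_def)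
          ultimately show "a * C + b * (\<integral>y. T y \<partial>lebesgue) \<le> bd x"
            using xU by (simp add: bd_def algebra_simps)
        qed
        finally show ?thesis .
      qed
    qed
    also have "\<dots> < \<infinity>"
    proof -
      have "0 \<le> bd x" for x using C(1) K by (simp add: bd_def)
      then show ?thesis by (subst nn_integral_eq_integral[OF bd]) auto
    qed
    finally show ?thesis .
  qed
  have IA: "(\<integral>\<^sup>+z. A z \<partial>?\<mu>) < \<infinity>"
  proof -
    have "(\<integral>\<^sup>+z. A z \<partial>?\<mu>) = gagliardo s p U u + gagliardo s p UNIV v"
      unfolding A_def gagliardo_def using UU by (subst nn_integral_add) auto
    then show ?thesis using gag W0_gagliardo[OF v] by simp
  qed
  show ?thesis
  proof (rule integrableI_bounded)
    show "(\<lambda>z. signed_power p (?d u z) * ?d v z) \<in> borel_measurable ?\<mu>"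
      by (rule pairing_integrand_measurable; measurable)
    have "(\<integral>\<^sup>+z. ennreal (norm (signed_power p (?d u z) * ?d v z)) \<partial>?\<mu>) \<le> (\<integral>\<^sup>+z. A z + (B z + B (prod.swap z)) \<partial>?\<mu>)"
    proof (rule nn_integral_mono_AE)
      show "AE z in ?\<mu>. ennreal (norm (signed_power p (?d u z) * ?d v z)) \<le> A z + (B z + B (prod.swap z))"
        using AE_frac_measure[OF W0_zero[OF v], of s p]
      proof eventually_elim
        case (elim z)
        obtain x y where z: "z = (x, y)" by (cases z)
        have half: "ennreal (norm (signed_power p (u x - u y) * (v x - v y))) \<le> B (x, y)"
          if "x \<in> U" "y \<notin> U" and e: "x \<notin> \<Omega> \<longrightarrow> v x = 0" "y \<notin> \<Omega> \<longrightarrow> v y = 0" for x y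
        proof (cases "x \<in> \<Omega>")
          case True
          have vy: "v y = 0" using that closure_subset[of \<Omega>] U(2) by auto
          have "\<bar>signed_power p (u x - u y)\<bar> = \<bar>u x + - u y\<bar> powr (p - 1)" using p_ge by (simp add: abs_signed_power)
          also have "\<dots> \<le> 2 powr (p - 1) * (\<bar>u x\<bar> powr (p - 1) + \<bar>- u y\<bar> powr (p - 1))"
            using p_ge by (intro powr_abs_add_le) auto
          also have "\<dots> \<le> 2 powr p * (\<bar>u x\<bar> powr (p - 1) + \<bar>u y\<bar> powr (p - 1))"
            by (simp add: mult_right_mono)
          finally have "\<bar>signed_power p (u x - u y)\<bar> * \<bar>v x\<bar> \<le> 2 powr p * (\<bar>u x\<bar> powr (p - 1) + \<bar>u y\<bar> powr (p - 1)) * \<bar>v x\<bar>"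
            by (intro mult_right_mono) auto
          then show ?thesis using True that(2) vy by (simp add: B_def abs_mult ennreal_leI)
        next
          case False
          then show ?thesis using that closure_subset[of \<Omega>] U(2) by auto
        qed
        have swp: "norm (signed_power p (u y - u x) * (v y - v x)) = norm (signed_power p (u x - u y) * (v x - v y))"
          using signed_power_minus[of p "u x - u y"] by (simp add: abs_mult abs_minus_commute)
        have ex: "x \<notin> \<Omega> \<longrightarrow> v x = 0" and ey: "y \<notin> \<Omega> \<longrightarrow> v y = 0" using elim by (auto simp: z)
        consider "x \<in> U" "y \<in> U" | "x \<in> U" "y \<notin> U" | "x \<notin> U" "y \<in> U" | "x \<notin> U" "y \<notin> U" by blast
        then show ?case
        proof cases
          case 1
          have "ennreal (norm (signed_power p (u x - u y) * (v x - v y))) \<le> ennreal (\<bar>u x - u y\<bar> powr p + \<bar>v x - v y\<bar> powr p)"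
            using signed_power_mult_le by (intro ennreal_leI) simp
          also have "\<dots> = A z" using 1 by (simp add: z A_def)
          finally show ?thesis by (simp add: z add_increasing2)
        next
          case 2
          then show ?thesis using half[OF 2 ex ey] by (simp add: z add_increasing add_increasing2)
        next
          case 3
          then show ?thesis using half[OF 3(2,1) ey ex] unfolding swp by (simp add: z add_increasing add_increasing2)
        next
          case 4
          then have "v x = 0" "v y = 0" using ex ey closure_subset[of \<Omega>] U(2) by auto
          then show ?thesis by (simp add: z)
        qed
      qed
    qed
    also have "\<dots> = (\<integral>\<^sup>+z. A z \<partial>?\<mu>) + ((\<integral>\<^sup>+z. B z \<partial>?\<mu>) + (\<integral>\<^sup>+z. B z \<partial>?\<mu>))"
      by (simp add: nn_integral_add nn_integral_frac_measure_swap)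
    also have "\<dots> < \<infinity>" using IA IB by simp
    finally show "(\<integral>\<^sup>+z. ennreal (norm (signed_power p (?d u z) * ?d v z)) \<partial>?\<mu>) < \<infinity>" .
  qed
qed

end

context sobolev_exponents
begin

section \<open>A solution below two solutions\<close>

text \<open>The truncated right-hand side and the three comparisons described at the beginning. The growth of
\<open>f\<close> enters only through the truncated values, which are bounded by \<open>\<bar>l\<bar> + \<bar>u1\<bar> + \<bar>u2\<bar>\<close> and hence by
a function whose \<open>P\<close>-th power is integrable over \<open>\<Omega>\<close>.\<close>

lemma solution_below_two_solutions:
  fixes \<Omega> :: "'a set" and f :: "'a \<Rightarrow> real \<Rightarrow> real"
  assumes \<Omega>: "open \<Omega>" "bounded \<Omega>" "\<Omega> \<noteq> {}"
    and cara: "caratheodory \<Omega> f" and c\<^sub>0: "0 < c\<^sub>0" and q: "1 < q" "q < P"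
    and growth: "AE x in lebesgue_on \<Omega>. \<forall>t. \<bar>f x t\<bar> \<le> c\<^sub>0 * (1 + \<bar>t\<bar> powr (q - 1))"
    and sub: "subsolution s p \<Omega> f l"
    and u1: "solution s p \<Omega> f u1" "AE x in lebesgue. l x \<le> u1 x"
    and u2: "solution s p \<Omega> f u2" "AE x in lebesgue. l x \<le> u2 x"
  obtains u where "solution s p \<Omega> f u" "AE x in lebesgue. l x \<le> u x"
    "AE x in lebesgue. u x \<le> u1 x" "AE x in lebesgue. u x \<le> u2 x"
proof -
  have \<Omega>l: "\<Omega> \<in> lmeasurable" using \<Omega>(1,2) by (simp add: lmeasurable_open)
  then have \<Omega>m [measurable]: "\<Omega> \<in> sets lebesgue" by auto
  have l_tilde: "l \<in> frac_sobolev_tilde s p \<Omega>" and l_off: "AE x in lebesgue. x \<notin> \<Omega> \<longrightarrow> l x \<le> 0"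
    and l_sub: "\<And>v. v \<in> frac_sobolev0_nonneg s p \<Omega> \<Longrightarrow>
        frac_plaplacian s p l v \<le> (\<integral>x. f x (l x) * v x \<partial>lebesgue_on \<Omega>)"
    using sub by (auto simp: subsolution_def)
  have W1: "u1 \<in> W0 \<Omega>" and W2: "u2 \<in> W0 \<Omega>" using u1(1) u2(1) by (auto simp: solution_def W0_def)
  have sol: "\<And>v. v \<in> W0 \<Omega> \<Longrightarrow> frac_plaplacian s p u1 v = (\<integral>x. f x (u1 x) * v x \<partial>lebesgue_on \<Omega>)"
    "\<And>v. v \<in> W0 \<Omega> \<Longrightarrow> frac_plaplacian s p u2 v = (\<integral>x. f x (u2 x) * v x \<partial>lebesgue_on \<Omega>)"
    using u1(1) u2(1) by (auto simp: solution_def W0_def)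
  have lm [measurable]: "l \<in> borel_measurable lebesgue"
    using l_tilde by (simp add: frac_sobolev_tilde_def Lp_loc_space_def)
  have u1m [measurable]: "u1 \<in> borel_measurable lebesgue" using W1 by (rule W0_measurable)
  have u2m [measurable]: "u2 \<in> borel_measurable lebesgue" using W2 by (rule W0_measurable)
  obtain V w where V: "V \<in> lmeasurable" "\<Omega> \<subseteq> V" "w \<in> W0 V" "\<And>x. x \<in> \<Omega> \<Longrightarrow> w x = l x" "\<And>x. l x \<le> 0 \<Longrightarrow> w x \<le> 0"
    using tilde_cutoff[OF \<Omega>(2,3) l_tilde] by metis
  have wm [measurable]: "w \<in> borel_measurable lebesgue" using V(3) by (rule W0_measurable)

  have "AE x in lebesgue. x \<in> \<Omega> \<longrightarrow> continuous_on UNIV (f x)"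
    using cara by (simp add: caratheodory_def AE_restrict_space_iff)
  moreover have "AE x in lebesgue. x \<in> \<Omega> \<longrightarrow> (\<forall>t. \<bar>f x t\<bar> \<le> c\<^sub>0 * (1 + \<bar>t\<bar> powr (q - 1)))"
    using growth by (simp add: AE_restrict_space_iff)
  ultimately have "AE x in lebesgue. (x \<in> \<Omega> \<longrightarrow> continuous_on UNIV (f x)) \<and>
      (x \<in> \<Omega> \<longrightarrow> (\<forall>t. \<bar>f x t\<bar> \<le> c\<^sub>0 * (1 + \<bar>t\<bar> powr (q - 1)))) \<and> l x \<le> u1 x \<and> l x \<le> u2 x"
    using u1(2) u2(2) by eventually_elim simp
  then obtain Z where Z: "Z \<in> null_sets lebesgue" "\<And>x. x \<notin> Z \<Longrightarrow> x \<in> \<Omega> \<Longrightarrow> continuous_on UNIV (f x)"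
      "\<And>x t. x \<notin> Z \<Longrightarrow> x \<in> \<Omega> \<Longrightarrow> \<bar>f x t\<bar> \<le> c\<^sub>0 * (1 + \<bar>t\<bar> powr (q - 1))"
      "\<And>x. x \<notin> Z \<Longrightarrow> l x \<le> u1 x \<and> l x \<le> u2 x"
    unfolding eventually_ae_filter by auto
  \<comment> \<open>Setting \<open>f\<close> to zero on a null set and outside \<open>\<Omega>\<close> turns properties valid almost everywhere into pointwise ones.\<close>
  define A where "A = \<Omega> - Z"
  have Am [measurable]: "A \<in> sets lebesgue" using Z(1) by (auto simp: A_def)
  have AEA: "AE x in lebesgue. x \<in> A \<longleftrightarrow> x \<in> \<Omega>"
    using AE_not_in[OF Z(1)] by eventually_elim (auto simp: A_def)
  define F where "F x t = (if x \<in> A then f x t else 0)" for x t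
  have F_cont: "continuous_on UNIV (F x)" for x
    using Z(2)[of x] by (cases "x \<in> A") (auto simp: F_def[abs_def] A_def)
  have F_meas: "(\<lambda>x. F x t) \<in> borel_measurable lebesgue" for t
  proof -
    have "(\<lambda>x. f x t) \<in> borel_measurable (lebesgue_on \<Omega>)" using cara by (simp add: caratheodory_def)
    then have "(\<lambda>x. if x \<in> \<Omega> then f x t else 0) \<in> borel_measurable lebesgue"
      using \<Omega>m by (simp add: borel_measurable_if)
    then have "(\<lambda>x. indicat_real A x * (if x \<in> \<Omega> then f x t else 0)) \<in> borel_measurable lebesgue"
      by measurable
    moreover have "(\<lambda>x. indicat_real A x * (if x \<in> \<Omega> then f x t else 0)) = (\<lambda>x. F x t)"
      by (auto simp: F_def A_def fun_eq_iff)
    ultimately show ?thesis by simp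
  qed
  have F_comp [measurable]: "(\<lambda>x. F x (y x)) \<in> borel_measurable lebesgue" if "y \<in> borel_measurable lebesgue" for y
    by (rule caratheodory_compose_measurable[OF F_meas F_cont that])

  have rhs: "(\<integral>x. f x (y x) * v x \<partial>lebesgue_on \<Omega>) = (\<integral>x. F x (y x) * v x \<partial>lebesgue)"
    if y: "y \<in> borel_measurable lebesgue" and v: "v \<in> borel_measurable lebesgue" for y v
  proof -
    have ae: "AE x in lebesgue. F x (y x) * v x = indicat_real \<Omega> x *\<^sub>R (f x (y x) * v x)"
      using AEA by eventually_elim (auto simp: F_def)
    have m: "(\<lambda>x. F x (y x) * v x) \<in> borel_measurable lebesgue" using F_comp[OF y] v by measurable
    have "(\<integral>x. f x (y x) * v x \<partial>lebesgue_on \<Omega>) = (\<integral>x. indicat_real \<Omega> x *\<^sub>R (f x (y x) * v x) \<partial>lebesgue)"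
      by (rule integral_restrict_space) auto
    also have "\<dots> = (\<integral>x. F x (y x) * v x \<partial>lebesgue)"
      using borel_measurable_AE[OF m ae] m ae by (intro integral_cong_AE) auto
    finally show ?thesis .
  qed

  define T where "T y x t = max (l x) (min t (y x))" for y :: "'a \<Rightarrow> real" and x t
  define g where "g x t = min (F x (T u1 x t)) (F x (T u2 x t))" for x t
  define m where "m x = indicat_real \<Omega> x * (1 + \<bar>l x\<bar> + \<bar>u1 x\<bar> + \<bar>u2 x\<bar>)" for x
  have m_meas [measurable]: "m \<in> borel_measurable lebesgue" unfolding m_def[abs_def] by measurable
  have m0: "0 \<le> m x" for x by (simp add: m_def)
  have F_bound: "\<bar>F x t\<bar> \<le> 2 * c\<^sub>0 * m x powr (P - 1)" if t: "\<bar>t\<bar> \<le> \<bar>l x\<bar> + \<bar>u1 x\<bar> + \<bar>u2 x\<bar>" for x t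
  proof (cases "x \<in> A")
    case True
    then have mx: "m x = 1 + \<bar>l x\<bar> + \<bar>u1 x\<bar> + \<bar>u2 x\<bar>" by (simp add: m_def A_def)
    have "\<bar>t\<bar> powr (q - 1) \<le> m x powr (q - 1)" using t q unfolding mx by (intro powr_mono2) auto
    also have "\<dots> \<le> m x powr (P - 1)" using q unfolding mx by (intro powr_mono) auto
    finally have 1: "\<bar>t\<bar> powr (q - 1) \<le> m x powr (P - 1)" .
    have 2: "1 \<le> m x powr (P - 1)" using q unfolding mx by (intro ge_one_powr_ge_zero) auto
    have "\<bar>F x t\<bar> \<le> c\<^sub>0 * (1 + \<bar>t\<bar> powr (q - 1))" using Z(3)[of x t] True by (simp add: F_def A_def)
    also have "\<dots> \<le> c\<^sub>0 * (m x powr (P - 1) + m x powr (P - 1))" using 1 2 c\<^sub>0 by (intro mult_left_mono add_mono) auto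
    finally show ?thesis by simp
  qed (use c\<^sub>0 in \<open>simp add: F_def\<close>)
  have T_bound: "\<bar>T y x t\<bar> \<le> \<bar>l x\<bar> + \<bar>y x\<bar>" if "l x \<le> y x" for y x t
    using that by (auto simp: T_def)
  have T_bound': "\<bar>F x (T y x t)\<bar> \<le> 2 * c\<^sub>0 * m x powr (P - 1)" if y: "y = u1 \<or> y = u2" for x y t
  proof (cases "x \<in> A")
    case True
    then show ?thesis using y T_bound[of x y t] Z(4)[of x] by (intro F_bound) (auto simp: A_def)
  qed (use c\<^sub>0 in \<open>simp add: F_def\<close>)
  have iP: "integrable lebesgue (\<lambda>x. m x powr P)"
  proof (rule Bochner_Integration.integrable_bound)
    show "integrable lebesgue (\<lambda>x. 2 powr P * (2 powr P * (indicat_real \<Omega> x + \<bar>w x\<bar> powr P) + 2 powr P * (\<bar>u1 x\<bar> powr P + \<bar>u2 x\<bar> powr P)))"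
      using W0_powr_P(1)[OF V(1) V(3) order_refl] W0_powr_P(1)[OF \<Omega>l W1 order_refl] W0_powr_P(1)[OF \<Omega>l W2 order_refl]
        integrable_indicator_lmeasurable[OF \<Omega>l] by simp
    show "AE x in lebesgue. norm (m x powr P) \<le> norm (2 powr P * (2 powr P * (indicat_real \<Omega> x + \<bar>w x\<bar> powr P) + 2 powr P * (\<bar>u1 x\<bar> powr P + \<bar>u2 x\<bar> powr P)))"
    proof (rule AE_I2)
      fix x
      have P0: "0 \<le> P" using P_gt_2 by simp
      show "norm (m x powr P) \<le> norm (2 powr P * (2 powr P * (indicat_real \<Omega> x + \<bar>w x\<bar> powr P) + 2 powr P * (\<bar>u1 x\<bar> powr P + \<bar>u2 x\<bar> powr P)))"
      proof (cases "x \<in> \<Omega>")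
        case True
        have "m x powr P = \<bar>(1 + \<bar>l x\<bar>) + (\<bar>u1 x\<bar> + \<bar>u2 x\<bar>)\<bar> powr P" using True by (simp add: m_def add.assoc)
        also have "\<dots> \<le> 2 powr P * (\<bar>1 + \<bar>l x\<bar>\<bar> powr P + \<bar>\<bar>u1 x\<bar> + \<bar>u2 x\<bar>\<bar> powr P)" by (rule powr_abs_add_le[OF P0])
        also have "\<dots> \<le> 2 powr P * (2 powr P * (1 + \<bar>w x\<bar> powr P) + 2 powr P * (\<bar>u1 x\<bar> powr P + \<bar>u2 x\<bar> powr P))"
          using powr_abs_add_le[OF P0, of 1 "\<bar>l x\<bar>"] powr_abs_add_le[OF P0, of "\<bar>u1 x\<bar>" "\<bar>u2 x\<bar>"] V(4)[OF True]
          by (intro mult_left_mono add_mono) auto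
        finally show ?thesis using True by simp
      qed (simp add: m_def)
    qed
  qed measurable
  interpret B: bounded_rhs "TYPE('a)" N s p \<Omega> g m "2 * c\<^sub>0"
  proof
    fix t :: real
    have "(\<lambda>x. T y x t) \<in> borel_measurable lebesgue" if "y \<in> borel_measurable lebesgue" for y
      using that unfolding T_def by measurable
    then show "(\<lambda>x. g x t) \<in> borel_measurable lebesgue"
      unfolding g_def by (intro borel_measurable_min F_comp) auto
  next
    fix x
    have "continuous_on UNIV (\<lambda>t. F x (T y x t))" for y
      unfolding T_def by (rule continuous_on_compose2[OF F_cont]) (auto intro!: continuous_intros)
    then show "continuous_on UNIV (g x)" unfolding g_def[abs_def] by (intro continuous_intros) auto
  next
    fix x t
    show "\<bar>g x t\<bar> \<le> 2 * c\<^sub>0 * m x powr (P - 1)" using T_bound'[of u1 x t] T_bound'[of u2 x t] by (auto simp: g_def min_def)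
  qed (use \<Omega>l \<Omega>(2) m0 iP c\<^sub>0 in auto)
  obtain u where u: "u \<in> W0 \<Omega>" "\<And>v. v \<in> W0 \<Omega> \<Longrightarrow> frac_plaplacian s p u v = (\<integral>x. g x (u x) * v x \<partial>lebesgue)"
    by (rule B.weak_solution_exists) blast
  have um [measurable]: "u \<in> borel_measurable lebesgue" using u(1) by (rule W0_measurable)
  have g_comp: "(\<lambda>x. g x (u x)) \<in> borel_measurable lebesgue"
    by (rule caratheodory_compose_measurable[OF B.g_measurable B.g_continuous um])
  have bounded_pairing: "integrable lebesgue (\<lambda>x. k x * v x)"
    if k: "k \<in> borel_measurable lebesgue" "\<And>x. \<bar>k x\<bar> \<le> 2 * c\<^sub>0 * m x powr (P - 1)" and v: "v \<in> W0 \<Omega>" for k v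
  proof (rule Bochner_Integration.integrable_bound[OF B.h_mult_integrable[OF v]])
    show "AE x in lebesgue. norm (k x * v x) \<le> norm (B.h x * \<bar>v x\<bar>)"
    proof (rule AE_I2)
      fix x
      show "norm (k x * v x) \<le> norm (B.h x * \<bar>v x\<bar>)"
      proof -
        have "\<bar>k x\<bar> * \<bar>v x\<bar> \<le> B.h x * \<bar>v x\<bar>"
          using k(2)[of x] unfolding B.h_def by (rule mult_right_mono) simp
        then show ?thesis using B.h_nonneg[of x] by (simp add: abs_mult)
      qed
    qed
    show "(\<lambda>x. k x * v x) \<in> borel_measurable lebesgue" using k(1) W0_measurable[OF v] by measurable
  qed

  have upper: "AE x in lebesgue. u x \<le> y x"
    if y: "y \<in> W0 \<Omega>" "\<And>v. v \<in> W0 \<Omega> \<Longrightarrow> frac_plaplacian s p y v = (\<integral>x. f x (y x) * v x \<partial>lebesgue_on \<Omega>)"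
      and bd: "\<And>x. \<bar>y x\<bar> \<le> \<bar>l x\<bar> + \<bar>u1 x\<bar> + \<bar>u2 x\<bar>"
      and gle: "\<And>x. x \<in> A \<Longrightarrow> y x < u x \<Longrightarrow> g x (u x) \<le> F x (y x)" for y
  proof (rule comparison[OF \<Omega>l])
    have ym: "y \<in> borel_measurable lebesgue" using y(1) by (rule W0_measurable)
    let ?v = "\<lambda>x. max 0 (u x - y x)"
    show v: "?v \<in> W0 \<Omega>" by (rule W0_positive_part[OF \<Omega>l W0_diff[OF \<Omega>l u(1) y(1)]])
    show "integrable (frac_measure s p) (\<lambda>\<xi>. signed_power p (u (fst \<xi>) - u (snd \<xi>)) * (?v (fst \<xi>) - ?v (snd \<xi>)))"
      by (rule W0_pairing_integrable[OF u(1) v])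
    show "integrable (frac_measure s p) (\<lambda>\<xi>. signed_power p (y (fst \<xi>) - y (snd \<xi>)) * (?v (fst \<xi>) - ?v (snd \<xi>)))"
      by (rule W0_pairing_integrable[OF y(1) v])
    have "frac_plaplacian s p u ?v = (\<integral>x. g x (u x) * ?v x \<partial>lebesgue)" by (rule u(2)[OF v])
    also have "\<dots> \<le> (\<integral>x. F x (y x) * ?v x \<partial>lebesgue)"
    proof (rule integral_mono)
      show "integrable lebesgue (\<lambda>x. g x (u x) * ?v x)"
        by (rule bounded_pairing[OF g_comp B.g_bound v])
      show "integrable lebesgue (\<lambda>x. F x (y x) * ?v x)"
        by (rule bounded_pairing[OF F_comp[OF ym] F_bound[OF bd] v])
      fix x
      show "g x (u x) * ?v x \<le> F x (y x) * ?v x"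
      proof (cases "x \<in> A \<and> y x < u x")
        case True
        then show ?thesis using gle[of x] by (intro mult_right_mono) auto
      next
        case False
        then show ?thesis by (cases "x \<in> A") (auto simp: g_def F_def)
      qed
    qed
    also have "\<dots> = frac_plaplacian s p y ?v"
      using y(2)[OF v] rhs[OF ym W0_measurable[OF v]] by simp
    finally show "frac_plaplacian s p u ?v \<le> frac_plaplacian s p y ?v" .
  qed
  have le1: "AE x in lebesgue. u x \<le> u1 x"
  proof (rule upper[OF W1 sol(1)])
    fix x assume "x \<in> A" "u1 x < u x"
    then have "T u1 x (u x) = u1 x" using Z(4)[of x] by (auto simp: T_def A_def)
    then show "g x (u x) \<le> F x (u1 x)" by (simp add: g_def)
  qed auto
  have le2: "AE x in lebesgue. u x \<le> u2 x"
  proof (rule upper[OF W2 sol(2)])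
    fix x assume "x \<in> A" "u2 x < u x"
    then have "T u2 x (u x) = u2 x" using Z(4)[of x] by (auto simp: T_def A_def)
    then show "g x (u x) \<le> F x (u2 x)" by (simp add: g_def)
  qed auto
  have ge: "AE x in lebesgue. l x \<le> u x"
  proof (rule comparison[OF \<Omega>l])
    let ?v = "\<lambda>x. max 0 (l x - u x)"
    \<comment> \<open>The test function agrees almost everywhere with the one built from the cutoff \<open>w\<close> of \<open>l\<close>.\<close>
    have wv: "(\<lambda>x. max 0 (w x - u x)) \<in> W0 V"
      by (rule W0_positive_part[OF V(1) W0_diff[OF V(1,3) W0_mono[OF V(2) u(1)]]])
    have eq: "AE x in lebesgue. max 0 (w x - u x) = ?v x"
      using l_off W0_zero[OF u(1)] by eventually_elim (use V(4,5) in force)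
    have off: "AE x in lebesgue. x \<notin> \<Omega> \<longrightarrow> ?v x = 0"
      using l_off W0_zero[OF u(1)] by eventually_elim auto
    show v: "?v \<in> W0 \<Omega>" unfolding W0_iff[OF \<Omega>l]
      using off W0_gagliardo[OF wv] gagliardo_cong_AE[OF eq, of s p] by auto
    have vn: "?v \<in> frac_sobolev0_nonneg s p \<Omega>"
      using v by (simp add: W0_def frac_sobolev0_nonneg_def)
    show "integrable (frac_measure s p) (\<lambda>\<xi>. signed_power p (u (fst \<xi>) - u (snd \<xi>)) * (?v (fst \<xi>) - ?v (snd \<xi>)))"
      by (rule W0_pairing_integrable[OF u(1) v])
    show "integrable (frac_measure s p) (\<lambda>\<xi>. signed_power p (l (fst \<xi>) - l (snd \<xi>)) * (?v (fst \<xi>) - ?v (snd \<xi>)))"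
      by (rule tilde_pairing_integrable[OF \<Omega>l \<Omega>(2) l_tilde v])
    have "frac_plaplacian s p l ?v \<le> (\<integral>x. f x (l x) * ?v x \<partial>lebesgue_on \<Omega>)" by (rule l_sub[OF vn])
    also have "\<dots> = (\<integral>x. F x (l x) * ?v x \<partial>lebesgue)" by (rule rhs[OF lm W0_measurable[OF v]])
    also have "\<dots> = (\<integral>x. g x (u x) * ?v x \<partial>lebesgue)"
    proof (rule Bochner_Integration.integral_cong[OF refl])
      fix x
      show "F x (l x) * ?v x = g x (u x) * ?v x"
      proof (cases "x \<in> A \<and> u x < l x")
        case True
        then have "T u1 x (u x) = l x" "T u2 x (u x) = l x" by (auto simp: T_def)
        then show ?thesis by (simp add: g_def)
      next
        case False
        then show ?thesis by (cases "x \<in> A") (auto simp: g_def F_def)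
      qed
    qed
    also have "\<dots> = frac_plaplacian s p u ?v" by (rule u(2)[OF v, symmetric])
    finally show "frac_plaplacian s p l ?v \<le> frac_plaplacian s p u ?v" .
  qed
  have "solution s p \<Omega> f u" unfolding solution_def W0_def[symmetric]
  proof (intro conjI ballI u(1))
    fix v assume v: "v \<in> W0 \<Omega>"
    have vm: "v \<in> borel_measurable lebesgue" using v by (rule W0_measurable)
    have "frac_plaplacian s p u v = (\<integral>x. g x (u x) * v x \<partial>lebesgue)" by (rule u(2)[OF v])
    also have "\<dots> = (\<integral>x. F x (u x) * v x \<partial>lebesgue)"
    proof (rule integral_cong_AE)
      show "AE x in lebesgue. g x (u x) * v x = F x (u x) * v x"
        using le1 le2 ge by eventually_elim (simp add: g_def T_def max_def min_def)
      show "(\<lambda>x. g x (u x) * v x) \<in> borel_measurable lebesgue" using g_comp vm by measurable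
      show "(\<lambda>x. F x (u x) * v x) \<in> borel_measurable lebesgue" using F_comp[OF um] vm by measurable
    qed
    also have "\<dots> = (\<integral>x. f x (u x) * v x \<partial>lebesgue_on \<Omega>)" by (rule rhs[OF um vm, symmetric])
    finally show "frac_plaplacian s p u v = (\<integral>x. f x (u x) * v x \<partial>lebesgue_on \<Omega>)" .
  qed
  then show thesis using that ge le1 le2 by blast
qed

section \<open>Reflection and directedness\<close>

lemma gagliardo_uminus: "gagliardo s p U (\<lambda>x. - u x) = gagliardo s p U u"
  for u :: "'a \<Rightarrow> real"
proof -
  have "\<bar>- a - - b\<bar> = \<bar>a - b\<bar>" for a b :: real by simp
  then show ?thesis unfolding gagliardo_def by (simp only:)
qed

lemma frac_sobolev0_uminus:
  fixes u :: "'a \<Rightarrow> real"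
  assumes "u \<in> frac_sobolev0 s p \<Omega>"
  shows "(\<lambda>x. - u x) \<in> frac_sobolev0 s p \<Omega>"
  using assms by (auto simp: frac_sobolev0_def frac_sobolev_def Lp_space_def gagliardo_uminus)

lemma frac_sobolev_tilde_uminus:
  fixes u :: "'a \<Rightarrow> real"
  assumes "u \<in> frac_sobolev_tilde s p \<Omega>"
  shows "(\<lambda>x. - u x) \<in> frac_sobolev_tilde s p \<Omega>"
  using assms by (auto simp: frac_sobolev_tilde_def frac_sobolev_def Lp_space_def Lp_loc_space_def gagliardo_uminus)

lemma solution_uminus:
  fixes u :: "'a \<Rightarrow> real"
  assumes "solution s p \<Omega> f u"
  shows "solution s p \<Omega> (\<lambda>x t. - f x (- t)) (\<lambda>x. - u x)"
  using assms by (auto simp: solution_def frac_sobolev0_uminus frac_plaplacian_uminus_left)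

lemma supersolution_uminus:
  fixes u :: "'a \<Rightarrow> real"
  assumes "supersolution s p \<Omega> f u"
  shows "subsolution s p \<Omega> (\<lambda>x t. - f x (- t)) (\<lambda>x. - u x)"
  using assms
  by (auto simp: supersolution_def subsolution_def frac_sobolev_tilde_uminus frac_plaplacian_uminus_left
      elim: eventually_mono)

lemma caratheodory_uminus:
  fixes f :: "'a \<Rightarrow> real \<Rightarrow> real"
  assumes "caratheodory \<Omega> f"
  shows "caratheodory \<Omega> (\<lambda>x t. - f x (- t))"
proof -
  have "continuous_on UNIV (\<lambda>t. - f x (- t))" if "continuous_on UNIV (f x)" for x
    using that by (intro continuous_intros continuous_on_compose2[OF that]) auto
  then show ?thesis using assms by (auto simp: caratheodory_def elim: eventually_mono)
qed

end

theorem lemma3p3: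
  fixes \<Omega> :: "'a::euclidean_space set"
    and f :: "'a \<Rightarrow> real \<Rightarrow> real"
    and u_low u_up :: "'a \<Rightarrow> real"
    and s p q c\<^sub>0 :: real
  assumes "DIM('a) > 1" and "p \<ge> 2" and "0 < s" and "s < 1" and "real DIM('a) > p * s"
    and "open \<Omega>" and "connected \<Omega>" and "\<Omega> \<noteq> {}" and "bounded \<Omega>" and "C11_boundary \<Omega>"
    and "caratheodory \<Omega> f"
    and "c\<^sub>0 > 0" and "p < q" and "q < real DIM('a) * p / (real DIM('a) - p * s)"
    and "AE x in lebesgue_on \<Omega>. \<forall>t. \<bar>f x t\<bar> \<le> c\<^sub>0 * (1 + \<bar>t\<bar> powr (q - 1))"
    and "u_low \<in> frac_sobolev_tilde s p \<Omega>" and "u_up \<in> frac_sobolev_tilde s p \<Omega>"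
    and "sub_supersolution_pair s p \<Omega> f u_low u_up"
  shows "\<forall>u\<^sub>1 \<in> solution_set s p \<Omega> f u_low u_up. \<forall>u\<^sub>2 \<in> solution_set s p \<Omega> f u_low u_up.
           \<exists>u\<^sub>3 \<in> solution_set s p \<Omega> f u_low u_up. \<exists>u\<^sub>4 \<in> solution_set s p \<Omega> f u_low u_up.
             (AE x in lebesgue. u\<^sub>3 x \<le> u\<^sub>1 x) \<and> (AE x in lebesgue. u\<^sub>3 x \<le> u\<^sub>2 x) \<and>
             (AE x in lebesgue. u\<^sub>4 x \<ge> u\<^sub>1 x) \<and> (AE x in lebesgue. u\<^sub>4 x \<ge> u\<^sub>2 x)"
proof (intro ballI)
  define N where "N = real DIM('a)"
  interpret sobolev_exponents "TYPE('a)" N s p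
    by unfold_locales (use assms(2-5) in \<open>simp_all add: N_def\<close>)
  have q: "1 < q" "q < P" using assms(2,13) assms(14)[folded N_def] unfolding P_def by linarith+
  fix u\<^sub>1 u\<^sub>2
  assume u1: "u\<^sub>1 \<in> solution_set s p \<Omega> f u_low u_up" and u2: "u\<^sub>2 \<in> solution_set s p \<Omega> f u_low u_up"
  have sub: "subsolution s p \<Omega> f u_low" and super: "supersolution s p \<Omega> f u_up"
    using assms(18) by (auto simp: sub_supersolution_pair_def)
  have s1: "solution s p \<Omega> f u\<^sub>1" "AE x in lebesgue. u_low x \<le> u\<^sub>1 x \<and> u\<^sub>1 x \<le> u_up x"
    using u1 by (auto simp: solution_set_def)
  have s2: "solution s p \<Omega> f u\<^sub>2" "AE x in lebesgue. u_low x \<le> u\<^sub>2 x \<and> u\<^sub>2 x \<le> u_up x"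
    using u2 by (auto simp: solution_set_def)
  obtain u\<^sub>3 where u3: "solution s p \<Omega> f u\<^sub>3" "AE x in lebesgue. u_low x \<le> u\<^sub>3 x"
    "AE x in lebesgue. u\<^sub>3 x \<le> u\<^sub>1 x" "AE x in lebesgue. u\<^sub>3 x \<le> u\<^sub>2 x"
    by (rule solution_below_two_solutions[OF assms(6,9,8,11,12) q assms(15) sub s1(1) _ s2(1)])
      (use s1(2) s2(2) in \<open>auto elim: eventually_mono\<close>)
  obtain u where u: "solution s p \<Omega> (\<lambda>x t. - f x (- t)) u" "AE x in lebesgue. - u_up x \<le> u x"
    "AE x in lebesgue. u x \<le> - u\<^sub>1 x" "AE x in lebesgue. u x \<le> - u\<^sub>2 x"
  proof (rule solution_below_two_solutions[OF assms(6,9,8) caratheodory_uminus[OF assms(11)] assms(12) q _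
        supersolution_uminus[OF super] solution_uminus[OF s1(1)] _ solution_uminus[OF s2(1)]])
    show "AE x in lebesgue_on \<Omega>. \<forall>t. \<bar>- f x (- t)\<bar> \<le> c\<^sub>0 * (1 + \<bar>t\<bar> powr (q - 1))"
      using assms(15)
    proof eventually_elim
      case (elim x)
      show ?case
      proof
        fix t show "\<bar>- f x (- t)\<bar> \<le> c\<^sub>0 * (1 + \<bar>t\<bar> powr (q - 1))" using elim[rule_format, of "- t"] by simp
      qed
    qed
  qed (use s1(2) s2(2) in \<open>auto elim: eventually_mono\<close>)
  define u\<^sub>4 where "u\<^sub>4 x = - u x" for x
  have u4: "solution s p \<Omega> f u\<^sub>4" using solution_uminus[OF u(1)] by (simp add: u\<^sub>4_def[abs_def])
  have "AE x in lebesgue. u_low x \<le> u\<^sub>3 x \<and> u\<^sub>3 x \<le> u_up x"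
    using s1(2) u3(2,3) by eventually_elim auto
  then have m3: "u\<^sub>3 \<in> solution_set s p \<Omega> f u_low u_up" using u3(1) by (simp add: solution_set_def solution_def)
  have "AE x in lebesgue. u_low x \<le> u\<^sub>4 x \<and> u\<^sub>4 x \<le> u_up x"
    using s1(2) u(2,3) by eventually_elim (auto simp: u\<^sub>4_def)
  then have m4: "u\<^sub>4 \<in> solution_set s p \<Omega> f u_low u_up" using u4 by (simp add: solution_set_def solution_def)
  have "AE x in lebesgue. u\<^sub>4 x \<ge> u\<^sub>1 x" "AE x in lebesgue. u\<^sub>4 x \<ge> u\<^sub>2 x"
    using u(3,4) by (simp_all add: u\<^sub>4_def le_minus_iff)
  then show "\<exists>u\<^sub>3 \<in> solution_set s p \<Omega> f u_low u_up. \<exists>u\<^sub>4 \<in> solution_set s p \<Omega> f u_low u_up.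
             (AE x in lebesgue. u\<^sub>3 x \<le> u\<^sub>1 x) \<and> (AE x in lebesgue. u\<^sub>3 x \<le> u\<^sub>2 x) \<and>
             (AE x in lebesgue. u\<^sub>4 x \<ge> u\<^sub>1 x) \<and> (AE x in lebesgue. u\<^sub>4 x \<ge> u\<^sub>2 x)"
    using m3 m4 u3(3,4) by blast
qed

end
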